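(* Let $H$ be a graph containing a cycle. Suppose that there are positive constants $\alpha$ and $A$ such that $\mathrm{ex}(n,H) \le A n^{\alpha}$ for all positive integers $n$. Then there exists a constant $C$ depending only on $\alpha$, $A$, and $H$ such that for all $n$, \[ |\mathcal{F}_n(H)| \le 2^{C n^{\alpha}}. \]
   Context: For a graph $H$, $\mathrm{ex}(n,H)$ denotes the maximum number of edges in an $n$-vertex graph that does not contain $H$ as a (not necessarily induced) subgraph. $\mathcal{F}_n(H)$ denotes the set of all labeled $H$-free graphs on the vertex set $[n]=\{1,\dots,n\}$. *)

theory Defs
  imports Complex_Main
begin

type_synonym 'a graph = "'a set \<times> 'a set set"

abbreviation verts :: "'a graph \<Rightarrow> 'a set" where "verts G \<equiv> fst G"
abbreviation edges :: "'a graph \<Rightarrow> 'a set set" where "edges G \<equiv> snd G"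

definition finite_simple_graph :: "'a graph \<Rightarrow> bool" where
  "finite_simple_graph G \<longleftrightarrow>
     finite (verts G) \<and> (\<forall>e\<in>edges G. e \<subseteq> verts G \<and> card e = 2)"

text \<open>A not necessarily induced copy of the graph \<open>H\<close> inside the graph \<open>G\<close>.\<close>

definition contains_copy :: "'b graph \<Rightarrow> 'a graph \<Rightarrow> bool" where
  "contains_copy G H \<longleftrightarrow>
     (\<exists>f. inj_on f (verts H) \<and> f ` verts H \<subseteq> verts G \<and> (\<forall>e\<in>edges H. f ` e \<in> edges G))"

text \<open>This is a cycle only for \<open>k \<ge> 3\<close>.\<close>

definition cycle_graph :: "nat \<Rightarrow> nat graph" where
  "cycle_graph k = ({..<k}, {{i, (i + 1) mod k} |i. i < k})"

definition contains_cycle :: "'a graph \<Rightarrow> bool" where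
  "contains_cycle G \<longleftrightarrow> (\<exists>k\<ge>3. contains_copy G (cycle_graph k))"

text \<open>Every finite graph is isomorphic to one whose vertices are natural numbers, so it
  suffices to range over those. For \<open>H\<close> with an edge the set of edge numbers is finite and
  nonempty (lemmas below), so \<open>Max\<close> is the intended maximum.\<close>

definition ex_number :: "nat \<Rightarrow> 'a graph \<Rightarrow> nat" where
  "ex_number n H = Max {card (edges G) |G :: nat graph.
     finite_simple_graph G \<and> card (verts G) = n \<and> \<not> contains_copy G H}"

definition labeled_free_graphs :: "nat \<Rightarrow> 'a graph \<Rightarrow> nat graph set" where
  "labeled_free_graphs n H =
     {G. finite_simple_graph G \<and> verts G = {1..n} \<and> \<not> contains_copy G H}"

lemma finite_edge_numbers:
  "finite {card (edges G) |G :: nat graph.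
     finite_simple_graph G \<and> card (verts G) = n \<and> \<not> contains_copy G H}" (is "finite ?S")
proof (rule finite_subset)
  show "?S \<subseteq> {..2 ^ n}"
  proof
    fix m assume "m \<in> ?S"
    then obtain G :: "nat graph" where
      G: "m = card (edges G)" "finite_simple_graph G" "card (verts G) = n" by blast
    then have "edges G \<subseteq> Pow (verts G)" "finite (verts G)"
      by (auto simp: finite_simple_graph_def)
    then have "m \<le> card (Pow (verts G))"
      using G(1) by (simp add: card_mono)
    then show "m \<in> {..2 ^ n}"
      using G(3) \<open>finite (verts G)\<close> by (simp add: card_Pow)
  qed
qed simp

lemma edge_numbers_nonempty:
  assumes "edges H \<noteq> {}"
  shows "{card (edges G) |G :: nat graph.
     finite_simple_graph G \<and> card (verts G) = n \<and> \<not> contains_copy G H} \<noteq> {}"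
proof -
  let ?G = "({..<n}, {}) :: nat graph"
  have "finite_simple_graph ?G \<and> card (verts ?G) = n \<and> \<not> contains_copy ?G H"
    using assms by (auto simp: finite_simple_graph_def contains_copy_def)
  then show ?thesis by blast
qed

lemma finite_labeled_free_graphs: "finite (labeled_free_graphs n H)"
proof (rule finite_subset)
  show "labeled_free_graphs n H \<subseteq> {{1..n}} \<times> Pow (Pow {1..n})"
    by (fastforce simp: labeled_free_graphs_def finite_simple_graph_def subset_eq)
qed simp

end

(* A graph G with t n^\<alpha> edges contains, for large t, a family of copies of H all of whose
   codegrees are as small as in a random graph: copies are added greedily, and a random set of
   n / t^(1 / (2 - \<alpha>)) vertices shows that a new copy avoiding all saturated edge sets exists
   while the family is too small. Hypergraph containers then cover the H-free subgraphs of G by few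
   graphs with (1 - c) t n^\<alpha> edges, and the cost of iterating down to t = O(1) is a convergent
   geometric series. Convergence needs \<alpha> to exceed the deletion method exponent
   2 - (v_F - 2) / (e_F - 1) strictly for every subgraph F of H with at least two edges. This
   follows from the assumption on ex(n, H), because that lower bound can be improved by an
   arbitrary constant factor: in a random F-free graph whose edge sets have about the right
   probabilities, delete a small proportion \<delta> of the edges at random; a positive proportion of
   the missing pairs becomes available, and however small that proportion is, the number of edges
   that can be added does not tend to 0 with \<delta> (after scaling by n^(2 - (v_F - 2) / (e_F - 1))). *)

theory Submission
  imports Defs "HOL-Probability.Probability"
begin

section \<open>Hypergraph containers\<close>

text \<open>Gaining an arbitrary constant factor rests on an invariant with two numbers:
  \<open>B\<close> bounds the probability that k given edges are all present by (B n^(-\<theta>))^k,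
  and \<open>K\<close> bounds the expected edge number from below by K n^(2 - \<theta>). A round
  with parameter \<kappa> raises them by 2 \<kappa> and \<kappa> / 16. How small \<kappa> must be
  depends on \<open>B\<close>, but the ratio of the two increments does not, so a cap on
  \<open>B\<close> is known before \<kappa> is chosen. The obstacle is correlation: several pairs
  may rely on the deletion of the same edge, and then they do not join the graph independently. Two
  copies through different pairs that share such an edge cost a factor n^(-\<epsilon>), provided
  that H is replaced by a strictly balanced subgraph; so for fixed \<kappa> the error vanishes as n
  grows. Each round inspects two further copies and thereby turns control of edge sets of size s +
  2e into control of size s, which is why the invariant speaks about all s.\<close>

definition wdeg :: "'v set \<Rightarrow> ('v set \<Rightarrow> real) \<Rightarrow> 'v set \<Rightarrow> real" where
  "wdeg V w T = (\<Sum>A | A \<subseteq> V \<and> T \<subseteq> A. w A)"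

definition indep :: "('v set \<Rightarrow> real) \<Rightarrow> 'v set \<Rightarrow> bool" where
  "indep w I \<longleftrightarrow> (\<forall>A\<subseteq>I. w A = 0)"

section \<open>Sums of binomial coefficients\<close>

definition binsum :: "nat \<Rightarrow> nat \<Rightarrow> nat" where
  "binsum m b = (\<Sum>i\<le>b. m choose i)"

lemma binsum_pos: "1 \<le> binsum m b"
proof -
  have "(m choose 0) \<le> binsum m b"
    unfolding binsum_def by (rule member_le_sum) auto
  then show ?thesis by simp
qed

text \<open>This is the branching of the decision tree below: skipping a vertex keeps the budget
  \<open>Suc b\<close>, picking it leaves \<open>b\<close>.\<close>

lemma binsum_pascal: "binsum (Suc m) (Suc b) = binsum m (Suc b) + binsum m b"
proof -
  have "binsum (Suc m) (Suc b) = 1 + (\<Sum>i\<le>b. Suc m choose Suc i)"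
    unfolding binsum_def by (subst sum.atMost_Suc_shift) simp
  also have "\<dots> = 1 + (\<Sum>i\<le>b. m choose Suc i) + (\<Sum>i\<le>b. m choose i)"
    by (simp add: sum.distrib)
  also have "1 + (\<Sum>i\<le>b. m choose Suc i) = binsum m (Suc b)"
    unfolding binsum_def by (subst sum.atMost_Suc_shift) simp
  finally show ?thesis by (simp add: binsum_def)
qed

text \<open>Weighting the i-th term by x^i \<ge> x^b turns the sum into part of (1 + x)^m. With
  \<open>x\<close> the codegree ratio and \<open>b\<close> about x m, the logarithm of the bound is
  of order x m (1 + ln (1 / x)).\<close>

lemma binsum_le:
  fixes x :: real
  assumes "0 < x" "x \<le> 1"
  shows "real (binsum m b) \<le> (1/x) ^ b * exp (x * real m)"
proof -
  have "real (binsum m b) * x ^ b = (\<Sum>i\<le>b. real (m choose i) * x ^ b)"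
    by (simp add: binsum_def sum_distrib_right)
  also have "\<dots> \<le> (\<Sum>i\<le>b. real (m choose i) * x ^ i)"
    using assms by (intro sum_mono mult_left_mono power_decreasing) auto
  also have "\<dots> = (\<Sum>i\<in>{..b} \<inter> {..m}. real (m choose i) * x ^ i)"
    by (rule sum.mono_neutral_right) (auto simp: binomial_eq_0)
  also have "\<dots> \<le> (\<Sum>i\<le>m. real (m choose i) * x ^ i)"
    using assms by (intro sum_mono2) auto
  also have "\<dots> = (x + 1) ^ m"
    by (subst binomial_ring) simp
  also have "\<dots> \<le> exp x ^ m"
    using assms exp_ge_add_one_self[of x] by (intro power_mono) (auto simp: add.commute)
  also have "\<dots> = exp (x * real m)"
    by (simp add: exp_of_nat_mult[symmetric] mult.commute)
  finally show ?thesis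
    using assms by (simp add: field_simps)
qed

lemma finite_Pow_sub: "finite V \<Longrightarrow> finite {A. A \<subseteq> V \<and> P A}"
  by (rule finite_subset[of _ "Pow V"]) auto

lemma wdeg_mono:
  assumes "finite V" "\<And>A. A \<subseteq> V \<Longrightarrow> w A \<le> w' A"
  shows "wdeg V w T \<le> wdeg V w' T"
  unfolding wdeg_def using assms by (intro sum_mono) auto

lemma wdeg_nonneg: "(\<And>A. 0 \<le> w A) \<Longrightarrow> 0 \<le> wdeg V w T"
  unfolding wdeg_def by (simp add: sum_nonneg)

lemma sum_wdeg:
  fixes w :: "'v set \<Rightarrow> real"
  assumes V: "finite V"
  shows "(\<Sum>T\<in>Pow V. wdeg V w T) = (\<Sum>A\<in>Pow V. 2 ^ card A * w A)"
proof -
  have "(\<Sum>T\<in>Pow V. wdeg V w T) = (\<Sum>T\<in>Pow V. \<Sum>A\<in>Pow V. if T \<subseteq> A then w A else 0)"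
    using V by (intro sum.cong refl) (auto simp: wdeg_def sum.If_cases intro!: sum.cong)
  also have "\<dots> = (\<Sum>A\<in>Pow V. \<Sum>T\<in>Pow V. if T \<subseteq> A then w A else 0)"
    by (rule sum.swap)
  also have "\<dots> = (\<Sum>A\<in>Pow V. 2 ^ card A * w A)"
  proof (rule sum.cong[OF refl])
    fix A assume A: "A \<in> Pow V"
    then have "Pow V \<inter> {T. T \<subseteq> A} = Pow A" by auto
    moreover have "finite A" using A V finite_subset by auto
    ultimately show "(\<Sum>T\<in>Pow V. if T \<subseteq> A then w A else 0) = 2 ^ card A * w A"
      using V by (simp add: sum.If_cases card_Pow)
  qed
  finally show ?thesis .
qed

lemma sum_wdeg_singleton:
  fixes w :: "'v set \<Rightarrow> real"
  assumes V: "finite V"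
  shows "(\<Sum>v\<in>V. wdeg V w {v}) = (\<Sum>A\<in>Pow V. card A * w A)"
proof -
  have "(\<Sum>v\<in>V. wdeg V w {v}) = (\<Sum>v\<in>V. \<Sum>A\<in>Pow V. if v \<in> A then w A else 0)"
    using V by (intro sum.cong refl) (auto simp: wdeg_def sum.If_cases intro!: sum.cong)
  also have "\<dots> = (\<Sum>A\<in>Pow V. \<Sum>v\<in>V. if v \<in> A then w A else 0)"
    by (rule sum.swap)
  also have "\<dots> = (\<Sum>A\<in>Pow V. card A * w A)"
  proof (rule sum.cong[OF refl])
    fix A assume A: "A \<in> Pow V"
    then have "V \<inter> A = A" by auto
    then show "(\<Sum>v\<in>V. if v \<in> A then w A else 0) = card A * w A"
      using V by (simp add: sum.If_cases)
  qed
  finally show ?thesis .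
qed

section \<open>One level of the container algorithm\<close>

locale container_step =
  fixes V :: "'v set" and w :: "'v set \<Rightarrow> real" and s :: nat and K p W :: real
  assumes finV: "finite V"
    and w_nonneg: "\<And>A. 0 \<le> w A"
    and w_unif: "\<And>A. w A \<noteq> 0 \<Longrightarrow> A \<subseteq> V \<and> card A = Suc s"
    and K_pos: "0 < K" and p_pos: "0 < p" and W_pos: "0 < W"
    and W_eq: "W = (\<Sum>A\<in>Pow V. w A)"
    and V_ne: "V \<noteq> {}"
    and deg_bound: "\<And>T. T \<subseteq> V \<Longrightarrow> T \<noteq> {} \<Longrightarrow> wdeg V w T \<le> K * p ^ (card T - 1) * W / card V"
begin

text \<open>\<open>u\<close> collects the links of the picked vertices; a set is saturated once its degree in \<open>u\<close>
  is as large as the degree condition for uniformity \<open>s\<close> allows, and \<open>rem u\<close> discards the edges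
  that contain a saturated set.\<close>

definition sat :: "('v set \<Rightarrow> real) \<Rightarrow> 'v set \<Rightarrow> bool" where
  "sat u T \<longleftrightarrow> T \<noteq> {} \<and> T \<subseteq> V \<and> K * p ^ card T * W / card V \<le> wdeg V u T"

definition rem :: "('v set \<Rightarrow> real) \<Rightarrow> 'v set \<Rightarrow> real" where
  "rem u A = (if \<exists>T\<subseteq>A. sat u T then 0 else w A)"

definition upd :: "('v set \<Rightarrow> real) \<Rightarrow> 'v \<Rightarrow> 'v set \<Rightarrow> real" where
  "upd u v B = u B + (if v \<notin> B then rem u (insert v B) else 0)"

text \<open>The factor 2 in the degree bound is the allowance below saturation plus one further
  link. The last clause records the greedy choice: each picked vertex had at least the degree that
  any vertex still available has now, and it contributed its degree to the mass of
  \<open>u\<close>.\<close>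

definition Inv :: "'v set \<Rightarrow> 'v set \<Rightarrow> ('v set \<Rightarrow> real) \<Rightarrow> bool" where
  "Inv F Av u \<longleftrightarrow> F \<subseteq> V \<and> Av \<subseteq> V \<and> F \<inter> Av = {} \<and> (\<forall>B. 0 \<le> u B) \<and>
     (\<forall>B. u B \<noteq> 0 \<longrightarrow> B \<subseteq> V \<and> card B = s) \<and>
     (\<forall>T\<subseteq>V. T \<noteq> {} \<longrightarrow> wdeg V u T \<le> 2 * K * p ^ card T * W / card V) \<and>
     (\<forall>v\<in>Av. card F * wdeg V (rem u) {v} \<le> sum u (Pow V))"

lemma Inv_sets:
  assumes "Inv F Av u"
  shows "F \<subseteq> V" "Av \<subseteq> V" "F \<inter> Av = {}" "0 \<le> u B"
  using assms by (simp_all add: Inv_def)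

lemma card_V_pos: "0 < card V"
  using finV V_ne by (simp add: card_gt_0_iff)

lemma rem_nonneg: "0 \<le> rem u A" and rem_le: "rem u A \<le> w A"
  using w_nonneg by (auto simp: rem_def)

lemma wdeg_upd:
  assumes "v \<in> V" "T \<subseteq> V"
  shows "wdeg V (upd u v) T = wdeg V u T + (if v \<in> T then 0 else wdeg V (rem u) (insert v T))"
proof -
  have "wdeg V (upd u v) T = wdeg V u T +
      (\<Sum>B | B \<subseteq> V \<and> T \<subseteq> B. if v \<notin> B then rem u (insert v B) else 0)"
    by (simp add: wdeg_def upd_def sum.distrib)
  also have "(\<Sum>B | B \<subseteq> V \<and> T \<subseteq> B. if v \<notin> B then rem u (insert v B) else 0) =
      (\<Sum>B | (B \<subseteq> V \<and> T \<subseteq> B) \<and> v \<notin> B. rem u (insert v B))"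
    using finV by (subst sum.If_cases) (auto intro!: sum.cong finite_Pow_sub)
  also have "\<dots> = (if v \<in> T then 0 else wdeg V (rem u) (insert v T))"
  proof (cases "v \<in> T")
    case False
    have "(\<Sum>B | (B \<subseteq> V \<and> T \<subseteq> B) \<and> v \<notin> B. rem u (insert v B)) =
        (\<Sum>A | A \<subseteq> V \<and> insert v T \<subseteq> A. rem u A)"
      using assms False
      by (intro sum.reindex_bij_witness[of _ "\<lambda>A. A - {v}" "insert v"]) (auto simp: insert_absorb)
    then show ?thesis using False by (simp add: wdeg_def)
  qed (auto intro!: sum.neutral)
  finally show ?thesis .
qed

lemma sum_upd:
  assumes "v \<in> V"
  shows "sum (upd u v) (Pow V) = sum u (Pow V) + wdeg V (rem u) {v}"
proof -
  have "wdeg V x {} = sum x (Pow V)" for x :: "'v set \<Rightarrow> real"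
    by (simp add: wdeg_def Pow_def)
  then show ?thesis using wdeg_upd[OF assms, of "{}" u] by simp
qed

lemma upd_ge: "u B \<le> upd u v B"
  using rem_nonneg by (simp add: upd_def)

lemma rem_upd_le: "rem (upd u v) A \<le> rem u A"
proof -
  have "sat u T \<Longrightarrow> sat (upd u v) T" for T
    unfolding sat_def using wdeg_mono[OF finV, of u "upd u v" T] upd_ge[of u _ v] by force
  then show ?thesis using w_nonneg by (auto simp: rem_def)
qed

lemma Inv_skip:
  assumes "Inv F Av u"
  shows "Inv F (Av - {v}) u"
proof -
  have "Av - {v} \<subseteq> V" "F \<inter> (Av - {v}) = {}" using Inv_sets[OF assms] by blast+
  then show ?thesis using assms by (simp add: Inv_def)
qed

lemma Inv_pick:
  assumes I: "Inv F Av u" and v: "v \<in> Av"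
    and mx: "\<And>x. x \<in> Av \<Longrightarrow> wdeg V (rem u) {x} \<le> wdeg V (rem u) {v}"
  shows "Inv (insert v F) (Av - {v}) (upd u v)"
proof -
  have vV: "v \<in> V" and vF: "v \<notin> F" and finF: "finite F"
    using Inv_sets[OF I] v finV finite_subset[of F V] by auto
  have nn: "0 \<le> upd u v B" for B
    using Inv_sets(4)[OF I] upd_ge[of u B v] by (rule order_trans)
  have unif: "B \<subseteq> V \<and> card B = s" if B: "upd u v B \<noteq> 0" for B
  proof (cases "u B = 0")
    case True
    then have "v \<notin> B" "rem u (insert v B) \<noteq> 0" using B by (auto simp: upd_def split: if_splits)
    then have "w (insert v B) \<noteq> 0" by (auto simp: rem_def split: if_splits)
    then have "insert v B \<subseteq> V" "card (insert v B) = Suc s" using w_unif by auto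
    moreover from this have "finite B" using finV finite_subset by auto
    ultimately show ?thesis using \<open>v \<notin> B\<close> by simp
  qed (use I in \<open>auto simp: Inv_def\<close>)
  have deg: "wdeg V (upd u v) T \<le> 2 * K * p ^ card T * W / card V" if T: "T \<subseteq> V" "T \<noteq> {}" for T
  proof (cases "v \<in> T \<or> sat u T")
    case True
    \<comment> \<open>Every edge that contains a saturated set has been discarded, so the degree of
      such a set in \<open>u\<close> is frozen.\<close>
    have "wdeg V (rem u) (insert v T) = 0" if "sat u T"
      unfolding wdeg_def by (rule sum.neutral) (use that in \<open>auto simp: rem_def\<close>)
    then have "wdeg V (upd u v) T = wdeg V u T"
      using wdeg_upd[OF vV T(1), of u] True by auto
    then show ?thesis using I T by (simp add: Inv_def)
  next
    case False
    have finT: "finite T" using T finV finite_subset by blast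
    have "wdeg V (rem u) (insert v T) \<le> wdeg V w (insert v T)"
      by (rule wdeg_mono[OF finV rem_le])
    also have "\<dots> \<le> K * p ^ (card (insert v T) - 1) * W / card V"
      using deg_bound T vV by auto
    also have "\<dots> = K * p ^ card T * W / card V"
      using False finT by simp
    finally have "wdeg V (rem u) (insert v T) \<le> K * p ^ card T * W / card V" .
    moreover have "wdeg V u T < K * p ^ card T * W / card V"
      using False T by (auto simp: sat_def)
    moreover have "wdeg V (upd u v) T = wdeg V u T + wdeg V (rem u) (insert v T)"
      using wdeg_upd[OF vV T(1), of u] False by simp
    ultimately have "wdeg V (upd u v) T \<le> K * p ^ card T * W / card V + K * p ^ card T * W / card V"
      by (metis add_mono less_imp_le)
    also have "\<dots> = 2 * K * p ^ card T * W / card V"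
      by (simp add: field_simps)
    finally show ?thesis .
  qed
  have mass: "card (insert v F) * wdeg V (rem (upd u v)) {x} \<le> sum (upd u v) (Pow V)"
    if x: "x \<in> Av" for x
  proof -
    have "wdeg V (rem (upd u v)) {x} \<le> wdeg V (rem u) {x}"
      by (rule wdeg_mono[OF finV rem_upd_le])
    also note mx[OF x]
    finally have "card (insert v F) * wdeg V (rem (upd u v)) {x} \<le>
        card (insert v F) * wdeg V (rem u) {v}"
      by (intro mult_left_mono) auto
    also have "\<dots> = card F * wdeg V (rem u) {v} + wdeg V (rem u) {v}"
      using vF finF by (simp add: algebra_simps)
    also have "\<dots> \<le> sum u (Pow V) + wdeg V (rem u) {v}"
      using I v unfolding Inv_def by simp
    finally show ?thesis using sum_upd[OF vV] by simp
  qed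
  have "insert v F \<subseteq> V" "Av - {v} \<subseteq> V" "insert v F \<inter> (Av - {v}) = {}"
    using Inv_sets[OF I] vV by blast+
  then show ?thesis
    unfolding Inv_def using nn unif deg mass by simp
qed

text \<open>A set of the link of \<open>v\<close> inside \<open>I\<close> would together with
  \<open>v\<close> be an edge of \<open>w\<close> inside \<open>I\<close>. Hence an independent set
  containing the fingerprint stays independent in \<open>u\<close>, and \<open>u\<close> can be
  handed to the next level.\<close>

lemma indep_upd:
  assumes "indep w I" "indep u I" "v \<in> I"
  shows "indep (upd u v) I"
  unfolding indep_def
proof (intro allI impI)
  fix A assume A: "A \<subseteq> I"
  have "w (insert v A) = 0" using A assms(1,3) unfolding indep_def by (meson insert_subset)
  moreover have "u A = 0" using A assms(2) unfolding indep_def by blast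
  ultimately show "upd u v A = 0" by (simp add: upd_def rem_def)
qed

text \<open>A leaf keeps \<open>u'\<close> besides the candidate \<open>F' \<union> Av'\<close>: if
  the candidate is too large to be a container, \<open>u'\<close> is the hypergraph of smaller
  uniformity with which the search continues.\<close>

definition tree_covered :: "'v set \<Rightarrow> 'v set \<Rightarrow> ('v set \<Rightarrow> real) \<Rightarrow> nat \<Rightarrow>
    ('v set \<times> 'v set \<times> ('v set \<Rightarrow> real)) set \<Rightarrow> bool" where
  "tree_covered F Av u b L \<longleftrightarrow>
    (\<forall>(F', Av', u')\<in>L. Inv F' Av' u' \<and> card F' \<le> b \<and> (card F' = b \<or> Av' = {})) \<and>
    (\<forall>I. indep w I \<longrightarrow> indep u I \<longrightarrow> F \<subseteq> I \<longrightarrow> I \<subseteq> F \<union> Av \<longrightarrow>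
       (\<exists>(F', Av', u')\<in>L. I \<subseteq> F' \<union> Av' \<and> indep u' I))"

lemma tree_leaf:
  assumes "Inv F Av u" "card F \<le> b" "card F = b \<or> Av = {}"
  shows "\<exists>L. finite L \<and> card L \<le> binsum m r \<and> tree_covered F Av u b L"
proof (intro exI conjI)
  show "finite {(F, Av, u)}" by (rule finite.intros) (rule finite.intros)
  show "card {(F, Av, u)} \<le> binsum m r" using binsum_pos[of m r] by simp
  show "tree_covered F Av u b {(F, Av, u)}"
    unfolding tree_covered_def using assms by blast
qed

text \<open>The decision tree of the container algorithm: a vertex of maximum degree is either declared
  to lie outside the independent set or put into the fingerprint \<open>F\<close>.\<close>

lemma decision_tree:
  assumes "Inv F Av u" "card F + r = b"
  shows "\<exists>L. finite L \<and> card L \<le> binsum (card Av) r \<and> tree_covered F Av u b L"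
  using assms
proof (induction "card Av" arbitrary: F Av u r)
  case 0
  have "Av \<subseteq> V" using Inv_sets[OF 0(2)] by auto
  then have "Av = {}" using 0(1) finV finite_subset[of Av V] by simp
  then show ?case
    using 0 by (intro tree_leaf) auto
next
  case (Suc a)
  have "F \<subseteq> V" "Av \<subseteq> V" using Inv_sets[OF Suc.prems(1)] by auto
  then have finAv: "finite Av" and finF: "finite F"
    using finV finite_subset by blast+
  show ?case
  proof (cases r)
    case 0
    then show ?thesis
      using Suc.prems by (intro tree_leaf) auto
  next
    case r: (Suc r')
    have "Av \<noteq> {}" using Suc.hyps by auto
    let ?f = "\<lambda>x. wdeg V (rem u) {x}"
    have "Max (?f ` Av) \<in> ?f ` Av" using finAv \<open>Av \<noteq> {}\<close> by (intro Max_in) auto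
    then obtain v where v: "v \<in> Av" and "Max (?f ` Av) = ?f v" by blast
    then have mx: "?f x \<le> ?f v" if "x \<in> Av" for x
      using Max_ge[of "?f ` Av" "?f x"] finAv that by auto
    have ca: "a = card (Av - {v})" using Suc.hyps v finAv by simp
    have vF: "v \<notin> F" using Inv_sets(3)[OF Suc.prems(1)] v by blast
    from Suc.hyps(1)[OF ca Inv_skip[OF Suc.prems(1)] Suc.prems(2)]
    obtain L1 where L1: "finite L1" "card L1 \<le> binsum a r" "tree_covered F (Av - {v}) u b L1"
      using ca by auto
    have "card (insert v F) + r' = b" using vF finF Suc.prems(2) r by simp
    from Suc.hyps(1)[OF ca Inv_pick[OF Suc.prems(1) v mx] this]
    obtain L2 where L2: "finite L2" "card L2 \<le> binsum a r'"
      "tree_covered (insert v F) (Av - {v}) (upd u v) b L2"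
      using ca by auto
    have cover: "\<exists>(F', Av', u')\<in>L1 \<union> L2. I \<subseteq> F' \<union> Av' \<and> indep u' I"
      if I: "indep w I" "indep u I" "F \<subseteq> I" "I \<subseteq> F \<union> Av" for I
    proof (cases "v \<in> I")
      case True
      then have "insert v F \<subseteq> I" "I \<subseteq> insert v F \<union> (Av - {v})" using I by blast+
      then have "\<exists>(F', Av', u')\<in>L2. I \<subseteq> F' \<union> Av' \<and> indep u' I"
        using L2(3) I(1) indep_upd[OF I(1,2) True] unfolding tree_covered_def by blast
      then show ?thesis by blast
    next
      case False
      then have "I \<subseteq> F \<union> (Av - {v})" using I by blast
      then have "\<exists>(F', Av', u')\<in>L1. I \<subseteq> F' \<union> Av' \<and> indep u' I"
        using L1(3) I unfolding tree_covered_def by blast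
      then show ?thesis by blast
    qed
    have "tree_covered F Av u b (L1 \<union> L2)"
      using cover L1(3) L2(3) unfolding tree_covered_def by (simp add: ball_Un)
    moreover have "card (L1 \<union> L2) \<le> binsum (card Av) r"
      using card_Un_le[of L1 L2] L1(2) L2(2) binsum_pascal[of a r'] Suc.hyps(2) r by simp
    ultimately show ?thesis
      using L1(1) L2(1) finite_UnI by blast
  qed
qed

lemma small_container:
  assumes I: "Inv F Av u" and b: "p * card V \<le> b" "real b \<le> card V / (4 * K)"
    and F: "card F \<le> b" "card F = b \<or> Av = {}"
    and small: "sum u (Pow V) < (1/2) ^ Suc s * p * W" and s: "s \<ge> 1"
    and "Av \<noteq> {}"
  shows "card (F \<union> Av) \<le> (1 - 1 / (2 * K)) * card V"
proof -
  let ?m = "real (card V)" and ?g = "(1/2::real) ^ Suc s"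
  have cF: "card F = b" using F \<open>Av \<noteq> {}\<close> by auto
  have m: "?m > 0" using card_V_pos by simp
  have b0: "real b > 0" using b(1) p_pos m by (smt (verit) mult_pos_pos)
  have unn: "0 \<le> u B" for B using I by (simp add: Inv_def)
  have lowdeg: "wdeg V (rem u) {v} \<le> ?g * W / ?m" if "v \<in> Av" for v
  proof -
    have "real b * wdeg V (rem u) {v} \<le> ?g * p * W"
      using I that cF small unfolding Inv_def by fastforce
    also have "?g * p * W \<le> ?g * W / ?m * b"
    proof -
      have "?g * W / ?m * (p * ?m) \<le> ?g * W / ?m * b"
        using b W_pos m by (intro mult_left_mono) auto
      then show ?thesis using m by (simp add: field_simps)
    qed
    finally have "real b * wdeg V (rem u) {v} \<le> real b * (?g * W / ?m)"
      by (simp only: mult.commute)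
    then show ?thesis using b0 by (simp only: mult_le_cancel_left_pos)
  qed
  have killed: "(\<Sum>T | sat u T. wdeg V w T) \<le> W / 2"
  proof -
    have "(\<Sum>T | sat u T. wdeg V w T) \<le> (\<Sum>T | sat u T. wdeg V u T / p)"
    proof (rule sum_mono)
      fix T assume "T \<in> {T. sat u T}"
      then have T: "sat u T" by simp
      then have TV: "T \<subseteq> V" "T \<noteq> {}" by (auto simp: sat_def)
      then have "card T > 0" using finV by (simp add: card_gt_0_iff finite_subset)
      then have pw: "p ^ card T = p * p ^ (card T - 1)" by (cases "card T") auto
      have "wdeg V w T * p \<le> (K * p ^ (card T - 1) * W / ?m) * p"
        using deg_bound[OF TV] p_pos by (intro mult_right_mono) auto
      also have "\<dots> = K * p ^ card T * W / ?m" using pw by simp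
      also have "\<dots> \<le> wdeg V u T" using T by (simp add: sat_def)
      finally show "wdeg V w T \<le> wdeg V u T / p" using p_pos by (simp add: field_simps)
    qed
    also have "\<dots> = (\<Sum>T | sat u T. wdeg V u T) / p" by (simp add: sum_divide_distrib)
    also have "(\<Sum>T | sat u T. wdeg V u T) \<le> (\<Sum>T\<in>Pow V. wdeg V u T)"
      using finV unn by (intro sum_mono2) (auto simp: sat_def intro: wdeg_nonneg)
    also have "\<dots> = (\<Sum>A\<in>Pow V. 2 ^ s * u A)"
      unfolding sum_wdeg[OF finV] using I by (intro sum.cong) (auto simp: Inv_def)
    also have "\<dots> = 2 ^ s * sum u (Pow V)" by (simp add: sum_distrib_left)
    also have "\<dots> \<le> 2 ^ s * (?g * p * W)" using small by (intro mult_left_mono) auto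
    also have "\<dots> = p * W / 2" by (simp add: power_one_over)
    finally show ?thesis using p_pos by (simp add: divide_right_mono)
  qed
  have fsat: "finite {T. sat u T}"
    by (rule finite_subset[of _ "Pow V"]) (use finV in \<open>auto simp: sat_def\<close>)
  have "W - sum (rem u) (Pow V) = (\<Sum>A\<in>Pow V. w A - rem u A)"
    by (simp add: W_eq sum_subtractf)
  also have "\<dots> \<le> (\<Sum>A\<in>Pow V. \<Sum>T | sat u T. if T \<subseteq> A then w A else 0)"
  proof (rule sum_mono)
    fix A assume "A \<in> Pow V"
    show "w A - rem u A \<le> (\<Sum>T | sat u T. if T \<subseteq> A then w A else 0)"
    proof (cases "\<exists>T\<subseteq>A. sat u T")
      case True
      then obtain T where T: "T \<subseteq> A" "sat u T" by blast
      then have "w A - rem u A = (if T \<subseteq> A then w A else 0)" by (auto simp: rem_def)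
      also have "\<dots> \<le> (\<Sum>T | sat u T. if T \<subseteq> A then w A else 0)"
        using T fsat w_nonneg by (intro member_le_sum) auto
      finally show ?thesis .
    next
      case False
      then show ?thesis using w_nonneg by (auto simp: rem_def intro!: sum_nonneg)
    qed
  qed
  also have "\<dots> = (\<Sum>T | sat u T. \<Sum>A\<in>Pow V. if T \<subseteq> A then w A else 0)"
    by (rule sum.swap)
  also have "\<dots> = (\<Sum>T | sat u T. wdeg V w T)"
    using finV by (intro sum.cong refl) (auto simp: wdeg_def sum.If_cases intro!: sum.cong)
  finally have "sum (rem u) (Pow V) \<ge> W / 2" using killed by simp
  \<comment> \<open>Edges have s + 1 \<ge> 2 vertices, so the degree sum counts each surviving edge
    at least twice and makes up for the lost half.\<close>
  moreover have "sum (rem u) (Pow V) * (real s + 1) \<ge> sum (rem u) (Pow V) * 2"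
    using s by (intro mult_left_mono sum_nonneg) (auto simp: rem_nonneg)
  moreover have "(\<Sum>v\<in>V. wdeg V (rem u) {v}) = (\<Sum>A\<in>Pow V. (real s + 1) * rem u A)"
    unfolding sum_wdeg_singleton[OF finV]
  proof (intro sum.cong refl)
    fix A
    show "card A * rem u A = (real s + 1) * rem u A"
      using w_unif[of A] by (cases "w A = 0") (auto simp: rem_def)
  qed
  ultimately have low: "W \<le> (\<Sum>v\<in>V. wdeg V (rem u) {v})"
    by (simp add: sum_distrib_left[symmetric] mult.commute)
  have AvV: "Av \<subseteq> V" using I by (simp add: Inv_def)
  have "(\<Sum>v\<in>V. wdeg V (rem u) {v}) =
      (\<Sum>v\<in>Av. wdeg V (rem u) {v}) + (\<Sum>v\<in>V - Av. wdeg V (rem u) {v})"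
    using sum.subset_diff[OF AvV finV, of "\<lambda>v. wdeg V (rem u) {v}"] by linarith
  also have "(\<Sum>v\<in>Av. wdeg V (rem u) {v}) \<le> card Av * (?g * W / ?m)"
    using sum_mono[OF lowdeg, of Av] by simp
  also have "\<dots> \<le> ?m * (?g * W / ?m)"
    using W_pos m finV AvV by (intro mult_right_mono) (auto simp: card_mono)
  also have "\<dots> \<le> W / 4"
  proof -
    have "?g \<le> (1/2) ^ 2" using s by (intro power_decreasing) auto
    then have "?g \<le> 1/4" by (simp add: power2_eq_square)
    then show ?thesis using m W_pos by simp
  qed
  also have "(\<Sum>v\<in>V - Av. wdeg V (rem u) {v}) \<le> (\<Sum>v\<in>V - Av. K * W / ?m)"
  proof (rule sum_mono)
    fix v assume "v \<in> V - Av"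
    then have "wdeg V w {v} \<le> K * W / ?m" using deg_bound[of "{v}"] by simp
    then show "wdeg V (rem u) {v} \<le> K * W / ?m"
      using wdeg_mono[OF finV, of "rem u" w "{v}"] rem_le by force
  qed
  finally have "W \<le> W / 4 + card (V - Av) * (K * W / ?m)" using low by simp
  then have "W * (3/4) \<le> W * (card (V - Av) * K / ?m)" by (simp add: field_simps)
  then have "3/4 \<le> card (V - Av) * K / ?m" using W_pos by (simp only: mult_le_cancel_left_pos)
  then have "3/4 * ?m / K \<le> card (V - Av)" using m K_pos by (simp add: field_simps)
  moreover have "card (V - Av) = ?m - card Av"
    using AvV finV by (simp add: card_Diff_subset finite_subset of_nat_diff card_mono)
  moreover have "real (card (F \<union> Av)) \<le> b + card Av"
    using card_Un_le[of F Av] cF by linarith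
  ultimately have "real (card (F \<union> Av)) \<le> b + ?m - 3/4 * ?m / K" by linarith
  also have "\<dots> \<le> ?m / (4 * K) + ?m - 3/4 * ?m / K" using b by simp
  also have "\<dots> = (1 - 1 / (2 * K)) * ?m" using K_pos by (simp add: field_simps)
  finally show "real (card (F \<union> Av)) \<le> (1 - 1 / (2 * K)) * ?m" .
qed

end

section \<open>Containers by induction on the uniformity\<close>

definition spread_hypergraph ::
    "nat \<Rightarrow> real \<Rightarrow> 'v set \<Rightarrow> ('v set \<Rightarrow> real) \<Rightarrow> real \<Rightarrow> bool" where
  "spread_hypergraph s K V w p \<longleftrightarrow> finite V \<and> V \<noteq> {} \<and> (\<forall>A. 0 \<le> w A) \<and>
     (\<forall>A. w A \<noteq> 0 \<longrightarrow> A \<subseteq> V \<and> card A = s) \<and> 0 < sum w (Pow V) \<and> 0 < p \<and>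
     (\<forall>T\<subseteq>V. T \<noteq> {} \<longrightarrow> wdeg V w T \<le> K * p ^ (card T - 1) * sum w (Pow V) / card V)"

text \<open>The exponent \<open>s\<close> appears because each lowering of the uniformity multiplies
  the number of containers by the number of leaves of one decision tree.\<close>

definition has_containers :: "nat \<Rightarrow> real \<Rightarrow> 'v set \<Rightarrow> ('v set \<Rightarrow> real) \<Rightarrow> nat \<Rightarrow> bool" where
  "has_containers s c V w b \<longleftrightarrow> (\<exists>\<C>. finite \<C> \<and> card \<C> \<le> binsum (card V) b ^ s \<and>
     (\<forall>C\<in>\<C>. C \<subseteq> V \<and> real (card C) \<le> (1 - c) * real (card V)) \<and>
     (\<forall>I\<subseteq>V. indep w I \<longrightarrow> (\<exists>C\<in>\<C>. I \<subseteq> C)))"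

text \<open>An independent set avoids all vertices of positive weight, and the degree bound forces
  at least a proportion 1 / K of the vertices to be of this kind.\<close>

lemma containers_uniformity_1:
  assumes K: "0 < K" and H: "spread_hypergraph 1 K V w p"
  shows "has_containers 1 (1 / K) V w b"
proof -
  let ?m = "real (card V)" and ?W = "sum w (Pow V)" and ?S = "{v\<in>V. w {v} \<noteq> 0}"
  have fin: "finite V" and m: "?m > 0" and W: "?W > 0"
    and unif: "\<And>A. w A \<noteq> 0 \<Longrightarrow> card A = 1"
    using H by (auto simp: spread_hypergraph_def card_gt_0_iff)
  have "?W = (\<Sum>v\<in>V. wdeg V w {v})"
    unfolding sum_wdeg_singleton[OF fin]
    by (rule sum.cong) (use unif in \<open>fastforce+\<close>)
  also have "\<dots> = (\<Sum>v\<in>?S. wdeg V w {v})"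
  proof (rule sum.mono_neutral_right)
    show "\<forall>v\<in>V - ?S. wdeg V w {v} = 0"
    proof
      fix v assume v: "v \<in> V - ?S"
      have "w A = 0" if "v \<in> A" for A
      proof (rule ccontr)
        assume "w A \<noteq> 0"
        moreover from unif[OF this] that have "A = {v}" by (auto simp: card_1_singleton_iff)
        ultimately show False using v by auto
      qed
      then show "wdeg V w {v} = 0" by (simp add: wdeg_def)
    qed
  qed (use fin in auto)
  also have "\<dots> \<le> (\<Sum>v\<in>?S. K * ?W / ?m)"
  proof (rule sum_mono)
    fix v assume "v \<in> ?S"
    then have "{v} \<subseteq> V" "{v} \<noteq> {}" by auto
    then have "wdeg V w {v} \<le> K * p ^ (card {v} - 1) * ?W / ?m"
      using H unfolding spread_hypergraph_def by blast
    then show "wdeg V w {v} \<le> K * ?W / ?m" by simp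
  qed
  finally have "?W * 1 \<le> ?W * (card ?S * K / ?m)" by (simp add: mult_ac)
  then have "1 \<le> card ?S * K / ?m" using W by (simp only: mult_le_cancel_left_pos)
  then have "?m / K \<le> card ?S" using m K by (simp add: field_simps)
  moreover have "real (card (V - ?S)) = ?m - card ?S"
    using fin by (subst card_Diff_subset) (auto simp: of_nat_diff card_mono)
  ultimately have "real (card (V - ?S)) \<le> (1 - 1 / K) * ?m" by (simp add: field_simps)
  moreover have "I \<subseteq> V - ?S" if "I \<subseteq> V" "indep w I" for I
    using that unfolding indep_def by auto
  ultimately show ?thesis
    unfolding has_containers_def using binsum_pos[of "card V" b]
    by (intro exI[of _ "{V - ?S}"]) auto
qed

text \<open>At each leaf of the decision tree either \<open>u\<close> is light and
  \<open>F \<union> Av\<close> itself is a container, or \<open>u\<close> is heavy and again a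
  spread hypergraph, of uniformity \<open>s\<close>, so that the induction hypothesis supplies
  containers.\<close>

lemma containers_step:
  assumes s: "s \<ge> 1" and K: "0 < K" and c: "0 < c"
    and IH: "\<And>(V :: 'v set) w p b. \<lbrakk>spread_hypergraph s (2 ^ (s + 2) * K) V w p;
      p * real (card V) \<le> b; real b \<le> c * real (card V)\<rbrakk> \<Longrightarrow> has_containers s c V w b"
    and H: "spread_hypergraph (Suc s) K (V :: 'v set) w p"
    and b: "p * real (card V) \<le> b" "real b \<le> d * real (card V)"
    and d: "d \<le> c" "d \<le> 1 / (4 * K)" "d \<le> 1 / 2"
  shows "has_containers (Suc s) d V w b"
proof -
  let ?m = "real (card V)" and ?W = "sum w (Pow V)"
  interpret container_step V w s K p ?W
    using H K by unfold_locales (auto simp: spread_hypergraph_def)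
  have m: "?m > 0" using card_V_pos by simp
  have "Inv {} V (\<lambda>_. 0)"
    using K_pos p_pos W_pos by (auto simp: Inv_def wdeg_def)
  from decision_tree[OF this, of b b] obtain L
    where L: "finite L" "card L \<le> binsum (card V) b" "tree_covered {} V (\<lambda>_. 0) b L" by auto
  have ex: "\<exists>\<C>. finite \<C> \<and> card \<C> \<le> binsum (card V) b ^ s \<and>
      (\<forall>C\<in>\<C>. C \<subseteq> V \<and> real (card C) \<le> (1 - d) * real (card V)) \<and>
      (\<forall>I\<subseteq>V. I \<subseteq> F \<union> Av \<longrightarrow> indep u I \<longrightarrow> (\<exists>C\<in>\<C>. I \<subseteq> C))" if x: "(F, Av, u) \<in> L" for F Av u
  proof -
    have I: "Inv F Av u" and F: "card F \<le> b" "card F = b \<or> Av = {}"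
      using x L(3) unfolding tree_covered_def by auto
    show ?thesis
    proof (cases "sum u (Pow V) < (1/2) ^ Suc s * p * ?W")
      case True
      have "card (F \<union> Av) \<le> (1 - d) * ?m"
      proof (cases "Av = {}")
        case True
        have "real (card F) \<le> d * ?m" using F(1) b(2) by linarith
        also have "\<dots> \<le> (1 - d) * ?m" using d(3) m by (intro mult_right_mono) auto
        finally show ?thesis using True by simp
      next
        case False
        have "real b \<le> 1 / (4 * K) * ?m"
          using b(2) d(2) m by (meson mult_right_mono less_imp_le order_trans)
        then have "card (F \<union> Av) \<le> (1 - 1 / (2 * K)) * ?m"
          using small_container[OF I b(1) _ F True s False] by (simp add: field_simps)
        also have "\<dots> \<le> (1 - d) * ?m"
        proof (rule mult_right_mono)
          have "1 / (4 * K) \<le> 1 / (2 * K)" using K by (intro divide_left_mono) auto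
          then show "1 - 1 / (2 * K) \<le> 1 - d" using d(2) by linarith
        qed simp
        finally show ?thesis .
      qed
      then show ?thesis
        using Inv_sets(1,2)[OF I] binsum_pos[of "card V" b] by (intro exI[of _ "{F \<union> Av}"]) auto
    next
      case False
      then have big: "(1/2) ^ Suc s * p * ?W \<le> sum u (Pow V)" by simp
      have pos: "0 < (1/2) ^ Suc s * p * ?W" using p_pos W_pos by simp
      have "wdeg V u T \<le> 2 ^ (s + 2) * K * p ^ (card T - 1) * sum u (Pow V) / card V"
        if T: "T \<subseteq> V" "T \<noteq> {}" for T
      proof -
        have "card T > 0" using T finV by (simp add: card_gt_0_iff finite_subset)
        then have pw: "p ^ card T = p * p ^ (card T - 1)" by (cases "card T") auto
        have "wdeg V u T \<le> 2 * K * p ^ card T * ?W / ?m"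
          using I T unfolding Inv_def by blast
        \<comment> \<open>The 2 of the invariant and the mass threshold (1/2)^(s + 1) combine to the
          new constant 2^(s + 2) K. One power of \<open>p\<close> disappears because the mass of
          \<open>u\<close> is at least of order p W.\<close>
        also have "\<dots> = (2 ^ (s + 2) * K * p ^ (card T - 1) / ?m) * ((1/2) ^ Suc s * p * ?W)"
          using pw by (simp add: power_one_over field_simps)
        also have "\<dots> \<le> (2 ^ (s + 2) * K * p ^ (card T - 1) / ?m) * sum u (Pow V)"
          using big K p_pos m by (intro mult_left_mono) auto
        finally show ?thesis by simp
      qed
      then have "spread_hypergraph s (2 ^ (s + 2) * K) V u p"
        using I finV V_ne p_pos pos big unfolding spread_hypergraph_def Inv_def by auto
      moreover have "real b \<le> c * ?m"
        using b(2) d(1) m by (meson mult_right_mono less_imp_le order_trans)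
      ultimately have "has_containers s c V u b" by (intro IH[OF _ b(1)])
      then obtain \<C> where \<C>: "finite \<C>" "card \<C> \<le> binsum (card V) b ^ s"
        "\<forall>C\<in>\<C>. C \<subseteq> V \<and> real (card C) \<le> (1 - c) * real (card V)"
        "\<forall>I\<subseteq>V. indep u I \<longrightarrow> (\<exists>C\<in>\<C>. I \<subseteq> C)"
        unfolding has_containers_def by (elim exE conjE)
      have "C \<subseteq> V \<and> real (card C) \<le> (1 - d) * ?m" if "C \<in> \<C>" for C
      proof -
        have "(1 - c) * ?m \<le> (1 - d) * ?m" using d(1) by (intro mult_right_mono) auto
        moreover have "C \<subseteq> V" "real (card C) \<le> (1 - c) * ?m" using \<C>(3) that by auto
        ultimately show ?thesis by auto
      qed
      then show ?thesis using \<C> by (intro exI[of _ \<C>] conjI ballI allI impI) auto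
    qed
  qed
  then have "\<forall>x\<in>L. \<exists>\<C>. finite \<C> \<and> card \<C> \<le> binsum (card V) b ^ s \<and>
      (\<forall>C\<in>\<C>. C \<subseteq> V \<and> real (card C) \<le> (1 - d) * real (card V)) \<and>
      (\<forall>I\<subseteq>V. I \<subseteq> fst x \<union> fst (snd x) \<longrightarrow> indep (snd (snd x)) I \<longrightarrow> (\<exists>C\<in>\<C>. I \<subseteq> C))"
    by (simp add: split_paired_all)
  from bchoice[OF this] obtain f where f: "\<forall>x\<in>L. finite (f x) \<and> card (f x) \<le> binsum (card V) b ^ s \<and>
      (\<forall>C\<in>f x. C \<subseteq> V \<and> real (card C) \<le> (1 - d) * real (card V)) \<and>
      (\<forall>I\<subseteq>V. I \<subseteq> fst x \<union> fst (snd x) \<longrightarrow> indep (snd (snd x)) I \<longrightarrow> (\<exists>C\<in>f x. I \<subseteq> C))"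
    by (rule exE)
  have "card (\<Union>x\<in>L. f x) \<le> (\<Sum>x\<in>L. card (f x))"
    by (rule card_UN_le[OF L(1)])
  also have "\<dots> \<le> (\<Sum>x\<in>L. binsum (card V) b ^ s)" using f by (intro sum_mono) auto
  also have "\<dots> = card L * binsum (card V) b ^ s" by simp
  also have "\<dots> \<le> binsum (card V) b * binsum (card V) b ^ s" using L(2) by (intro mult_right_mono) auto
  also have "\<dots> = binsum (card V) b ^ Suc s" by simp
  finally have crd: "card (\<Union>x\<in>L. f x) \<le> binsum (card V) b ^ Suc s" .
  have cov: "\<exists>C\<in>(\<Union>x\<in>L. f x). I \<subseteq> C" if IV: "I \<subseteq> V" and "indep w I" for I
  proof -
    have "indep (\<lambda>_. 0) I" by (simp add: indep_def)
    then have "\<exists>(F', Av', u')\<in>L. I \<subseteq> F' \<union> Av' \<and> indep u' I"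
      using L(3) IV \<open>indep w I\<close> unfolding tree_covered_def by simp
    then obtain F' Av' u' where y: "(F', Av', u') \<in> L" "I \<subseteq> F' \<union> Av'" "indep u' I" by blast
    then have "\<exists>C\<in>f (F', Av', u'). I \<subseteq> C" using bspec[OF f y(1)] IV by simp
    then show ?thesis using y(1) by blast
  qed
  show ?thesis
    unfolding has_containers_def
  proof (intro exI conjI)
    show "finite (\<Union>x\<in>L. f x)" using f L(1) by auto
    show "card (\<Union>x\<in>L. f x) \<le> binsum (card V) b ^ Suc s" by (fact crd)
    show "\<forall>C\<in>(\<Union>x\<in>L. f x). C \<subseteq> V \<and> real (card C) \<le> (1 - d) * real (card V)" using f by blast
    show "\<forall>I\<subseteq>V. indep w I \<longrightarrow> (\<exists>C\<in>(\<Union>x\<in>L. f x). I \<subseteq> C)" using cov by blast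
  qed
qed

theorem hypergraph_containers:
  assumes "s \<ge> 1" "0 < K"
  shows "\<exists>c>0. \<forall>(V :: 'v set) w p b. spread_hypergraph s K V w p \<longrightarrow> p * real (card V) \<le> real b \<longrightarrow>
    real b \<le> c * real (card V) \<longrightarrow> has_containers s c V w b"
  using assms
proof (induction s arbitrary: K rule: nat_induct_at_least)
  case base
  show ?case
    using containers_uniformity_1[OF base] base by (intro exI[of _ "1 / K"]) auto
next
  case (Suc s)
  have "0 < 2 ^ (s + 2) * K" using Suc.prems by simp
  from Suc.IH[OF this] obtain c where c: "c > 0" and
    IH: "\<And>(V :: 'v set) w p b. spread_hypergraph s (2 ^ (s + 2) * K) V w p \<Longrightarrow> p * real (card V) \<le> b \<Longrightarrow>
      real b \<le> c * real (card V) \<Longrightarrow> has_containers s c V w b" by blast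
  define d where "d = min c (min (1 / (4 * K)) (1 / 2))"
  have "d > 0" "d \<le> c" "d \<le> 1 / (4 * K)" "d \<le> 1 / 2"
    using c Suc.prems by (auto simp: d_def)
  then show ?case
    using containers_step[OF Suc.hyps Suc.prems c IH] by (intro exI[of _ d]) auto
qed

section \<open>Supersaturation\<close>

text \<open>Copies are edge sets rather than embeddings, so isolated vertices are ignored;
  \<open>copy_of_imp_contains_copy\<close> puts them back.\<close>

definition copy_of :: "'a set set \<Rightarrow> 'b set set \<Rightarrow> bool" where
  "copy_of E X \<longleftrightarrow> (\<exists>f. inj_on f (\<Union>E) \<and> X = (`) f ` E)"

definition pairs :: "'a set \<Rightarrow> 'a set set" where
  "pairs V = {e. e \<subseteq> V \<and> card e = 2}"

lemma finite_pairs: "finite V \<Longrightarrow> finite (pairs V)"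
  unfolding pairs_def by (rule finite_subset[of _ "Pow V"]) auto

lemma card_pairs: "finite V \<Longrightarrow> card (pairs V) = card V choose 2"
  unfolding pairs_def by (rule n_subsets)

lemma choose_two_le: "n choose 2 \<le> n * n"
  by (simp add: choose_two) (meson diff_le_self div_le_dividend le_trans mult_le_mono2)

lemma card_le_square:
  assumes "G \<subseteq> pairs {1..n}"
  shows "card G \<le> n * n"
  using card_mono[OF finite_pairs assms] card_pairs[of "{1..n}"] choose_two_le[of n] by simp

lemma Union_pairs_subset: "G \<subseteq> pairs V \<Longrightarrow> \<Union>G \<subseteq> V"
  unfolding pairs_def by blast

lemma inj_on_image_sets: "inj_on f (\<Union>E) \<Longrightarrow> inj_on ((`) f) E"
  by (rule inj_on_image)

lemma copy_of_subset:
  assumes "copy_of E X" "J \<subseteq> X"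
  shows "\<exists>J'\<subseteq>E. copy_of J' J"
proof -
  obtain f where f: "inj_on f (\<Union>E)" "X = (`) f ` E" using assms by (auto simp: copy_of_def)
  obtain J' where J': "J' \<subseteq> E" "J = (`) f ` J'"
    using assms(2) f(2) by (auto simp: subset_image_iff)
  then have "inj_on f (\<Union>J')" using f(1) by (meson Union_mono inj_on_subset)
  then show ?thesis using J' by (auto simp: copy_of_def)
qed

lemma copy_of_card:
  assumes "copy_of E X"
  shows "card X = card E" "card (\<Union>X) = card (\<Union>E)" "finite X \<longleftrightarrow> finite E"
proof -
  obtain f where f: "inj_on f (\<Union>E)" "X = (`) f ` E" using assms by (auto simp: copy_of_def)
  show "card X = card E" "finite X \<longleftrightarrow> finite E"
    using f inj_on_image_sets[OF f(1)] by (auto simp: card_image finite_image_iff)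
  have "\<Union>X = f ` \<Union>E" using f(2) by auto
  then show "card (\<Union>X) = card (\<Union>E)" using f(1) by (simp add: card_image)
qed

lemma contains_copy_imp_copy_of:
  assumes "contains_copy G H" "E \<subseteq> edges H" "\<forall>e\<in>edges H. e \<subseteq> verts H"
  shows "\<exists>X\<subseteq>edges G. copy_of E X"
proof -
  obtain f where f: "inj_on f (verts H)" "\<forall>e\<in>edges H. f ` e \<in> edges G"
    using assms by (auto simp: contains_copy_def)
  have "\<Union>E \<subseteq> verts H" using assms by auto
  then have "inj_on f (\<Union>E)" using f(1) inj_on_subset by blast
  then show ?thesis
    using f(2) assms(2) by (intro exI[of _ "(`) f ` E"]) (auto simp: copy_of_def)
qed

section \<open>Vertex sets of fixed size\<close>

lemma card_supersets:
  assumes "finite V" "U \<subseteq> V"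
  shows "card {R. R \<subseteq> V \<and> card R = r \<and> U \<subseteq> R} =
    (if card U \<le> r then (card V - card U) choose (r - card U) else 0)"
proof (cases "card U \<le> r")
  case True
  have fU: "finite U" using assms finite_subset by blast
  have "bij_betw (\<lambda>R. R - U) {R. R \<subseteq> V \<and> card R = r \<and> U \<subseteq> R} {R. R \<subseteq> V - U \<and> card R = r - card U}"
  proof (rule bij_betwI[where g = "\<lambda>R. R \<union> U"])
    show "(\<lambda>R. R - U) \<in> {R. R \<subseteq> V \<and> card R = r \<and> U \<subseteq> R} \<rightarrow> {R. R \<subseteq> V - U \<and> card R = r - card U}"
      using fU by (auto simp: card_Diff_subset)
    show "(\<lambda>R. R \<union> U) \<in> {R. R \<subseteq> V - U \<and> card R = r - card U} \<rightarrow> {R. R \<subseteq> V \<and> card R = r \<and> U \<subseteq> R}"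
    proof
      fix R assume R: "R \<in> {R. R \<subseteq> V - U \<and> card R = r - card U}"
      then have "finite R" using assms finite_subset by blast
      moreover have "R \<inter> U = {}" using R by auto
      ultimately have "card (R \<union> U) = r" using R True fU by (simp add: card_Un_disjoint)
      then show "R \<union> U \<in> {R. R \<subseteq> V \<and> card R = r \<and> U \<subseteq> R}" using R assms by auto
    qed
  qed auto
  then have "card {R. R \<subseteq> V \<and> card R = r \<and> U \<subseteq> R} = card {R. R \<subseteq> V - U \<and> card R = r - card U}"
    by (rule bij_betw_same_card)
  also have "\<dots> = (card V - card U) choose (r - card U)"
    using assms fU by (subst n_subsets) (auto simp: card_Diff_subset)
  finally show ?thesis using True by simp
next
  case False
  have "{R. R \<subseteq> V \<and> card R = r \<and> U \<subseteq> R} = {}"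
    using False assms by (auto dest: card_mono[rotated] finite_subset)
  then show ?thesis using False by (simp only: card.empty if_False)
qed

lemma binomial_ratio_step:
  assumes "k < r" "r \<le> n"
  shows "real ((n - Suc k) choose (r - Suc k)) = real ((n - k) choose (r - k)) * (real (r - k) / real (n - k))"
proof -
  have "Suc (r - Suc k) * ((n - k) choose Suc (r - Suc k)) = (n - k) * ((n - k - 1) choose (r - Suc k))"
    by (rule binomial_absorption)
  moreover have "Suc (r - Suc k) = r - k" "n - k - 1 = n - Suc k" using assms by auto
  ultimately have "(r - k) * ((n - k) choose (r - k)) = (n - k) * ((n - Suc k) choose (r - Suc k))"
    by metis
  then have "real (r - k) * real ((n - k) choose (r - k)) = real (n - k) * real ((n - Suc k) choose (r - Suc k))"
    by (metis of_nat_mult)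
  moreover have "real (n - k) > 0" using assms by simp
  ultimately show ?thesis by (simp add: field_simps)
qed

lemma binomial_ratio_le:
  assumes "k \<le> r" "r \<le> n"
  shows "real ((n - k) choose (r - k)) \<le> real (n choose r) * (real r / real n) ^ k"
  using assms(1)
proof (induction k)
  case (Suc k)
  have "real (r - k) / real (n - k) \<le> real r / real n"
    using Suc.prems assms(2) by (simp add: divide_simps of_nat_diff algebra_simps mult_left_mono)
  then have "real ((n - k) choose (r - k)) * (real (r - k) / real (n - k)) \<le>
      real (n choose r) * (real r / real n) ^ k * (real r / real n)"
    using Suc by (intro mult_mono) auto
  then show ?case
    using binomial_ratio_step[of k r n] Suc.prems assms(2) by (simp add: mult_ac)
qed simp

text \<open>For a single edge, sampling without replacement costs at most a factor 2, since (r - 1)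
  / (n - 1) \<ge> r / (2 n) once r \<ge> 2.\<close>

lemma binomial_ratio_2:
  assumes "2 \<le> r" "r \<le> n"
  shows "real (n choose r) * (real r / real n) ^ 2 / 2 \<le> real ((n - 2) choose (r - 2))"
proof -
  have "real ((n - 2) choose (r - 2)) = real (n choose r) * (real r / real n) * (real (r - 1) / real (n - 1))"
    using binomial_ratio_step[of 0 r n] binomial_ratio_step[of 1 r n] assms
    by (simp add: numeral_2_eq_2)
  also have "\<dots> \<ge> real (n choose r) * (real r / real n) * (real r / real n / 2)"
  proof (intro mult_left_mono)
    have "2 * real n \<le> real n * real r" using assms by simp
    then have "real r * (real n - 1) \<le> 2 * real n * (real r - 1)" by (simp add: algebra_simps)
    then show "real r / real n / 2 \<le> real (r - 1) / real (n - 1)"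
      using assms by (simp add: divide_simps of_nat_diff algebra_simps)
  qed auto
  finally show ?thesis by (simp add: power2_eq_square)
qed

text \<open>A maximal family of copies with bounded degrees is large: an edge is deleted from every
  saturated set inside a random vertex set, and what remains still contains a copy.\<close>

lemma supersaturation:
  fixes E :: "'a set set" and G :: "nat set set" and \<alpha> A u :: real and n :: nat
  defines "Q \<equiv> u powr (1 / (2 - \<alpha>))"
  assumes E: "finite E" "E \<noteq> {}" "finite (\<Union>E)"
    and \<alpha>: "0 < \<alpha>" "\<alpha> < 2" and A: "0 < A"
    and ex: "\<And>(R :: nat set) G'. finite R \<Longrightarrow> R \<noteq> {} \<Longrightarrow> G' \<subseteq> pairs R \<Longrightarrow>
      A * real (card R) powr \<alpha> < real (card G') \<Longrightarrow> \<exists>X\<subseteq>G'. copy_of E X"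
    and n: "n > 0" and G: "G \<subseteq> pairs {1..n}" and u: "u \<ge> 1"
    and m: "real (card G) = u * (4 * A + 4) * n powr \<alpha>"
  shows "\<exists>\<H>. finite \<H> \<and> (\<forall>X\<in>\<H>. X \<subseteq> G \<and> copy_of E X) \<and>
    (\<forall>S. S \<noteq> {} \<longrightarrow> real (card {X\<in>\<H>. S \<subseteq> X}) \<le> 2 * Q ^ (card (\<Union>E) - card (\<Union>S))) \<and>
    1 / 2 ^ (card (\<Union>E) + card E + 3) * real (card G) * Q powr (real (card (\<Union>E)) - 2) \<le> real (card \<H>)"
proof -
  let ?v = "card (\<Union>E)" and ?m = "real (card G)"
  have Q1: "Q \<ge> 1" unfolding Q_def using u \<alpha> by (simp add: ge_one_powr_ge_zero)
  have finG: "finite G" using G finite_pairs finite_subset by blast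
  have nr: "real n > 0" using n by simp
  have m0: "?m > 0" using m u A nr by simp
  define good where "good \<H> \<longleftrightarrow> \<H> \<subseteq> Pow G \<and> (\<forall>X\<in>\<H>. copy_of E X) \<and>
    (\<forall>S. S \<noteq> {} \<longrightarrow> real (card {X\<in>\<H>. S \<subseteq> X}) \<le> 2 * Q ^ (?v - card (\<Union>S)))" for \<H>
  have "finite {\<H>. good \<H>}"
    by (rule finite_subset[of _ "Pow (Pow G)"]) (use finG in \<open>auto simp: good_def\<close>)
  moreover have "good {}" using Q1 by (auto simp: good_def)
  ultimately obtain \<H> where \<H>: "good \<H>" and mx: "\<And>\<H>'. good \<H>' \<Longrightarrow> \<H> \<subseteq> \<H>' \<Longrightarrow> \<H>' = \<H>"
    using finite_has_maximal2[of "{\<H>. good \<H>}" "{}"] by auto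
  have HG: "\<H> \<subseteq> Pow G" using \<H> by (simp add: good_def)
  have finH: "finite \<H>" using HG finG finite_subset by blast
  have "1 / 2 ^ (?v + card E + 3) * ?m * Q powr (real ?v - 2) \<le> real (card \<H>)"
  proof (rule ccontr)
    assume "\<not> ?thesis"
    then have small: "real (card \<H>) < 1 / 2 ^ (?v + card E + 3) * ?m * Q powr (real ?v - 2)" by simp
    let ?deg = "\<lambda>S. card {X\<in>\<H>. S \<subseteq> X}"
    \<comment> \<open>The family may have degrees up to 2 Q^k, but a set counts as saturated from
      Q^k on. As Q^k \<ge> 1, a new copy without saturated subsets keeps the family within its
      bound.\<close>
    define Sat where "Sat = {S. S \<subseteq> G \<and> S \<noteq> {} \<and> Q ^ (?v - card (\<Union>S)) \<le> real (?deg S)}"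
    have finSat: "finite Sat" by (rule finite_subset[of _ "Pow G"]) (use finG in \<open>auto simp: Sat_def\<close>)
    define \<beta> where "\<beta> = 2 - \<alpha>"
    have \<beta>: "0 < \<beta>" "\<beta> < 2" using \<alpha> by (auto simp: \<beta>_def)
    \<comment> \<open>This is the reason for the choice of \<open>Q\<close>: a random set of n / Q
      vertices keeps about a proportion 1 / Q^2 of the edges, and u n^\<alpha> / Q^2 = (n /
      Q)^\<alpha> exactly if Q^\<beta> = u.\<close>
    have Qb: "Q powr \<beta> = u" unfolding Q_def \<beta>_def[symmetric] using \<beta> u by (simp add: powr_powr)
    \<comment> \<open>There are at most n^2 edges, which bounds u and therefore \<open>Q\<close>;
      the random set thus has at least two vertices.\<close>
    have nQ: "2 * Q \<le> n"
    proof -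
      have "?m \<le> real (n * n)" using card_le_square[OF G] by (simp only: of_nat_le_iff)
      then have "u * (4 * A + 4) * n powr \<alpha> \<le> n powr \<beta> * n powr \<alpha>"
        using m nr by (simp add: \<beta>_def powr_add[symmetric] power2_eq_square)
      then have le: "u * (4 * A + 4) \<le> n powr \<beta>"
        using nr by (simp only: mult_le_cancel_right_pos powr_gt_zero)
      have "2 powr \<beta> \<le> 2 powr (2::real)" using \<beta> by (intro powr_mono) auto
      then have "(2::real) powr \<beta> \<le> 4" by simp
      then have "2 powr \<beta> * u \<le> (4 * A + 4) * u" using A u by (intro mult_right_mono) auto
      then have "(2 * Q) powr \<beta> \<le> n powr \<beta>" using le Q1 Qb by (simp add: powr_mult mult.commute)
      then show ?thesis using \<beta> Q1 nr by (simp add: powr_mono2' not_less[symmetric])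
         (meson linorder_not_less powr_less_mono2 zero_le_mult_iff not_less order_trans zero_le_one zero_le_numeral of_nat_0_le_iff)
    qed
    define r where "r = nat \<lceil>n / Q\<rceil>"
    have rlow: "n / Q \<le> r" unfolding r_def by linarith
    have nQ2: "n / Q \<ge> 2" using nQ Q1 by (simp add: field_simps)
    have rup: "r \<le> 2 * (n / Q)" unfolding r_def using nQ2 by linarith
    have r2: "2 \<le> r" using rlow nQ2 by linarith
    have "n / Q \<le> n" using Q1 nr by (simp add: field_simps)
    then have rn: "r \<le> n" unfolding r_def by (simp add: nat_le_iff ceiling_le_iff)
    define x where "x = real r / real n"
    have x0: "x > 0" using r2 nr by (simp add: x_def)
    have x1: "1 / Q \<le> x" using rlow nr Q1 by (simp add: x_def field_simps)
    have x2: "x \<le> 2 / Q" using rup nr Q1 by (simp add: x_def field_simps)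
    define \<R> where "\<R> = {R. R \<subseteq> {1..n} \<and> card R = r}"
    have fR: "finite \<R>" by (rule finite_subset[of _ "Pow {1..n}"]) (auto simp: \<R>_def)
    have cR: "card \<R> = n choose r" using n_subsets[of "{1..n}" r] by (simp add: \<R>_def)
    have cRU: "card {R\<in>\<R>. U \<subseteq> R} = (if card U \<le> r then (n - card U) choose (r - card U) else 0)"
      if "U \<subseteq> {1..n}" for U
      using card_supersets[of "{1..n}" U r] that by (simp add: \<R>_def conj_ac)
    have cRU_le: "real (card {R\<in>\<R>. U \<subseteq> R}) \<le> card \<R> * x ^ card U" if "U \<subseteq> {1..n}" for U
      using cRU[OF that] binomial_ratio_le[of "card U" r n] rn x0 by (auto simp: cR x_def)
    have cRU_ge: "card \<R> * (x\<^sup>2 / 2) \<le> real (card {R\<in>\<R>. g \<subseteq> R})" if "g \<in> G" for g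
      using that G cRU[of g] binomial_ratio_2[of r n] rn r2 by (auto simp: cR x_def pairs_def)
    have UG: "\<Union>S \<subseteq> {1..n}" if "S \<subseteq> G" for S using that G Union_pairs_subset by blast
    \<comment> \<open>Up to normalisation, the expected number of saturated sets inside the sample.
      A saturated set is paid for by its own large degree, and each member of \<open>\<H>\<close>
      contributes to the degrees of only \<open>2 ^ card E\<close> sets, so a small family saturates
      few sets.\<close>
    have Sat_le: "(\<Sum>S\<in>Sat. x ^ card (\<Union>S)) \<le> ?m * x\<^sup>2 / 8"
    proof -
      have "(\<Sum>S\<in>Sat. x ^ card (\<Union>S)) \<le> (\<Sum>S\<in>Sat. 2 ^ ?v / Q ^ ?v * real (?deg S))"
      proof (rule sum_mono)
        fix S assume S: "S \<in> Sat"
        have "0 < Q ^ (?v - card (\<Union>S))" using Q1 by simp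
        then have "?deg S \<noteq> 0" using S by (auto simp: Sat_def)
        then obtain X where X: "X \<in> \<H>" "S \<subseteq> X" by (auto simp: card_eq_0_iff)
        have "copy_of E X" using X \<H> by (simp add: good_def)
        then have cX: "card (\<Union>X) = ?v" by (rule copy_of_card(2))
        have "finite (\<Union>X)" using UG[of X] X HG finite_subset[of "\<Union>X" "{1..n}"] by auto
        then have le: "card (\<Union>S) \<le> ?v" using X cX by (metis Union_mono card_mono)
        have "x ^ card (\<Union>S) \<le> (2 / Q) ^ card (\<Union>S)" using x0 x2 by (intro power_mono) auto
        also have "\<dots> = 2 ^ card (\<Union>S) / Q ^ card (\<Union>S)" by (simp add: power_divide)
        also have "\<dots> \<le> 2 ^ ?v / Q ^ card (\<Union>S)"
          using le Q1 by (intro divide_right_mono power_increasing) auto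
        also have "\<dots> = 2 ^ ?v / Q ^ ?v * Q ^ (?v - card (\<Union>S))"
          using le Q1 by (simp add: field_simps power_add[symmetric])
        also have "\<dots> \<le> 2 ^ ?v / Q ^ ?v * real (?deg S)"
          using S Q1 by (intro mult_left_mono) (auto simp: Sat_def)
        finally show "x ^ card (\<Union>S) \<le> 2 ^ ?v / Q ^ ?v * real (?deg S)" .
      qed
      also have "\<dots> = 2 ^ ?v / Q ^ ?v * real (\<Sum>S\<in>Sat. ?deg S)" by (simp add: sum_distrib_left)
      also have "\<dots> \<le> 2 ^ ?v / Q ^ ?v * real (\<Sum>S\<in>Pow G. ?deg S)"
      proof -
        have "(\<Sum>S\<in>Sat. ?deg S) \<le> (\<Sum>S\<in>Pow G. ?deg S)"
          using finG by (intro sum_mono2) (auto simp: Sat_def)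
        then have "real (\<Sum>S\<in>Sat. ?deg S) \<le> real (\<Sum>S\<in>Pow G. ?deg S)"
          by (simp only: of_nat_le_iff)
        then show ?thesis using Q1 by (intro mult_left_mono) simp_all
      qed
      also have "(\<Sum>S\<in>Pow G. ?deg S) = (\<Sum>S\<in>Pow G. \<Sum>X\<in>\<H>. if S \<subseteq> X then 1 else 0)"
        using finH by (intro sum.cong refl) (auto simp: sum.If_cases Int_def)
      also have "\<dots> = (\<Sum>X\<in>\<H>. \<Sum>S\<in>Pow G. if S \<subseteq> X then 1 else 0)" by (rule sum.swap)
      also have "\<dots> = (\<Sum>X\<in>\<H>. 2 ^ card E)"
      proof (rule sum.cong[OF refl])
        fix X assume X: "X \<in> \<H>"
        then have "Pow G \<inter> {S. S \<subseteq> X} = Pow X" using HG by auto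
        moreover have "finite X" "card X = card E"
          using X HG finG \<H> copy_of_card(1)[of E X] by (auto simp: good_def dest: finite_subset)
        ultimately show "(\<Sum>S\<in>Pow G. if S \<subseteq> X then 1 else 0) = (2::nat) ^ card E"
          using finG by (simp add: sum.If_cases card_Pow)
      qed
      also have "2 ^ ?v / Q ^ ?v * real (\<Sum>X\<in>\<H>. 2 ^ card E) = 2 ^ (?v + card E) / Q ^ ?v * card \<H>"
        by (simp add: power_add)
      also have "\<dots> \<le> 2 ^ (?v + card E) / Q ^ ?v * (1 / 2 ^ (?v + card E + 3) * ?m * Q powr (real ?v - 2))"
        using small Q1 by (intro mult_left_mono) auto
      also have "\<dots> = ?m * (1 / Q)\<^sup>2 / 8"
        using Q1 by (simp add: powr_diff powr_realpow power_add field_simps power2_eq_square)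
      also have "\<dots> \<le> ?m * x\<^sup>2 / 8"
        using x1 Q1 by (intro divide_right_mono mult_left_mono power_mono) auto
      finally show ?thesis .
    qed
    \<comment> \<open>On average the sample keeps at least m x^2 / 2 edges and at most m x^2 / 8
      saturated sets. The factor 4 A + 4 in the edge number makes even m x^2 / 4 at least (A + 1)
      r^\<alpha>.\<close>
    have "\<exists>R\<in>\<R>. A * real r powr \<alpha> < real (card {g\<in>G. g \<subseteq> R}) - real (card {S\<in>Sat. \<Union>S \<subseteq> R})"
    proof (rule ccontr)
      assume "\<not> ?thesis"
      then have "(\<Sum>R\<in>\<R>. real (card {g\<in>G. g \<subseteq> R}) - real (card {S\<in>Sat. \<Union>S \<subseteq> R})) \<le> (\<Sum>R\<in>\<R>. A * real r powr \<alpha>)"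
        by (intro sum_mono) auto
      moreover have "(\<Sum>R\<in>\<R>. real (card {g\<in>G. g \<subseteq> R})) = (\<Sum>g\<in>G. real (card {R\<in>\<R>. g \<subseteq> R}))"
      proof -
        have "(\<Sum>R\<in>\<R>. real (card {g\<in>G. g \<subseteq> R})) = (\<Sum>R\<in>\<R>. \<Sum>g\<in>G. if g \<subseteq> R then 1 else 0)"
          using finG by (intro sum.cong refl) (auto simp: sum.If_cases Int_def)
        also have "\<dots> = (\<Sum>g\<in>G. \<Sum>R\<in>\<R>. if g \<subseteq> R then 1 else 0)" by (rule sum.swap)
        also have "\<dots> = (\<Sum>g\<in>G. real (card {R\<in>\<R>. g \<subseteq> R}))"
          using fR by (intro sum.cong refl) (auto simp: sum.If_cases Int_def)
        finally show ?thesis .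
      qed
      moreover have "(\<Sum>R\<in>\<R>. real (card {S\<in>Sat. \<Union>S \<subseteq> R})) = (\<Sum>S\<in>Sat. real (card {R\<in>\<R>. \<Union>S \<subseteq> R}))"
      proof -
        have "(\<Sum>R\<in>\<R>. real (card {S\<in>Sat. \<Union>S \<subseteq> R})) = (\<Sum>R\<in>\<R>. \<Sum>S\<in>Sat. if \<Union>S \<subseteq> R then 1 else 0)"
          using finSat by (intro sum.cong refl) (simp add: sum.If_cases Int_def)
        also have "\<dots> = (\<Sum>S\<in>Sat. \<Sum>R\<in>\<R>. if \<Union>S \<subseteq> R then 1 else 0)" by (rule sum.swap)
        also have "\<dots> = (\<Sum>S\<in>Sat. real (card {R\<in>\<R>. \<Union>S \<subseteq> R}))"
          using fR by (intro sum.cong refl) (simp add: sum.If_cases Int_def)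
        finally show ?thesis .
      qed
      moreover have "(\<Sum>g\<in>G. real (card {R\<in>\<R>. g \<subseteq> R})) \<ge> (\<Sum>g\<in>G. card \<R> * (x\<^sup>2 / 2))"
        by (rule sum_mono) (rule cRU_ge)
      moreover have "(\<Sum>S\<in>Sat. real (card {R\<in>\<R>. \<Union>S \<subseteq> R})) \<le> (\<Sum>S\<in>Sat. card \<R> * x ^ card (\<Union>S))"
        by (rule sum_mono, rule cRU_le) (use UG in \<open>auto simp: Sat_def\<close>)
      moreover have "(\<Sum>S\<in>Sat. card \<R> * x ^ card (\<Union>S)) \<le> card \<R> * (?m * x\<^sup>2 / 8)"
        unfolding sum_distrib_left[symmetric] using Sat_le by (intro mult_left_mono) auto
      ultimately have "card \<R> * (?m * x\<^sup>2 / 2) - card \<R> * (?m * x\<^sup>2 / 8) \<le> card \<R> * (A * real r powr \<alpha>)"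
        by (simp add: sum_subtractf mult_ac)
      then have "card \<R> * (?m * x\<^sup>2 / 2 - ?m * x\<^sup>2 / 8) \<le> card \<R> * (A * real r powr \<alpha>)"
        by (simp only: right_diff_distrib)
      moreover have "real (card \<R>) > 0" using cR rn by simp
      ultimately have "?m * x\<^sup>2 / 2 - ?m * x\<^sup>2 / 8 \<le> A * real r powr \<alpha>"
        by (simp only: mult_le_cancel_left_pos)
      moreover have "?m * x\<^sup>2 > 0" using m0 x0 by simp
      ultimately have "?m * x\<^sup>2 / 4 \<le> A * real r powr \<alpha>" by linarith
      moreover have "(A + 1) * real r powr \<alpha> \<le> ?m * x\<^sup>2 / 4"
      proof -
        have "1 = u * (1 / Q) powr \<beta>" using Qb Q1 u by (simp add: powr_divide)
        also have "\<dots> \<le> u * x powr \<beta>" using x1 Q1 \<beta> u by (intro mult_left_mono powr_mono2) auto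
        finally have "1 \<le> u * x powr \<beta>" .
        then have "1 * ((A + 1) * n powr \<alpha> * x powr \<alpha>) \<le> u * x powr \<beta> * ((A + 1) * n powr \<alpha> * x powr \<alpha>)"
          using A by (intro mult_right_mono) auto
        also have "\<dots> = ?m * (x powr \<beta> * x powr \<alpha>) / 4" using m by (simp add: field_simps)
        also have "x powr \<beta> * x powr \<alpha> = x\<^sup>2" using x0 by (simp add: \<beta>_def powr_add[symmetric])
        finally have "(A + 1) * (n powr \<alpha> * x powr \<alpha>) \<le> ?m * x\<^sup>2 / 4" by (simp add: mult.assoc)
        moreover have "n powr \<alpha> * x powr \<alpha> = real r powr \<alpha>"
          using nr x0 by (simp add: powr_mult[symmetric] x_def)
        ultimately show ?thesis by simp
      qed
      moreover have "real r powr \<alpha> > 0" using r2 by simp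
      ultimately show False by (simp add: algebra_simps)
    qed
    then obtain R where R: "R \<in> \<R>"
      "A * real r powr \<alpha> < real (card {g\<in>G. g \<subseteq> R}) - real (card {S\<in>Sat. \<Union>S \<subseteq> R})" by blast
    define pick where "pick S = (SOME g. g \<in> S)" for S :: "nat set set"
    have pick: "pick S \<in> S" if "S \<noteq> {}" for S
      unfolding pick_def using that by (simp add: some_in_eq)
    \<comment> \<open>One edge of each saturated set inside \<open>R\<close> is removed, so a copy
      found in \<open>G'\<close> contains no saturated set.\<close>
    define G' where "G' = {g\<in>G. g \<subseteq> R} - pick ` {S\<in>Sat. \<Union>S \<subseteq> R}"
    have "card {g\<in>G. g \<subseteq> R} - card (pick ` {S\<in>Sat. \<Union>S \<subseteq> R}) \<le> card G'"
      unfolding G'_def by (rule diff_card_le_card_Diff) (use finSat in auto)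
    moreover have "card (pick ` {S\<in>Sat. \<Union>S \<subseteq> R}) \<le> card {S\<in>Sat. \<Union>S \<subseteq> R}"
      by (rule card_image_le) (use finSat in auto)
    ultimately have cG': "A * real r powr \<alpha> < real (card G')" using R(2) by linarith
    have "finite R" "card R = r" using R(1) finite_subset[of R "{1..n}"] by (auto simp: \<R>_def)
    moreover have "R \<noteq> {}" using calculation r2 by auto
    moreover have "G' \<subseteq> pairs R" using G by (auto simp: G'_def pairs_def)
    ultimately obtain X where X: "X \<subseteq> G'" "copy_of E X" using ex cG' by blast
    have nosat: "S \<notin> Sat" if "S \<subseteq> X" "S \<noteq> {}" for S
    proof
      assume "S \<in> Sat"
      moreover have "\<Union>S \<subseteq> R" using that X(1) by (auto simp: G'_def)
      ultimately have "pick S \<notin> G'" by (auto simp: G'_def)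
      then show False using pick[OF that(2)] that(1) X(1) by auto
    qed
    have XG: "X \<subseteq> G" using X(1) by (auto simp: G'_def)
    have Xne: "X \<noteq> {}" using X(2) E(2) by (auto simp: copy_of_def)
    \<comment> \<open>A member of the family is itself saturated, as its threshold is Q^0 = 1; so
      the copy found is new.\<close>
    have "X \<notin> \<H>"
    proof
      assume "X \<in> \<H>"
      then have "{Y\<in>\<H>. X \<subseteq> Y} \<noteq> {}" "finite {Y\<in>\<H>. X \<subseteq> Y}" using finH by auto
      then have "card {Y\<in>\<H>. X \<subseteq> Y} \<ge> 1" by (simp add: Suc_le_eq card_gt_0_iff)
      then have "X \<in> Sat" using XG Xne copy_of_card(2)[OF X(2)] by (simp add: Sat_def)
      then show False using nosat[of X] Xne by simp
    qed
    moreover have "good (insert X \<H>)"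
      unfolding good_def
    proof (intro conjI allI impI)
      fix S :: "nat set set" assume S: "S \<noteq> {}"
      show "real (card {Y\<in>insert X \<H>. S \<subseteq> Y}) \<le> 2 * Q ^ (?v - card (\<Union>S))"
      proof (cases "S \<subseteq> X")
        case True
        then have "\<not> Q ^ (?v - card (\<Union>S)) \<le> real (?deg S)"
          using nosat[OF True S] True XG S by (auto simp: Sat_def)
        moreover have "{Y\<in>insert X \<H>. S \<subseteq> Y} = insert X {Y\<in>\<H>. S \<subseteq> Y}" using True by auto
        then have "real (card {Y\<in>insert X \<H>. S \<subseteq> Y}) \<le> real (?deg S) + 1"
          using card_insert_le_m1[of "Suc (?deg S)" "{Y\<in>\<H>. S \<subseteq> Y}" X] by simp
        moreover have "Q ^ (?v - card (\<Union>S)) \<ge> 1" using Q1 by simp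
        ultimately show ?thesis by linarith
      next
        case False
        then have "{Y\<in>insert X \<H>. S \<subseteq> Y} = {Y\<in>\<H>. S \<subseteq> Y}" by auto
        then show ?thesis using \<H> S by (simp add: good_def)
      qed
    qed (use \<H> XG X in \<open>auto simp: good_def\<close>)
    ultimately show False using mx[of "insert X \<H>"] by auto
  qed
  then show ?thesis
    using \<H> finH by (intro exI[of _ \<H>]) (auto simp: good_def)
qed

section \<open>Improving the deletion method\<close>

text \<open>The exponent of n in the expected number of copies of \<open>Y\<close> when edges have
  probability n^(-\<theta>).\<close>

definition wt :: "real \<Rightarrow> 'v set set \<Rightarrow> real" where
  "wt \<theta> Y = real (card (\<Union>Y)) - \<theta> * real (card Y)"

lemma wt_Un:
  assumes "finite A" "finite B" "finite (\<Union>A)" "finite (\<Union>B)"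
  shows "wt \<theta> (A \<union> B) = wt \<theta> A + wt \<theta> B - card (\<Union>A \<inter> \<Union>B) + \<theta> * card (A \<inter> B)"
proof -
  have "card (\<Union>A) + card (\<Union>B) = card (\<Union>(A \<union> B)) + card (\<Union>A \<inter> \<Union>B)"
    using card_Un_Int[OF assms(3,4)] by (simp add: Union_Un_distrib)
  moreover have "card A + card B = card (A \<union> B) + card (A \<inter> B)"
    using card_Un_Int[OF assms(1,2)] .
  ultimately have "real (card (\<Union>(A \<union> B))) = real (card (\<Union>A)) + real (card (\<Union>B)) - real (card (\<Union>A \<inter> \<Union>B))"
    "real (card (A \<union> B)) = real (card A) + real (card B) - real (card (A \<inter> B))"
    by linarith+
  then show ?thesis by (simp only: wt_def) (simp add: algebra_simps)
qed

text \<open>Submodularity: common vertices that lie on no common edge only lower the weight of the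
  union further.\<close>

lemma wt_Un_le:
  assumes "finite A" "finite B" "finite (\<Union>A)" "finite (\<Union>B)"
  shows "wt \<theta> (A \<union> B) \<le> wt \<theta> A + wt \<theta> B - wt \<theta> (A \<inter> B)"
proof -
  have "card (\<Union>(A \<inter> B)) \<le> card (\<Union>A \<inter> \<Union>B)"
    using assms by (intro card_mono) auto
  then show ?thesis unfolding wt_Un[OF assms] by (simp add: wt_def)
qed

text \<open>Strictly balanced with respect to the \<open>2\<close>-density, whose inverse is \<open>\<theta>\<close>.\<close>

locale strictly_balanced =
  fixes E :: "'a set set" and \<theta> \<epsilon> :: real
  assumes finE: "finite E" and edgeE: "\<And>e. e \<in> E \<Longrightarrow> card e = 2"
    and E2: "2 \<le> card E" and \<theta>: "0 < \<theta>" "\<theta> < 1" and \<epsilon>: "0 < \<epsilon>" "\<epsilon> \<le> 1"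
    and exact: "real (card (\<Union>E)) - 2 = \<theta> * (real (card E) - 1)"
    and strict: "\<And>J. J \<subseteq> E \<Longrightarrow> 2 \<le> card J \<Longrightarrow> J \<noteq> E \<Longrightarrow>
      \<theta> * (real (card J) - 1) + \<epsilon> \<le> real (card (\<Union>J)) - 2"
begin

abbreviation v where "v \<equiv> card (\<Union>E)"
abbreviation e where "e \<equiv> card E"
abbreviation cp :: "nat set set \<Rightarrow> bool" where "cp \<equiv> copy_of E"

lemma edge_cp:
  assumes "cp X" "x \<in> X"
  shows "card x = 2" "finite x"
proof -
  obtain f where f: "inj_on f (\<Union>E)" "X = (`) f ` E" using assms by (auto simp: copy_of_def)
  then obtain y where y: "y \<in> E" "x = f ` y" using assms by auto
  then have "inj_on f y" using f(1) by (meson Union_upper inj_on_subset)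
  then show "card x = 2" using y edgeE by (simp add: card_image)
  then show "finite x" using card_ge_0_finite by force
qed

lemma finite_cp:
  assumes "cp X"
  shows "finite X" "finite (\<Union>X)" "card X = e" "card (\<Union>X) = v"
  using copy_of_card[OF assms] finE edge_cp(2)[OF assms] by auto

lemma wt_cp: "cp X \<Longrightarrow> wt \<theta> X = 2 - \<theta>"
  using finite_cp[of X] exact by (simp add: wt_def algebra_simps)

lemma wt_strict:
  assumes "cp X" "J \<subseteq> X" "2 \<le> card J" "J \<noteq> X"
  shows "2 - \<theta> + \<epsilon> \<le> wt \<theta> J"
proof -
  obtain J' where J': "J' \<subseteq> E" "copy_of J' J" using copy_of_subset[OF assms(1,2)] by blast
  have c: "card J = card J'" "card (\<Union>J) = card (\<Union>J')" using copy_of_card[OF J'(2)] by auto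
  have "card J < card X" using assms finite_cp by (intro psubset_card_mono) auto
  then have "J' \<noteq> E" using c finite_cp(3)[OF assms(1)] by auto
  then show ?thesis using strict[OF J'(1)] c assms(3) by (simp add: wt_def algebra_simps)
qed

text \<open>By balance the lowest weight among nonempty parts of a copy is the weight 2 - \<theta>
  of a single edge, which the whole copy shares.\<close>

lemma wt_ge:
  assumes "cp X" "J \<subseteq> X" "J \<noteq> {}"
  shows "2 - \<theta> \<le> wt \<theta> J"
proof (cases "2 \<le> card J")
  case True
  then show ?thesis using wt_strict[OF assms(1,2) True] wt_cp[OF assms(1)] \<epsilon> by (cases "J = X") auto
next
  case False
  moreover have "finite J" using assms finite_cp finite_subset by blast
  ultimately have "card J = 1" using assms(3) by (metis One_nat_def Suc_1 card_gt_0_iff le_antisym not_less_eq_eq Suc_leI)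
  then obtain x where "J = {x}" by (auto simp: card_1_singleton_iff)
  then show ?thesis using edge_cp[OF assms(1)] assms(2) by (simp add: wt_def)
qed

lemma wt_single: "cp X \<Longrightarrow> x \<in> X \<Longrightarrow> wt \<theta> {x} = 2 - \<theta>"
  using edge_cp[of X x] by (simp add: wt_def)

text \<open>Two copies through different edges of \<open>S\<close> that meet outside these edges cost a factor
  \<open>n powr (- \<epsilon>)\<close> in the expected number of extensions of \<open>S\<close>.\<close>

lemma overlap:
  assumes S: "finite S" "finite (\<Union>S)" and X1: "cp X1" and X2: "cp X2"
    and x1: "x1 \<in> S" "x1 \<in> X1" "x1 \<notin> X2" and x2: "x2 \<in> S" "x2 \<in> X2" "x2 \<notin> X1"
    and ns: "\<not> X1 \<subseteq> S" and int: "X1 \<inter> X2 \<noteq> {}"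
  shows "wt \<theta> (S \<union> X1 \<union> X2) \<le> wt \<theta> S - \<epsilon>"
proof -
  note f1 = finite_cp(1,2)[OF X1] and f2 = finite_cp(1,2)[OF X2]
  let ?T = "S \<union> X1"
  have fT: "finite ?T" "finite (\<Union>?T)" using S f1 by auto
  obtain g where g: "g \<in> X1" "g \<in> X2" using int by auto
  \<comment> \<open>Attaching a copy to a set that contains one of its edges does not raise the
    weight, and lowers it by \<epsilon> if two edges are shared and the copy is not yet contained in
    the set.\<close>
  have T_le: "wt \<theta> ?T \<le> wt \<theta> S + (2 - \<theta>) - wt \<theta> (S \<inter> X1)"
    using wt_Un_le[OF S(1) f1(1) S(2) f1(2), of \<theta>] wt_cp[OF X1] by simp
  have U_le: "wt \<theta> (?T \<union> X2) \<le> wt \<theta> ?T + (2 - \<theta>) - wt \<theta> (?T \<inter> X2)"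
    using wt_Un_le[OF fT(1) f2(1) fT(2) f2(2), of \<theta>] wt_cp[OF X2] by simp
  have S1: "2 - \<theta> \<le> wt \<theta> (S \<inter> X1)" using x1 by (intro wt_ge[OF X1]) auto
  have T2: "2 - \<theta> \<le> wt \<theta> (?T \<inter> X2)" using x2 by (intro wt_ge[OF X2]) auto
  show ?thesis
  proof (cases "2 \<le> card (S \<inter> X1)")
    case True
    then have "2 - \<theta> + \<epsilon> \<le> wt \<theta> (S \<inter> X1)" using ns by (intro wt_strict[OF X1]) auto
    then show ?thesis using T_le U_le T2 by linarith
  next
    case False
    have SX1: "S \<inter> X1 = {x1}"
    proof (rule ccontr)
      assume "S \<inter> X1 \<noteq> {x1}"
      then obtain y where "y \<in> S \<inter> X1" "y \<noteq> x1" using x1 by auto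
      then have "card {x1, y} \<le> card (S \<inter> X1)" using x1 f1 by (intro card_mono) auto
      then show False using False \<open>y \<noteq> x1\<close> by simp
    qed
    have gS: "g \<notin> S" using SX1 g x1 by auto
    show ?thesis
    proof (cases "X2 \<subseteq> ?T")
      case False
      have "card {x2, g} \<le> card (?T \<inter> X2)" using x2 g f2 by (intro card_mono) auto
      moreover have "x2 \<noteq> g" using g x2 by auto
      ultimately have "2 - \<theta> + \<epsilon> \<le> wt \<theta> (?T \<inter> X2)"
        using False by (intro wt_strict[OF X2]) auto
      then show ?thesis using T_le S1 U_le by linarith
    next
      case True
      then have TX: "?T \<union> X2 = ?T" by auto
      have T_eq: "wt \<theta> ?T = wt \<theta> S + 2 - card (\<Union>S \<inter> \<Union>X1)"
        using wt_Un[OF S(1) f1(1) S(2) f1(2), of \<theta>] wt_cp[OF X1] SX1 by simp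
      show ?thesis
      proof (cases "3 \<le> card (\<Union>S \<inter> \<Union>X1)")
        case True
        then show ?thesis using T_eq TX \<epsilon> by simp
      next
        case False
        have cx1: "card x1 = 2" "finite x1" using edge_cp[OF X1 x1(2)] by auto
        have cx2: "card x2 = 2" "finite x2" using edge_cp[OF X2 x2(2)] by auto
        have "x1 \<subseteq> \<Union>S \<inter> \<Union>X1" using x1 by auto
        then have VV: "\<Union>S \<inter> \<Union>X1 = x1"
          using False cx1 f1 by (intro card_seteq[symmetric]) auto
        \<comment> \<open>In the last case \<open>X2\<close> lies in \<open>S \<union> X1\<close>,
          while \<open>S\<close> and \<open>X1\<close> have only the endpoints of \<open>x1\<close>
          in common. The weights of \<open>P\<close> and \<open>insert x1 Q\<close> then add up to
          at most 2 (2 - \<theta>), so both are minimal, and strictness leaves only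
          \<open>P = {x2}\<close> and \<open>insert x1 Q = X1\<close>.\<close>
        define P where "P = X2 \<inter> S"
        define Q where "Q = X2 \<inter> X1"
        have PQ: "X2 = P \<union> Q" "P \<inter> Q = {}" using True SX1 x1 by (auto simp: P_def Q_def)
        have fP: "finite P" "finite (\<Union>P)" using S by (auto simp: P_def intro: finite_subset[OF _ S(2)])
        have fQ: "finite Q" "finite (\<Union>Q)" using f1 by (auto simp: Q_def intro: finite_subset[OF _ f1(2)])
        have sub: "\<Union>P \<inter> \<Union>Q \<subseteq> \<Union>Q \<inter> x1" using VV by (auto simp: P_def Q_def)
        have le: "card (\<Union>P \<inter> \<Union>Q) \<le> card (\<Union>Q \<inter> x1)" using fQ by (intro card_mono sub) auto
        have e1: "2 - \<theta> = wt \<theta> P + wt \<theta> Q - card (\<Union>P \<inter> \<Union>Q)"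
          using wt_Un[OF fP(1) fQ(1) fP(2) fQ(2), of \<theta>] PQ wt_cp[OF X2] by simp
        have x1Q: "x1 \<notin> Q" using x1 by (simp add: Q_def)
        have e2: "wt \<theta> (insert x1 Q) = wt \<theta> Q + (2 - \<theta>) - card (\<Union>Q \<inter> x1)"
          using wt_Un[OF fQ(1) _ fQ(2), of "{x1}" \<theta>] cx1 wt_single[OF X1 x1(2)] x1Q by simp
        have iX1: "insert x1 Q \<subseteq> X1" using x1 by (auto simp: Q_def)
        have gQ: "g \<in> Q" using g by (simp add: Q_def)
        have wP: "2 - \<theta> \<le> wt \<theta> P" using x2 by (intro wt_ge[OF X2]) (auto simp: P_def)
        have wI: "2 - \<theta> \<le> wt \<theta> (insert x1 Q)" using iX1 by (intro wt_ge[OF X1]) auto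
        have eqX1: "insert x1 Q = X1"
        proof (rule ccontr)
          assume "insert x1 Q \<noteq> X1"
          moreover have "card {x1, g} \<le> card (insert x1 Q)" using gQ fQ by (intro card_mono) auto
          moreover have "x1 \<noteq> g" using g x1 by auto
          ultimately have "2 - \<theta> + \<epsilon> \<le> wt \<theta> (insert x1 Q)" using iX1 by (intro wt_strict[OF X1]) auto
          then show False using e1 e2 le wP \<epsilon> by linarith
        qed
        have PX: "P = {x2}"
        proof (rule ccontr)
          assume "P \<noteq> {x2}"
          then obtain y where "y \<in> P" "y \<noteq> x2" using x2 by (auto simp: P_def)
          then have "card {x2, y} \<le> card P" using x2 fP by (intro card_mono) (auto simp: P_def)
          moreover have "P \<noteq> X2" using g gS by (auto simp: P_def)
          ultimately have "2 - \<theta> + \<epsilon> \<le> wt \<theta> P" using \<open>y \<noteq> x2\<close>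
            by (intro wt_strict[OF X2]) (auto simp: P_def)
          then show False using e1 e2 le wI \<epsilon> by linarith
        qed
        have wQ: "wt \<theta> Q = card (\<Union>Q \<inter> x1)" using e2 eqX1 wt_cp[OF X1] by simp
        have "2 - \<theta> \<le> wt \<theta> Q" using gQ by (intro wt_ge[OF X1]) (auto simp: Q_def)
        \<comment> \<open>The weight of \<open>Q\<close> is now an integer above 1, because \<theta>
          < 1. So \<open>Q\<close> reaches both endpoints of \<open>x1\<close>, and they turn out to
          be the endpoints of \<open>x2\<close>.\<close>
        then have "2 \<le> card (\<Union>Q \<inter> x1)" using wQ \<theta> by linarith
        then have "\<Union>Q \<inter> x1 = x1" using cx1 by (intro card_seteq) auto
        moreover have "\<Union>P \<inter> \<Union>Q = \<Union>Q \<inter> x1"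
          using e1 wQ wP le sub fQ by (intro card_seteq) auto
        ultimately have "x1 \<subseteq> x2" using PX by auto
        then have "x1 = x2" using cx1 cx2 by (intro card_seteq) auto
        then show ?thesis using x1 x2 by simp
      qed
    qed
  qed
qed

end

text \<open>The at most n^j vertex sets of size j cancel the weight n^(-j) of each object on them,
  so every size contributes at most C a. In this way exponents of expected counts become bounds on
  sums.\<close>

lemma sum_by_vertices:
  fixes \<phi> :: "'x \<Rightarrow> 'v set" and h :: "'x \<Rightarrow> real"
  assumes V: "finite V" "card V = n" "n > 0" and P: "finite P"
    and \<phi>: "\<And>x. x \<in> P \<Longrightarrow> \<phi> x \<subseteq> V \<and> card (\<phi> x) \<le> k"
    and fibre: "\<And>U. U \<subseteq> V \<Longrightarrow> card U \<le> k \<Longrightarrow> real (card {x\<in>P. \<phi> x = U}) \<le> C"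
    and h: "\<And>x. x \<in> P \<Longrightarrow> h x \<le> a / real n ^ card (\<phi> x)" and a: "a \<ge> 0" and C: "C \<ge> 0"
  shows "sum h P \<le> C * real (k + 1) * a"
proof -
  let ?U = "{U. U \<subseteq> V \<and> card U \<le> k}"
  have fU: "finite ?U" using V by (auto intro: finite_subset[of _ "Pow V"])
  have "sum h P \<le> (\<Sum>x\<in>P. a / real n ^ card (\<phi> x))" by (intro sum_mono h)
  also have "\<dots> = (\<Sum>U\<in>?U. \<Sum>x\<in>{x\<in>P. \<phi> x = U}. a / real n ^ card (\<phi> x))"
    using \<phi> by (intro sum.group[symmetric] P fU) auto
  also have "\<dots> \<le> (\<Sum>U\<in>?U. C * (a / real n ^ card U))"
  proof (rule sum_mono)
    fix U assume U: "U \<in> ?U"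
    have "(\<Sum>x\<in>{x\<in>P. \<phi> x = U}. a / real n ^ card (\<phi> x)) = card {x\<in>P. \<phi> x = U} * (a / real n ^ card U)"
      by simp
    also have "\<dots> \<le> C * (a / real n ^ card U)" using fibre U a by (intro mult_right_mono) auto
    finally show "(\<Sum>x\<in>{x\<in>P. \<phi> x = U}. a / real n ^ card (\<phi> x)) \<le> C * (a / real n ^ card U)" .
  qed
  also have "\<dots> = (\<Sum>j\<le>k. \<Sum>U\<in>{U\<in>?U. card U = j}. C * (a / real n ^ card U))"
    by (intro sum.group[symmetric] fU) auto
  also have "\<dots> \<le> (\<Sum>j\<le>k. C * a)"
  proof (rule sum_mono)
    fix j assume "j \<in> {..k}"
    then have eq: "{U\<in>?U. card U = j} = {U. U \<subseteq> V \<and> card U = j}" by auto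
    have "real (card {U\<in>?U. card U = j}) \<le> real n ^ j"
    proof (cases "j \<le> n")
      case True
      then show ?thesis unfolding eq n_subsets[OF V(1)] V(2)
        using binomial_le_pow[OF True] by (metis of_nat_le_iff of_nat_power)
    next
      case False
      then show ?thesis unfolding eq n_subsets[OF V(1)] V(2) by (simp add: binomial_eq_0)
    qed
    then have "card {U\<in>?U. card U = j} * (C * (a / real n ^ j)) \<le> real n ^ j * (C * (a / real n ^ j))"
      using a C by (intro mult_right_mono) auto
    then show "(\<Sum>U\<in>{U\<in>?U. card U = j}. C * (a / real n ^ card U)) \<le> C * a" using V(3) by simp
  qed
  also have "\<dots> = C * real (k + 1) * a" by simp
  finally show ?thesis .
qed

lemma card_set_systems_le:
  assumes "finite W" "card W \<le> k" "P \<subseteq> {X. \<Union>X \<subseteq> W}"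
  shows "finite P" "card P \<le> 2 ^ 2 ^ k"
proof -
  have sub: "P \<subseteq> Pow (Pow W)" using assms(3) by auto
  show "finite P" using finite_subset[OF sub] assms(1) by simp
  have "card P \<le> card (Pow (Pow W))" using sub assms(1) by (intro card_mono) auto
  also have "\<dots> = 2 ^ 2 ^ card W" using assms(1) by (simp add: card_Pow)
  also have "\<dots> \<le> 2 ^ 2 ^ k" using assms(2) by (intro power_increasing) auto
  finally show "card P \<le> 2 ^ 2 ^ k" .
qed

section \<open>Random subsets and expectations over finite probability spaces\<close>

abbreviation Pr :: "'x pmf \<Rightarrow> 'x set \<Rightarrow> real" where "Pr M \<equiv> measure_pmf.prob M"

abbreviation Exp :: "'x pmf \<Rightarrow> ('x \<Rightarrow> real) \<Rightarrow> real" where "Exp M \<equiv> measure_pmf.expectation M"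

definition rsub :: "'x set \<Rightarrow> ('x \<Rightarrow> real) \<Rightarrow> 'x set pmf" where
  "rsub A r = map_pmf (\<lambda>f. {x\<in>A. f x}) (Pi_pmf A False (\<lambda>x. bernoulli_pmf (r x)))"

lemma prob_rsub:
  assumes "finite A" "S \<subseteq> A" "\<And>x. x \<in> A \<Longrightarrow> 0 \<le> r x \<and> r x \<le> 1"
  shows "Pr (rsub A r) {T. S \<subseteq> T} = (\<Prod>x\<in>S. r x)"
proof -
  let ?B = "\<lambda>x. if x \<in> S then {True} else UNIV"
  have "(\<lambda>f. {x\<in>A. f x}) -` {T. S \<subseteq> T} = Pi A ?B"
    using assms(2) by (auto simp: Pi_def)
  then have "Pr (rsub A r) {T. S \<subseteq> T} =
      Pr (Pi_pmf A False (\<lambda>x. bernoulli_pmf (r x))) (Pi A ?B)"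
    by (simp add: rsub_def)
  also have "\<dots> = (\<Prod>x\<in>A. Pr (bernoulli_pmf (r x)) (?B x))"
    using assms(1) by (rule measure_Pi_pmf_Pi)
  also have "\<dots> = (\<Prod>x\<in>A. if x \<in> S then r x else 1)"
    using assms(3) by (intro prod.cong refl) (auto simp: measure_pmf_single)
  also have "\<dots> = (\<Prod>x\<in>S. r x)"
    using assms(1,2) by (simp add: prod.If_cases Int_absorb1)
  finally show ?thesis .
qed

lemma set_rsub: "set_pmf (rsub A r) \<subseteq> Pow A"
  by (auto simp: rsub_def)

lemma expectation_card:
  assumes fin: "finite (set_pmf M)" and N: "finite N"
  shows "Exp M (\<lambda>T. real (card (g T \<inter> N))) = (\<Sum>x\<in>N. Pr M {T. x \<in> g T})"
proof -
  have "Exp M (\<lambda>T. real (card (g T \<inter> N))) =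
      Exp M (\<lambda>T. \<Sum>x\<in>N. indicator {T. x \<in> g T} T)"
    using N by (intro Bochner_Integration.integral_cong refl)
      (simp add: indicator_def sum.If_cases Int_def conj_commute)
  also have "\<dots> = (\<Sum>x\<in>N. Exp M (indicator {T. x \<in> g T}))"
    using fin by (intro Bochner_Integration.integral_sum integrable_measure_pmf_finite)
  also have "\<dots> = (\<Sum>x\<in>N. Pr M {T. x \<in> g T})" by simp
  finally show ?thesis .
qed

lemma expectation_mono:
  fixes f g :: "'x \<Rightarrow> real"
  assumes "finite (set_pmf M)" "\<And>x. x \<in> set_pmf M \<Longrightarrow> f x \<le> g x"
  shows "Exp M f \<le> Exp M g"
  using assms by (intro integral_mono_AE integrable_measure_pmf_finite) (auto simp: AE_measure_pmf_iff)

lemma prob_bind: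
  assumes "finite (set_pmf M)" "\<And>x. x \<in> set_pmf M \<Longrightarrow> finite (set_pmf (f x))"
  shows "Pr (bind_pmf M f) A = Exp M (\<lambda>x. Pr (f x) A)"
  using pmf_expectation_bind[OF assms subset_refl, where h = "indicator A :: _ \<Rightarrow> real"]
  by (simp add: integral_measure_pmf[OF assms(1)])

lemma expectation_bind:
  fixes h :: "'y \<Rightarrow> real"
  assumes "finite (set_pmf M)" "\<And>x. x \<in> set_pmf M \<Longrightarrow> finite (set_pmf (f x))"
  shows "Exp (bind_pmf M f) h = Exp M (\<lambda>x. Exp (f x) h)"
  using pmf_expectation_bind[OF assms subset_refl, where h = h]
  by (simp add: integral_measure_pmf[OF assms(1)])

lemma prob_Ball_le:
  assumes "finite P" "\<And>x. x \<in> set_pmf M \<Longrightarrow> x \<in> A \<Longrightarrow> \<exists>i\<in>P. x \<in> F i"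
  shows "Pr M A \<le> (\<Sum>i\<in>P. Pr M (F i))"
proof -
  have "Pr M A = Pr M (A \<inter> set_pmf M)"
    by (simp add: measure_Int_set_pmf)
  also have "\<dots> \<le> Pr M (\<Union>i\<in>P. F i)"
    using assms(2) by (intro measure_pmf.finite_measure_mono) auto
  also have "\<dots> \<le> (\<Sum>i\<in>P. Pr M (F i))"
    using assms(1) by (intro measure_pmf.finite_measure_subadditive_finite) auto
  finally show ?thesis .
qed

lemma prob_mono_set:
  assumes "\<And>x. x \<in> set_pmf M \<Longrightarrow> x \<in> A \<Longrightarrow> x \<in> B"
  shows "Pr M A \<le> Pr M B"
  using prob_Ball_le[of "{()}" M A "\<lambda>_. B"] assms by simp

section \<open>Expected numbers of copies and of overlapping pairs of copies\<close>

context strictly_balanced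
begin

definition cps :: "nat set \<Rightarrow> nat set set set" where
  "cps V = {X. cp X \<and> X \<subseteq> pairs V}"

lemma finite_cps: "finite V \<Longrightarrow> finite (cps V)"
  by (rule finite_subset[of _ "Pow (pairs V)"]) (auto simp: cps_def finite_pairs)

lemma cps_Union: "X \<in> cps V \<Longrightarrow> \<Union>X \<subseteq> V"
  using Union_pairs_subset by (auto simp: cps_def)

text \<open>The number of set systems on v points, which bounds the copies with a given vertex set,
  times the number of possible sizes of a vertex set.\<close>

abbreviation cst :: real where "cst \<equiv> 2 ^ 2 ^ v * real (v + 1)"

lemma v_ge_2: "2 \<le> v"
proof -
  have "\<theta> * (real e - 1) \<ge> 0" using \<theta> E2 by (intro mult_nonneg_nonneg) auto
  then show ?thesis using exact by linarith
qed

lemma powr_neg_power: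
  fixes x :: real
  assumes "x > 0"
  shows "(x powr (- \<theta>)) ^ k = x powr (- \<theta> * real k)"
  using assms by (simp add: powr_powr powr_realpow[symmetric])

lemma sum_cps:
  assumes V: "finite V" "card V = n" "n > 0"
  shows "(\<Sum>X\<in>cps V. (real n powr (- \<theta>)) ^ e) \<le> cst * real n powr (2 - \<theta>)"
proof -
  have "(\<Sum>X\<in>cps V. (real n powr (- \<theta>)) ^ e) \<le> 2 ^ 2 ^ v * real (v + 1) * real n powr (2 - \<theta>)"
  proof (rule sum_by_vertices[OF V finite_cps[OF V(1)], where \<phi> = "\<lambda>X. \<Union>X"])
    fix X assume "X \<in> cps V"
    then show "\<Union>X \<subseteq> V \<and> card (\<Union>X) \<le> v" using cps_Union finite_cp by (auto simp: cps_def)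
    have "- \<theta> * real e = (2 - \<theta>) - real v" using exact by (simp add: algebra_simps)
    then have "(real n powr (- \<theta>)) ^ e = real n powr (2 - \<theta>) / real n ^ v"
      using V by (simp only: powr_neg_power powr_diff powr_realpow of_nat_0_less_iff)
    then show "(real n powr (- \<theta>)) ^ e \<le> real n powr (2 - \<theta>) / real n ^ card (\<Union>X)"
      using \<open>X \<in> cps V\<close> finite_cp by (simp add: cps_def)
  next
    fix U assume U: "U \<subseteq> V" "card U \<le> v"
    have "card {X \<in> cps V. \<Union>X = U} \<le> 2 ^ 2 ^ v"
      by (rule card_set_systems_le(2)[OF finite_subset[OF U(1) V(1)] U(2)]) auto
    then have "real (card {X \<in> cps V. \<Union>X = U}) \<le> real (2 ^ 2 ^ v)" by (simp only: of_nat_le_iff)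
    then show "real (card {X \<in> cps V. \<Union>X = U}) \<le> 2 ^ 2 ^ v" by simp
  qed auto
  then show ?thesis by simp
qed

text \<open>Fixing one edge removes two vertices and one factor n^(-\<theta>), and v - 2 - \<theta>
  (e - 1) = 0. So at this density a pair expects only a bounded number of copies that it would
  complete, which is what makes the nibble possible.\<close>

lemma sum_cps_through:
  assumes V: "finite V" "card V = n" "n > 0" and x: "x \<in> pairs V"
  shows "(\<Sum>X\<in>{X\<in>cps V. x \<in> X}. (real n powr (- \<theta>)) ^ (e - 1)) \<le> cst"
proof -
  have cx: "card x = 2" "finite x" using x card_ge_0_finite[of x] by (auto simp: pairs_def)
  have cd: "card (\<Union>X - x) = v - 2" if "X \<in> cps V" "x \<in> X" for X
    using that finite_cp[of X] cx by (subst card_Diff_subset) (auto simp: cps_def)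
  have "(\<Sum>X\<in>{X\<in>cps V. x \<in> X}. (real n powr (- \<theta>)) ^ (e - 1)) \<le> 2 ^ 2 ^ v * real (v + 1) * 1"
  proof (rule sum_by_vertices[OF V, where \<phi> = "\<lambda>X. \<Union>X - x"])
    fix X assume X: "X \<in> {X\<in>cps V. x \<in> X}"
    then show "\<Union>X - x \<subseteq> V \<and> card (\<Union>X - x) \<le> v" using cps_Union cd by auto
    have "- \<theta> * real (e - 1) = - real (v - 2)" using exact E2 v_ge_2 by (simp add: algebra_simps of_nat_diff)
    then have "(real n powr (- \<theta>)) ^ (e - 1) = real n powr (- real (v - 2))"
      using V by (simp only: powr_neg_power of_nat_0_less_iff)
    also have "\<dots> = 1 / real n ^ (v - 2)"
      using V by (simp only: powr_minus powr_realpow of_nat_0_less_iff inverse_eq_divide)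
    finally have "(real n powr (- \<theta>)) ^ (e - 1) = 1 / real n ^ (v - 2)" .
    then show "(real n powr (- \<theta>)) ^ (e - 1) \<le> 1 / real n ^ card (\<Union>X - x)"
      using X cd by simp
  next
    fix U assume U: "U \<subseteq> V" "card U \<le> v"
    show "real (card {X \<in> {X\<in>cps V. x \<in> X}. \<Union>X - x = U}) \<le> 2 ^ 2 ^ v"
    proof (cases "{X \<in> {X\<in>cps V. x \<in> X}. \<Union>X - x = U} = {}")
      case True
      show ?thesis unfolding True by simp
    next
      case False
      then obtain X where X: "X \<in> cps V" "x \<in> X" "\<Union>X - x = U" by auto
      then have "U \<union> x = \<Union>X" by auto
      then have "card (U \<union> x) \<le> v" "finite (U \<union> x)" using X finite_cp[of X] by (auto simp: cps_def)
      from card_set_systems_le(2)[OF this(2,1), of "{X \<in> {X\<in>cps V. x \<in> X}. \<Union>X - x = U}"]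
      have "card {X \<in> {X\<in>cps V. x \<in> X}. \<Union>X - x = U} \<le> 2 ^ 2 ^ v" by auto
      then have "real (card {X \<in> {X\<in>cps V. x \<in> X}. \<Union>X - x = U}) \<le> real (2 ^ 2 ^ v)"
        by (simp only: of_nat_le_iff)
      then show ?thesis by simp
    qed
  qed (use finite_cps[OF V(1)] in auto)
  then show ?thesis by simp
qed

definition overlaps :: "nat set \<Rightarrow> nat set set \<Rightarrow> nat set \<Rightarrow> nat set \<Rightarrow> (nat set set \<times> nat set set) set" where
  "overlaps V S x1 x2 = {(X1, X2). X1 \<in> cps V \<and> X2 \<in> cps V \<and> x1 \<in> X1 \<and> x1 \<notin> X2 \<and>
     x2 \<in> X2 \<and> x2 \<notin> X1 \<and> \<not> X1 \<subseteq> S \<and> X1 \<inter> X2 \<noteq> {}}"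

lemma finite_overlaps: "finite V \<Longrightarrow> finite (overlaps V S x1 x2)"
  by (rule finite_subset[of _ "cps V \<times> cps V"]) (auto simp: overlaps_def finite_cps)

definition ocst :: "nat \<Rightarrow> real" where
  "ocst s = (2 ^ 2 ^ (2 * s + 2 * v))\<^sup>2 * real (2 * v + 1)"

text \<open>Vertices and edges of \<open>S\<close> are given and cost nothing, so the exponent of a
  pair of copies is the change of weight from \<open>S\<close> to
  \<open>S \<union> X1 \<union> X2\<close>, which \<open>overlap\<close> bounds by -
  \<epsilon>.\<close>

lemma sum_overlaps:
  assumes V: "finite V" "card V = n" "n > 0" and S: "S \<subseteq> pairs V" "card S \<le> s"
    and x: "x1 \<in> S" "x2 \<in> S"
  shows "(\<Sum>(X1, X2)\<in>overlaps V S x1 x2. (real n powr (- \<theta>)) ^ card (X1 \<union> X2 - S)) \<le>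
    ocst s * real n powr (- \<epsilon>)"
proof -
  have fS: "finite S" using S V finite_pairs finite_subset by blast
  have fUS: "finite (\<Union>S)" using Union_pairs_subset[OF S(1)] V(1) finite_subset by blast
  have cUS: "card (\<Union>S) \<le> 2 * s"
  proof -
    have "card (\<Union>S) \<le> (\<Sum>g\<in>S. card g)" by (rule card_Union_le_sum_card)
    also have "\<dots> = (\<Sum>g\<in>S. 2)" using S(1) by (intro sum.cong) (auto simp: pairs_def)
    finally show ?thesis using S(2) by simp
  qed
  let ?h = "\<lambda>X. (real n powr (- \<theta>)) ^ card (fst X \<union> snd X - S)"
  let ?f = "\<lambda>X. \<Union>(fst X \<union> snd X) - \<Union>S"
  let ?P = "overlaps V S x1 x2"
  have "sum ?h ?P \<le> (2 ^ 2 ^ (2 * s + 2 * v))\<^sup>2 * real (2 * v + 1) * real n powr (- \<epsilon>)"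
  proof (rule sum_by_vertices[OF V finite_overlaps[OF V(1)], where \<phi> = ?f])
    fix X assume X: "X \<in> ?P"
    obtain X1 X2 where X12: "X = (X1, X2)" by (cases X)
    have cp12: "cp X1" "cp X2" "X1 \<in> cps V" "X2 \<in> cps V" using X X12 by (auto simp: overlaps_def cps_def)
    note f1 = finite_cp[OF cp12(1)] and f2 = finite_cp[OF cp12(2)]
    have "card (?f X) \<le> card (\<Union>X1 \<union> \<Union>X2)"
      using f1 f2 X12 by (intro card_mono) auto
    also have "\<dots> \<le> 2 * v" using card_Un_le[of "\<Union>X1" "\<Union>X2"] f1 f2 by linarith
    finally show "?f X \<subseteq> V \<and> card (?f X) \<le> 2 * v"
      using cps_Union[OF cp12(3)] cps_Union[OF cp12(4)] X12 by auto
    have ov: "wt \<theta> (S \<union> X1 \<union> X2) \<le> wt \<theta> S - \<epsilon>"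
      by (rule overlap[OF fS fUS cp12(1,2), of x1 x2]) (use X X12 x in \<open>auto simp: overlaps_def\<close>)
    have "card (S \<union> X1 \<union> X2) = card S + card (X1 \<union> X2 - S)"
      using fS f1 f2 card_Un_disjoint[of S "X1 \<union> X2 - S"] by (simp add: Un_assoc)
    moreover have "card (\<Union>(S \<union> X1 \<union> X2)) = card (\<Union>S) + card (?f X)"
    proof -
      have "\<Union>(S \<union> X1 \<union> X2) = \<Union>S \<union> ?f X" using X12 by auto
      moreover have "card (\<Union>S \<union> ?f X) = card (\<Union>S) + card (?f X)"
        using fUS f1 f2 X12 by (intro card_Un_disjoint) auto
      ultimately show ?thesis by metis
    qed
    ultimately have "real (card (?f X)) - \<theta> * card (X1 \<union> X2 - S) \<le> - \<epsilon>"
      using ov by (simp add: wt_def algebra_simps)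
    then have "- \<theta> * card (X1 \<union> X2 - S) \<le> - \<epsilon> - card (?f X)" by simp
    then have "real n powr (- \<theta> * card (X1 \<union> X2 - S)) \<le> real n powr (- \<epsilon> - card (?f X))"
      using V(3) by (intro powr_mono) auto
    also have "\<dots> = real n powr (- \<epsilon>) / real n ^ card (?f X)"
      using V(3) by (simp add: powr_diff powr_realpow)
    finally show "?h X \<le> real n powr (- \<epsilon>) / real n ^ card (?f X)"
      using V(3) X12 by (simp add: powr_neg_power)
  next
    fix U assume U: "U \<subseteq> V" "card U \<le> 2 * v"
    let ?W = "\<Union>S \<union> U" and ?Q = "{X. \<Union>X \<subseteq> \<Union>S \<union> U}"
    have fW: "finite ?W" using fUS U V finite_subset by auto
    have cW: "card ?W \<le> 2 * s + 2 * v" using card_Un_le[of "\<Union>S" U] cUS U by linarith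
    have Q: "finite ?Q" "card ?Q \<le> 2 ^ 2 ^ (2 * s + 2 * v)"
      using card_set_systems_le[OF fW cW subset_refl] .
    have "{X \<in> ?P. ?f X = U} \<subseteq> ?Q \<times> ?Q" by fastforce
    then have "card {X \<in> ?P. ?f X = U} \<le> card (?Q \<times> ?Q)" using Q by (intro card_mono) auto
    also have "\<dots> \<le> (2 ^ 2 ^ (2 * s + 2 * v)) * (2 ^ 2 ^ (2 * s + 2 * v))"
      unfolding card_cartesian_product using Q(2) by (intro mult_mono) auto
    finally have "card {X \<in> ?P. ?f X = U} \<le> (2 ^ 2 ^ (2 * s + 2 * v))\<^sup>2" by (simp add: power2_eq_square)
    then have "real (card {X \<in> ?P. ?f X = U}) \<le> real ((2 ^ 2 ^ (2 * s + 2 * v))\<^sup>2)" by (simp only: of_nat_le_iff)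
    then show "real (card {X \<in> ?P. ?f X = U}) \<le> (2 ^ 2 ^ (2 * s + 2 * v))\<^sup>2" by simp
  qed auto
  then show ?thesis by (simp add: ocst_def case_prod_beta)
qed

section \<open>One round of deletions and additions\<close>

definition closers :: "nat set set \<Rightarrow> nat set \<Rightarrow> nat set set set" where
  "closers G x = {X. cp X \<and> x \<in> X \<and> X \<subseteq> insert x G}"

definition openable :: "nat set \<Rightarrow> nat \<Rightarrow> nat set set \<Rightarrow> nat set set" where
  "openable V z G = {x \<in> pairs V - G. card (closers G x) \<le> z}"

text \<open>One edge from each copy that \<open>x\<close> would complete: once these edges are
  deleted, \<open>x\<close> can be added. Different copies may yield the same edge, so it is a set
  that can be smaller than the number of closers.\<close>

definition transversal :: "nat set set \<Rightarrow> nat set \<Rightarrow> nat set set" where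
  "transversal G x = (\<lambda>X. SOME y. y \<in> X - {x}) ` closers G x"

text \<open>The factor depending on the transversal makes every openable pair join the graph with
  probability exactly \<open>q\<close>.\<close>

definition rate :: "nat set \<Rightarrow> nat \<Rightarrow> real \<Rightarrow> real \<Rightarrow> nat set set \<Rightarrow> nat set \<Rightarrow> real" where
  "rate V z \<delta> q G x = (if x \<in> G then \<delta>
     else if x \<in> openable V z G then q * (1 / \<delta>) ^ card (transversal G x) else 0)"

text \<open>A single independent sample \<open>T\<close> plays two roles: its members in
  \<open>G\<close> are deleted, its members outside \<open>G\<close> are proposed for
  addition.\<close>

definition added :: "nat set \<Rightarrow> nat \<Rightarrow> nat set set \<Rightarrow> nat set set \<Rightarrow> nat set set" where
  "added V z G T = {x \<in> openable V z G. x \<in> T \<and> transversal G x \<subseteq> T}"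

definition grown :: "nat set \<Rightarrow> nat \<Rightarrow> nat set set \<Rightarrow> nat set set \<Rightarrow> nat set set" where
  "grown V z G T = (G - T) \<union> added V z G T"

definition bad :: "nat set \<Rightarrow> nat \<Rightarrow> nat set set \<Rightarrow> nat set set \<Rightarrow> nat set set" where
  "bad V z G T = {x \<in> added V z G T. \<exists>X. cp X \<and> X \<subseteq> grown V z G T \<and> x \<in> X}"

definition improved :: "nat set \<Rightarrow> nat \<Rightarrow> nat set set \<Rightarrow> nat set set \<Rightarrow> nat set set" where
  "improved V z G T = grown V z G T - bad V z G T"

definition copy_free :: "nat set \<Rightarrow> nat set set set" where
  "copy_free V = {G. G \<subseteq> pairs V \<and> (\<forall>X. cp X \<longrightarrow> \<not> X \<subseteq> G)}"

lemma finite_copy_free: "finite V \<Longrightarrow> finite (copy_free V)"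
  by (rule finite_subset[of _ "Pow (pairs V)"]) (auto simp: copy_free_def finite_pairs)

lemma finite_closers: "finite G \<Longrightarrow> finite (closers G x)"
  by (rule finite_subset[of _ "Pow (insert x G)"]) (auto simp: closers_def)

lemma finite_transversal: "finite G \<Longrightarrow> finite (transversal G x)"
  by (simp add: transversal_def finite_closers)

lemma closer_pick:
  assumes "X \<in> closers G x"
  shows "(SOME y. y \<in> X - {x}) \<in> X - {x}"
proof -
  have "X \<noteq> {x}" "x \<in> X" using assms finite_cp(3)[of X] E2 by (auto simp: closers_def)
  then have "\<exists>y. y \<in> X - {x}" by auto
  then show ?thesis by (rule someI_ex)
qed

lemma transversal_subset: "transversal G x \<subseteq> G"
proof
  fix y assume "y \<in> transversal G x"
  then obtain X where "X \<in> closers G x" "y = (SOME y. y \<in> X - {x})" by (auto simp: transversal_def)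
  then have "y \<in> X - {x}" "X \<subseteq> insert x G" using closer_pick by (auto simp: closers_def)
  then show "y \<in> G" by auto
qed

lemma transversal_hits: "X \<in> closers G x \<Longrightarrow> \<exists>y\<in>transversal G x. y \<in> X - {x}"
  using closer_pick by (fastforce simp: transversal_def)

lemma transversal_closer:
  assumes "y \<in> transversal G x"
  shows "\<exists>X\<in>closers G x. y \<in> X - {x}"
proof -
  obtain X where "X \<in> closers G x" "y = (SOME y. y \<in> X - {x})" using assms by (auto simp: transversal_def)
  then show ?thesis using closer_pick by blast
qed

lemma card_transversal_le:
  assumes "finite G" "x \<in> openable V z G"
  shows "card (transversal G x) \<le> z"
proof -
  have "card (transversal G x) \<le> card (closers G x)"
    unfolding transversal_def using finite_closers[OF assms(1)] by (rule card_image_le)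
  then show ?thesis using assms(2) by (simp add: openable_def)
qed

lemma added_disjoint: "added V z G T \<inter> G = {}"
  by (auto simp: added_def openable_def)

text \<open>A copy with only one added edge would be a closer of it, but every closer has lost an
  edge to the transversal. Copies therefore need two simultaneous additions, which makes the damage
  quadratic in \<open>q\<close> while the gain is linear.\<close>

lemma copy_in_grown:
  assumes G: "G \<in> copy_free V" and X: "cp X" "X \<subseteq> grown V z G T"
  shows "2 \<le> card (X \<inter> added V z G T)"
proof (rule ccontr)
  assume "\<not> ?thesis"
  moreover have fin: "finite (X \<inter> added V z G T)" using finite_cp[OF X(1)] by auto
  moreover have "X \<inter> added V z G T \<noteq> {}"
  proof
    assume "X \<inter> added V z G T = {}"
    then have "X \<subseteq> G" using X(2) by (auto simp: grown_def)
    then show False using G X(1) by (auto simp: copy_free_def)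
  qed
  ultimately have "card (X \<inter> added V z G T) = 1"
    by (metis One_nat_def Suc_1 card_gt_0_iff le_antisym not_less_eq_eq Suc_leI)
  then obtain x where x: "X \<inter> added V z G T = {x}" by (auto simp: card_1_singleton_iff)
  then have "X \<subseteq> insert x (G - T)" "x \<in> X" "x \<in> added V z G T" using X(2) by (auto simp: grown_def)
  then have "X \<in> closers G x" using X(1) by (auto simp: closers_def)
  then obtain y where y: "y \<in> transversal G x" "y \<in> X - {x}" using transversal_hits by blast
  then have "y \<in> T" using \<open>x \<in> added V z G T\<close> by (auto simp: added_def)
  then show False using y \<open>X \<subseteq> insert x (G - T)\<close> by auto
qed

lemma improved_copy_free:
  assumes G: "G \<in> copy_free V"
  shows "improved V z G T \<in> copy_free V"
proof -
  have "improved V z G T \<subseteq> pairs V"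
    using G by (auto simp: improved_def grown_def added_def openable_def copy_free_def)
  moreover have False if X: "cp X" "X \<subseteq> improved V z G T" for X
  proof -
    have Xg: "X \<subseteq> grown V z G T" using X(2) by (auto simp: improved_def)
    from copy_in_grown[OF G X(1) Xg] have "X \<inter> added V z G T \<noteq> {}" by auto
    then obtain x where "x \<in> X" "x \<in> added V z G T" by auto
    then have "x \<in> bad V z G T" using X(1) Xg by (auto simp: bad_def)
    then show False using \<open>x \<in> X\<close> X(2) by (auto simp: improved_def)
  qed
  ultimately show ?thesis by (auto simp: copy_free_def)
qed

lemma improved_subset: "improved V z G T \<subseteq> G \<union> added V z G T"
  by (auto simp: improved_def grown_def)

text \<open>\<open>S\<close> stands for the added edges of the copy \<open>X\<close>, of which there
  are at least two by \<open>copy_in_grown\<close>; the other edges come from the old graph.\<close>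

definition conflicts :: "nat set \<Rightarrow> (nat set set \<times> nat set set) set" where
  "conflicts V = (SIGMA X:cps V. {S. S \<subseteq> X \<and> 2 \<le> card S})"

lemma finite_conflicts: "finite V \<Longrightarrow> finite (conflicts V)"
  unfolding conflicts_def using finite_cps
  by (intro finite_SigmaI) (auto simp: cps_def dest!: finite_cp(1))

lemma card_bad_le:
  assumes V: "finite V" and G: "G \<in> copy_free V"
  shows "real (card (bad V z G T)) \<le>
    real e * (\<Sum>(X, S)\<in>conflicts V. if X - S \<subseteq> G \<and> S \<subseteq> added V z G T then 1 else 0)"
proof -
  let ?D = "{(X, S) \<in> conflicts V. X - S \<subseteq> G \<and> S \<subseteq> added V z G T}"
  let ?C = "{X \<in> cps V. X \<subseteq> grown V z G T}"
  have gp: "grown V z G T \<subseteq> pairs V"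
    using G by (auto simp: grown_def added_def openable_def copy_free_def)
  have fC: "finite ?C" using finite_cps[OF V] by auto
  have "bad V z G T \<subseteq> \<Union>?C" using gp by (auto simp: bad_def cps_def)
  moreover have "finite (\<Union>?C)" using fC finite_cp(1) by (auto simp: cps_def)
  ultimately have "card (bad V z G T) \<le> card (\<Union>?C)" by (intro card_mono) auto
  also have "\<dots> \<le> (\<Sum>X\<in>?C. card X)" by (rule card_Union_le_sum_card)
  also have "\<dots> = (\<Sum>X\<in>?C. e)" by (intro sum.cong) (auto simp: cps_def finite_cp(3))
  also have "\<dots> = e * card ?C" by simp
  also have "card ?C \<le> card ?D"
  proof (rule card_inj_on_le[where f = "\<lambda>X. (X, X \<inter> added V z G T)"])
    show "inj_on (\<lambda>X. (X, X \<inter> added V z G T)) ?C" by (auto simp: inj_on_def)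
    show "(\<lambda>X. (X, X \<inter> added V z G T)) ` ?C \<subseteq> ?D"
      using copy_in_grown[OF G] by (auto simp: conflicts_def cps_def grown_def)
    show "finite ?D"
      by (rule finite_subset[OF _ finite_conflicts[OF V]]) auto
  qed
  finally have "card (bad V z G T) \<le> e * card ?D"
    by simp
  then have "real (card (bad V z G T)) \<le>
      real (e * card ?D)"
    by (simp only: of_nat_le_iff)
  also have "\<dots> = real e * real (card ?D)"
    by (rule of_nat_mult)
  also have "real (card ?D) =
      (\<Sum>(X, S)\<in>conflicts V. if X - S \<subseteq> G \<and> S \<subseteq> added V z G T then 1 else 0)"
  proof -
    have "?D =
      conflicts V \<inter> {x. fst x - snd x \<subseteq> G \<and> snd x \<subseteq> added V z G T}" by auto
    then show ?thesis using finite_conflicts[OF V] by (simp add: case_prod_beta sum.If_cases)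
  qed
  finally show ?thesis .
qed

lemma card_improved_ge:
  assumes V: "finite V" and G: "G \<in> copy_free V"
  shows "real (card G) - real (card (T \<inter> G)) + real (card (added V z G T)) -
    real e * (\<Sum>(X, S)\<in>conflicts V. if X - S \<subseteq> G \<and> S \<subseteq> added V z G T then 1 else 0)
    \<le> real (card (improved V z G T))"
proof -
  have fG: "finite G" using G finite_pairs[OF V] by (auto simp: copy_free_def dest: finite_subset)
  have fA: "finite (added V z G T)"
    by (rule finite_subset[OF _ finite_pairs[OF V]]) (auto simp: added_def openable_def)
  have "card (grown V z G T) = card (G - T) + card (added V z G T)"
    unfolding grown_def using fG fA added_disjoint[of V z G T] by (intro card_Un_disjoint) auto
  moreover have "card (G - T) = card G - card (T \<inter> G)" "card (T \<inter> G) \<le> card G"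
    using fG by (auto simp: card_Diff_subset_Int Int_commute intro: card_mono)
  moreover have "card (grown V z G T) - card (bad V z G T) \<le> card (improved V z G T)"
    unfolding improved_def using fA by (intro diff_card_le_card_Diff) (auto simp: bad_def)
  ultimately show ?thesis using card_bad_le[OF assms, of z T] by linarith
qed

definition clash :: "nat set set \<Rightarrow> nat set set \<Rightarrow> bool" where
  "clash G S \<longleftrightarrow> (\<exists>x\<in>S. \<exists>y\<in>S. x \<noteq> y \<and> transversal G x \<inter> transversal G y \<noteq> {})"

lemma rate_bounds:
  assumes "finite V" "G \<subseteq> pairs V" "0 < \<delta>" "\<delta> \<le> 1" "0 \<le> q" "q * (1 / \<delta>) ^ z \<le> 1"
  shows "0 \<le> rate V z \<delta> q G x \<and> rate V z \<delta> q G x \<le> 1"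
proof -
  have fG: "finite G" by (rule finite_subset[OF assms(2) finite_pairs[OF assms(1)]])
  have "q * (1 / \<delta>) ^ card (transversal G x) \<le> 1" if "x \<in> openable V z G"
  proof -
    have "(1 / \<delta>) ^ card (transversal G x) \<le> (1 / \<delta>) ^ z"
      using card_transversal_le[OF fG that] assms by (intro power_increasing) auto
    from mult_left_mono[OF this assms(5)] show ?thesis using assms(6) by (rule order_trans)
  qed
  then show ?thesis using assms by (auto simp: rate_def)
qed

text \<open>If the transversals are pairwise disjoint, the factors 1 / \<delta> in the rates cancel
  the deletion probabilities exactly. If two of them meet, a common deletion is compensated more
  than once, and only a crude bound by powers of 1 / \<delta> remains.\<close>

lemma prob_added_le:
  assumes V: "finite V" and G: "G \<subseteq> pairs V" and \<delta>: "0 < \<delta>" "\<delta> \<le> 1"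
    and q: "0 \<le> q" "q * (1 / \<delta>) ^ z \<le> 1" and S: "finite S"
  shows "Pr (rsub (pairs V) (rate V z \<delta> q G)) {T. S \<subseteq> added V z G T} \<le>
    q ^ card S * (1 + (if S \<subseteq> openable V z G \<and> clash G S then (1 / \<delta>) ^ (z * card S) else 0))"
proof (cases "S \<subseteq> openable V z G")
  case False
  then have "{T. S \<subseteq> added V z G T} = {}" by (auto simp: added_def)
  then show ?thesis using q False by simp
next
  case True
  have fG: "finite G" by (rule finite_subset[OF G finite_pairs[OF V]])
  let ?U = "\<Union>(transversal G ` S)"
  have UG: "?U \<subseteq> G" using transversal_subset by auto
  have SG: "S \<inter> ?U = {}" using True UG by (auto simp: openable_def)
  have fU: "finite ?U" using S finite_transversal[OF fG] by auto
  let ?r = "rate V z \<delta> q G"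
  have "Pr (rsub (pairs V) ?r) {T. S \<subseteq> added V z G T} \<le>
      Pr (rsub (pairs V) ?r) {T. S \<union> ?U \<subseteq> T}"
    by (rule prob_mono_set) (auto simp: added_def)
  also have "\<dots> = (\<Prod>x\<in>S \<union> ?U. ?r x)"
    using True UG G rate_bounds[OF V G \<delta> q] finite_pairs[OF V]
    by (intro prob_rsub) (auto simp: openable_def)
  also have "\<dots> = (\<Prod>x\<in>S. ?r x) * (\<Prod>x\<in>?U. ?r x)"
    using S fU SG by (rule prod.union_disjoint)
  also have "(\<Prod>x\<in>S. ?r x) = (\<Prod>x\<in>S. q * (1 / \<delta>) ^ card (transversal G x))"
    using True by (intro prod.cong) (auto simp: rate_def openable_def)
  also have "\<dots> = q ^ card S * (1 / \<delta>) ^ (\<Sum>x\<in>S. card (transversal G x))"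
    by (simp add: prod.distrib power_sum)
  also have "(\<Prod>x\<in>?U. ?r x) = \<delta> ^ card ?U"
    using UG by (subst prod.cong[OF refl, of _ _ "\<lambda>_. \<delta>"]) (auto simp: rate_def)
  finally have main: "Pr (rsub (pairs V) ?r) {T. S \<subseteq> added V z G T} \<le>
      q ^ card S * ((1 / \<delta>) ^ (\<Sum>x\<in>S. card (transversal G x)) * \<delta> ^ card ?U)" by (simp add: mult.assoc)
  show ?thesis
  proof (cases "clash G S")
    case False
    then have "card ?U = (\<Sum>x\<in>S. card (transversal G x))"
      using S finite_transversal[OF fG] by (intro card_UN_disjoint) (auto simp: clash_def)
    then show ?thesis using main False \<delta> by (simp add: power_one_over)
  next
    case True
    have "(\<Sum>x\<in>S. card (transversal G x)) \<le> (\<Sum>x\<in>S. z)"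
      using \<open>S \<subseteq> openable V z G\<close> card_transversal_le[OF fG] by (intro sum_mono) auto
    then have "(1 / \<delta>) ^ (\<Sum>x\<in>S. card (transversal G x)) \<le> (1 / \<delta>) ^ (z * card S)"
      using \<delta> by (intro power_increasing) (auto simp: mult.commute)
    moreover have "\<delta> ^ card ?U \<le> 1" using \<delta> by (intro power_le_one) auto
    ultimately have "(1 / \<delta>) ^ (\<Sum>x\<in>S. card (transversal G x)) * \<delta> ^ card ?U \<le> (1 / \<delta>) ^ (z * card S) * 1"
      using \<delta> by (intro mult_mono) auto
    then have "q ^ card S * ((1 / \<delta>) ^ (\<Sum>x\<in>S. card (transversal G x)) * \<delta> ^ card ?U) \<le>
        q ^ card S * (1 + (1 / \<delta>) ^ (z * card S))"
      using q by (intro mult_left_mono) auto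
    then show ?thesis using main True \<open>S \<subseteq> openable V z G\<close> by simp
  qed
qed

lemma prob_added_single:
  assumes V: "finite V" and G: "G \<subseteq> pairs V" and \<delta>: "0 < \<delta>" "\<delta> \<le> 1"
    and q: "0 \<le> q" "q * (1 / \<delta>) ^ z \<le> 1" and x: "x \<in> openable V z G"
  shows "Pr (rsub (pairs V) (rate V z \<delta> q G)) {T. x \<in> added V z G T} = q"
proof -
  have fG: "finite G" by (rule finite_subset[OF G finite_pairs[OF V]])
  have TG: "transversal G x \<subseteq> G" by (rule transversal_subset)
  have xT: "x \<notin> G" "x \<in> pairs V" using x by (auto simp: openable_def)
  let ?r = "rate V z \<delta> q G"
  have "{T. x \<in> added V z G T} = {T. insert x (transversal G x) \<subseteq> T}" using x by (auto simp: added_def)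
  then have "Pr (rsub (pairs V) ?r) {T. x \<in> added V z G T} = (\<Prod>y\<in>insert x (transversal G x). ?r y)"
    using xT TG G rate_bounds[OF V G \<delta> q] finite_pairs[OF V] by (simp only:) (rule prob_rsub, auto)
  also have "\<dots> = ?r x * (\<Prod>y\<in>transversal G x. ?r y)"
    using xT TG finite_transversal[OF fG] by (intro prod.insert) auto
  also have "(\<Prod>y\<in>transversal G x. ?r y) = \<delta> ^ card (transversal G x)"
    using TG by (subst prod.cong[OF refl, of _ _ "\<lambda>_. \<delta>"]) (auto simp: rate_def)
  also have "?r x = q * (1 / \<delta>) ^ card (transversal G x)" using x xT by (simp add: rate_def)
  finally show ?thesis using \<delta> by (simp add: power_one_over)
qed

end

section \<open>Probability estimates for one round\<close>

locale nibble = strictly_balanced E \<theta> \<epsilon> for E :: "'a set set" and \<theta> \<epsilon> +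
  fixes V :: "nat set" and n z s :: nat and \<delta> q B :: real and M :: "nat set set pmf"
  assumes V: "finite V" "card V = n" "2 \<le> n" and B: "1 \<le> B"
    and \<delta>: "0 < \<delta>" "\<delta> \<le> 1" and q: "0 \<le> q" "q * (1 / \<delta>) ^ z \<le> 1"
    and s: "e \<le> s" and M_free: "set_pmf M \<subseteq> copy_free V"
    and M_spread: "\<And>S. S \<subseteq> pairs V \<Longrightarrow> card S \<le> s + 2 * e \<Longrightarrow>
      Pr M {G. S \<subseteq> G} \<le> (B * real n powr (- \<theta>)) ^ card S"
begin

abbreviation p :: real where "p \<equiv> real n powr (- \<theta>)"

text \<open>The relative error caused by meeting transversals: the crude factor from
  \<open>prob_added_le\<close> times the probability of a clash. The exponent 2 e, here and in the
  assumption on \<open>M\<close>, counts the edges of the two copies that witness a clash.\<close>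

definition D :: real where
  "D = (1 / \<delta>) ^ (z * s) * ((real s)\<^sup>2 * (B ^ (2 * e) * (ocst s * real n powr (- \<epsilon>))))"

lemma p_pos: "0 < p" using V by simp

lemma n_pos: "0 < n" using V by simp

lemma finite_M: "finite (set_pmf M)"
  using M_free finite_copy_free[OF V(1)] finite_subset by blast

lemma M_pairs: "G \<in> set_pmf M \<Longrightarrow> G \<subseteq> pairs V"
  using M_free by (auto simp: copy_free_def)

lemma finP: "finite (pairs V)" using V finite_pairs by blast

text \<open>A clash gives two closers with a common edge, and all their edges outside
  \<open>S1 \<union> S2\<close> lie in the random graph. The assumption on copies inside
  \<open>S1 \<union> S2\<close> guarantees that the first closer has such an edge, as
  \<open>overlap\<close> requires.\<close>

lemma clash_prob:
  assumes S: "S1 \<subseteq> pairs V" "S2 \<subseteq> pairs V" "S1 \<inter> S2 = {}" "card (S1 \<union> S2) \<le> s"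
    and ncp: "\<And>X. cp X \<Longrightarrow> X \<subseteq> S1 \<union> S2 \<Longrightarrow> card (X \<inter> S2) \<noteq> 1"
  shows "Pr M {G. S1 \<subseteq> G \<and> S2 \<subseteq> openable V z G \<and> clash G S2} \<le>
    (real s)\<^sup>2 * (B ^ (2 * e) * (ocst s * real n powr (- \<epsilon>))) * (B * p) ^ card S1"
proof -
  let ?S = "S1 \<union> S2"
  let ?P = "SIGMA xy:S2 \<times> S2. overlaps V ?S (fst xy) (snd xy)"
  let ?F = "\<lambda>i. {G. S1 \<union> (fst (snd i) \<union> snd (snd i) - ?S) \<subseteq> G}"
  have finS: "finite S1" "finite S2" using finite_subset[OF S(1) finP] finite_subset[OF S(2) finP] by auto
  have finP': "finite ?P" using finS finite_overlaps[OF V(1)] by (intro finite_SigmaI) auto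
  have "Pr M {G. S1 \<subseteq> G \<and> S2 \<subseteq> openable V z G \<and> clash G S2} \<le>
      (\<Sum>i\<in>?P. Pr M (?F i))"
  proof (rule prob_Ball_le[OF finP'])
    fix G assume "G \<in> set_pmf M" and "G \<in> {G. S1 \<subseteq> G \<and> S2 \<subseteq> openable V z G \<and> clash G S2}"
    then have GV: "G \<subseteq> pairs V" and G: "S1 \<subseteq> G" "S2 \<subseteq> openable V z G" "clash G S2"
      using M_pairs by auto
    have S2G: "S2 \<inter> G = {}" using G(2) by (auto simp: openable_def)
    obtain x y w where xy: "x \<in> S2" "y \<in> S2" "x \<noteq> y" "w \<in> transversal G x" "w \<in> transversal G y"
      using G(3) by (auto simp: clash_def)
    obtain X1 where X1: "X1 \<in> closers G x" "w \<in> X1 - {x}" using transversal_closer[OF xy(4)] by blast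
    obtain X2 where X2: "X2 \<in> closers G y" "w \<in> X2 - {y}" using transversal_closer[OF xy(5)] by blast
    have sub: "X1 \<subseteq> insert x G" "X2 \<subseteq> insert y G" "x \<in> X1" "y \<in> X2" "cp X1" "cp X2"
      using X1 X2 by (auto simp: closers_def)
    have "\<not> X1 \<subseteq> ?S"
    proof
      assume "X1 \<subseteq> ?S"
      moreover have "X1 \<inter> S2 = {x}" using sub S2G xy by auto
      ultimately show False using ncp[OF sub(5)] by simp
    qed
    moreover have "X1 \<in> cps V" "X2 \<in> cps V" using sub GV S(2) xy by (auto simp: cps_def)
    moreover have "x \<notin> X2" "y \<notin> X1" using sub S2G xy by auto
    ultimately have "(X1, X2) \<in> overlaps V ?S x y" using sub X1 X2 by (auto simp: overlaps_def)
    moreover have "S1 \<union> (X1 \<union> X2 - ?S) \<subseteq> G" using G(1) sub xy by auto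
    ultimately show "\<exists>i\<in>?P. G \<in> ?F i"
      using xy by (intro bexI[of _ "((x, y), (X1, X2))"]) auto
  qed
  also have "\<dots> \<le> (\<Sum>i\<in>?P. (B * p) ^ card S1 * B ^ (2 * e) * p ^ card (fst (snd i) \<union> snd (snd i) - ?S))"
  proof (rule sum_mono)
    fix i assume i: "i \<in> ?P"
    let ?X = "fst (snd i) \<union> snd (snd i)" and ?k = "card (fst (snd i) \<union> snd (snd i) - ?S)"
    have X: "fst (snd i) \<in> cps V" "snd (snd i) \<in> cps V" using i by (auto simp: overlaps_def)
    have f: "finite ?X" using X finite_cp(1) by (auto simp: cps_def)
    have "card ?X \<le> 2 * e"
      using card_Un_le[of "fst (snd i)" "snd (snd i)"] X finite_cp(3) by (simp add: cps_def)
    moreover have "?k \<le> card ?X" using f by (intro card_mono) auto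
    ultimately have k: "?k \<le> 2 * e" by linarith
    have c: "card (S1 \<union> (?X - ?S)) = card S1 + ?k" using finS f by (intro card_Un_disjoint) auto
    have "card S1 \<le> s" using S(4) finS card_mono[of ?S S1] by simp
    then have "Pr M (?F i) \<le> (B * p) ^ card (S1 \<union> (?X - ?S))"
      using c k S(1) X by (intro M_spread) (auto simp: cps_def)
    also have "\<dots> = (B * p) ^ card S1 * (B ^ ?k * p ^ ?k)"
      unfolding c by (simp add: power_add power_mult_distrib)
    also have "\<dots> \<le> (B * p) ^ card S1 * (B ^ (2 * e) * p ^ ?k)"
      using k B p_pos by (intro mult_left_mono mult_right_mono power_increasing) auto
    finally show "Pr M (?F i) \<le> (B * p) ^ card S1 * B ^ (2 * e) * p ^ ?k"
      by (simp add: mult.assoc)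
  qed
  also have "\<dots> = (B * p) ^ card S1 * B ^ (2 * e) *
      (\<Sum>xy\<in>S2 \<times> S2. \<Sum>X\<in>overlaps V ?S (fst xy) (snd xy). p ^ card (fst X \<union> snd X - ?S))"
    using finS finite_overlaps[OF V(1)]
    by (subst sum.Sigma) (auto simp: sum_distrib_left case_prod_beta)
  also have "\<dots> \<le> (B * p) ^ card S1 * B ^ (2 * e) * (\<Sum>xy\<in>S2 \<times> S2. ocst s * real n powr (- \<epsilon>))"
  proof (intro mult_left_mono sum_mono)
    fix xy assume "xy \<in> S2 \<times> S2"
    then show "(\<Sum>X\<in>overlaps V ?S (fst xy) (snd xy). p ^ card (fst X \<union> snd X - ?S)) \<le>
        ocst s * real n powr (- \<epsilon>)"
      using sum_overlaps[OF V(1,2) n_pos _ S(4), of "fst xy" "snd xy"] S by (auto simp: case_prod_beta)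
  qed (use B p_pos in auto)
  also have "(\<Sum>xy\<in>S2 \<times> S2. ocst s * real n powr (- \<epsilon>)) = real (card S2) * real (card S2) * (ocst s * real n powr (- \<epsilon>))"
    by (simp add: card_cartesian_product)
  also have "\<dots> \<le> (real s)\<^sup>2 * (ocst s * real n powr (- \<epsilon>))"
  proof (rule mult_right_mono)
    have "card S2 \<le> s" using S(4) finS card_mono[of ?S S2] by simp
    then show "real (card S2) * real (card S2) \<le> (real s)\<^sup>2" unfolding power2_eq_square by (intro mult_mono) auto
  qed (auto simp: ocst_def)
  finally show ?thesis using B p_pos by (simp add: mult_ac)
qed

abbreviation R where "R G \<equiv> rsub (pairs V) (rate V z \<delta> q G)"

abbreviation hit :: "nat set set \<Rightarrow> nat set set \<Rightarrow> nat set set \<Rightarrow> real" where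
  "hit G S1 S2 \<equiv> if S1 \<subseteq> G then Pr (R G) {T. S2 \<subseteq> added V z G T} else 0"

text \<open>The main term is what independence would give. Clashes lose a factor depending on
  \<delta>, \<open>z\<close> and \<open>s\<close> only, but gain n^(-\<epsilon>).\<close>

lemma joint:
  assumes S: "S1 \<subseteq> pairs V" "S2 \<subseteq> pairs V" "S1 \<inter> S2 = {}" "card (S1 \<union> S2) \<le> s"
    and ncp: "\<And>X. cp X \<Longrightarrow> X \<subseteq> S1 \<union> S2 \<Longrightarrow> card (X \<inter> S2) \<noteq> 1"
  shows "Exp M (\<lambda>G. hit G S1 S2) \<le>
    q ^ card S2 * (B * p) ^ card S1 * (1 + D)"
proof -
  let ?A = "{G. S1 \<subseteq> G}"
  let ?C = "{G. S1 \<subseteq> G \<and> S2 \<subseteq> openable V z G \<and> clash G S2}"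
  let ?d = "(1 / \<delta>) ^ (z * s)"
  have finS: "finite S1" "finite S2" using finite_subset[OF S(1) finP] finite_subset[OF S(2) finP] by auto
  have cS: "card S2 \<le> s" "card S1 \<le> s"
    using S(4) finS card_mono[of "S1 \<union> S2" S2] card_mono[of "S1 \<union> S2" S1] by simp_all
  have "Exp M (\<lambda>G. hit G S1 S2) \<le>
    Exp M (\<lambda>G. q ^ card S2 * indicator ?A G + q ^ card S2 * ?d * indicator ?C G)"
  proof (rule expectation_mono[OF finite_M])
    fix G assume G: "G \<in> set_pmf M"
    have "(1 / \<delta>) ^ (z * card S2) \<le> ?d"
      using cS \<delta> by (intro power_increasing) auto
    then have "q ^ card S2 * (1 + (1 / \<delta>) ^ (z * card S2)) \<le> q ^ card S2 * (1 + ?d)"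
      using q by (intro mult_left_mono) auto
    then show "hit G S1 S2 \<le>
        q ^ card S2 * indicator ?A G + q ^ card S2 * ?d * indicator ?C G"
      using prob_added_le[OF V(1) M_pairs[OF G] \<delta> q finS(2)]
      by (auto simp: indicator_def algebra_simps split: if_splits)
  qed
  also have "\<dots> = q ^ card S2 * Pr M ?A + q ^ card S2 * ?d * Pr M ?C"
    using finite_M by (subst Bochner_Integration.integral_add) (auto intro: integrable_measure_pmf_finite)
  also have "\<dots> \<le> q ^ card S2 * (B * p) ^ card S1 + q ^ card S2 * ?d *
      ((real s)\<^sup>2 * (B ^ (2 * e) * (ocst s * real n powr (- \<epsilon>))) * (B * p) ^ card S1)"
    using q \<delta> cS by (intro add_mono mult_left_mono M_spread S clash_prob ncp mult_nonneg_nonneg) auto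
  also have "\<dots> = q ^ card S2 * (B * p) ^ card S1 * (1 + D)"
    by (simp add: D_def algebra_simps)
  finally show ?thesis .
qed

definition M' :: "nat set set pmf" where
  "M' = bind_pmf M (\<lambda>G. map_pmf (improved V z G) (R G))"

lemma finite_R: "finite (set_pmf (R G))"
  by (rule finite_subset[OF set_rsub]) (simp add: finP)

lemma M'_free: "set_pmf M' \<subseteq> copy_free V"
  using M_free improved_copy_free by (auto simp: M'_def)

lemma prob_M': "Pr M' A =
    Exp M (\<lambda>G. Pr (R G) {T. improved V z G T \<in> A})"
  unfolding M'_def using finite_M finite_R
  by (subst prob_bind) (auto simp: vimage_def)

text \<open>An edge of the new graph is either old, with weight B p, or added, with weight
  \<open>q\<close>; summing over the possible sets of added edges yields a binomial expansion. Sets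
  that contain a copy are treated apart, since the assumption of \<open>joint\<close> may fail for
  them while their probability is 0.\<close>

lemma M'_spread:
  assumes S: "S \<subseteq> pairs V" "card S \<le> s"
  shows "Pr M' {G. S \<subseteq> G} \<le> (1 + D) * (q + B * p) ^ card S"
proof (cases "\<exists>X. cp X \<and> X \<subseteq> S")
  case True
  then have "S \<notin> copy_free V" "\<not> S \<subseteq> G" if "G \<in> copy_free V" for G
    using that by (auto simp: copy_free_def)
  then have "Pr M' {G. S \<subseteq> G} \<le> Pr M' {}"
    using M'_free by (intro prob_mono_set) auto
  moreover have "0 \<le> (1 + D) * (q + B * p) ^ card S"
    using B q p_pos \<delta> by (intro mult_nonneg_nonneg zero_le_power) (auto simp: D_def ocst_def)
  ultimately show ?thesis by simp
next
  case False
  have finS: "finite S" using S finP finite_subset by blast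
  have "Pr M' {G. S \<subseteq> G} \<le> Exp M (\<lambda>G. \<Sum>S2\<in>Pow S. hit G (S - S2) S2)"
    unfolding prob_M'
  proof (rule expectation_mono[OF finite_M])
    fix G
    let ?Q = "{S2\<in>Pow S. S - S2 \<subseteq> G}"
    have "Pr (R G) {T. improved V z G T \<in> {G. S \<subseteq> G}} \<le>
        (\<Sum>S2\<in>?Q. Pr (R G) {T. S2 \<subseteq> added V z G T})"
    proof (rule prob_Ball_le)
      fix T assume "T \<in> {T. improved V z G T \<in> {G. S \<subseteq> G}}"
      then have "S \<subseteq> G \<union> added V z G T" using improved_subset[of V z G T] by auto
      then show "\<exists>S2\<in>?Q. T \<in> {T. S2 \<subseteq> added V z G T}"
        by (intro bexI[of _ "S \<inter> added V z G T"]) auto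
    qed (use finS in auto)
    also have "\<dots> = (\<Sum>S2\<in>Pow S. hit G (S - S2) S2)"
      using finS by (intro sum.mono_neutral_cong_left) auto
    finally show "Pr (R G) {T. improved V z G T \<in> {G. S \<subseteq> G}} \<le> \<dots>" .
  qed
  also have "\<dots> = (\<Sum>S2\<in>Pow S. Exp M (\<lambda>G. hit G (S - S2) S2))"
    using finite_M by (intro Bochner_Integration.integral_sum integrable_measure_pmf_finite)
  also have "\<dots> \<le> (\<Sum>S2\<in>Pow S. q ^ card S2 * (B * p) ^ card (S - S2) * (1 + D))"
  proof (rule sum_mono)
    fix S2 assume S2: "S2 \<in> Pow S"
    then have "S - S2 \<union> S2 = S" by auto
    then show "Exp M (\<lambda>G. hit G (S - S2) S2) \<le> q ^ card S2 * (B * p) ^ card (S - S2) * (1 + D)"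
      using S2 S False by (intro joint) auto
  qed
  also have "\<dots> = (1 + D) * (\<Sum>S2\<in>Pow S. (\<Prod>x\<in>S2. q) * (\<Prod>x\<in>S - S2. B * p))"
    by (simp add: sum_distrib_left mult_ac)
  also have "(\<Sum>S2\<in>Pow S. (\<Prod>x\<in>S2. q) * (\<Prod>x\<in>S - S2. B * p)) = (q + B * p) ^ card S"
    using prod_add[OF finS, of "\<lambda>_. q" "\<lambda>_. B * p"] by simp
  finally show ?thesis .
qed

text \<open>Markov's inequality for the number of closers, whose expectation is bounded; the term B
  p accounts for pairs that already belong to the graph.\<close>

lemma openable_prob:
  assumes x: "x \<in> pairs V"
  shows "1 - B * p - cst * B ^ (e - 1) / real (z + 1) \<le> Pr M {G. x \<in> openable V z G}"
proof -
  let ?Q = "{X\<in>cps V. x \<in> X}"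
  let ?c = "\<lambda>G. \<Sum>X\<in>?Q. indicator {G. X - {x} \<subseteq> G} G :: real"
  have fQ: "finite ?Q" using finite_cps[OF V(1)] by auto
  have ec: "Exp M ?c \<le> cst * B ^ (e - 1)"
  proof -
    have "Exp M ?c = (\<Sum>X\<in>?Q. Pr M {G. X - {x} \<subseteq> G})"
      using finite_M by (subst Bochner_Integration.integral_sum) (auto intro: integrable_measure_pmf_finite)
    also have "\<dots> \<le> (\<Sum>X\<in>?Q. B ^ (e - 1) * p ^ (e - 1))"
    proof (rule sum_mono)
      fix X assume X: "X \<in> ?Q"
      then have c: "card (X - {x}) = e - 1" using finite_cp[of X] by (auto simp: cps_def)
      then have "Pr M {G. X - {x} \<subseteq> G} \<le> (B * p) ^ card (X - {x})"
        using X by (intro M_spread) (auto simp: cps_def)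
      then show "Pr M {G. X - {x} \<subseteq> G} \<le> B ^ (e - 1) * p ^ (e - 1)"
        using c by (simp add: power_mult_distrib)
    qed
    also have "\<dots> = B ^ (e - 1) * (\<Sum>X\<in>?Q. p ^ (e - 1))" by (simp add: sum_distrib_left)
    also have "\<dots> \<le> B ^ (e - 1) * cst"
      using sum_cps_through[OF V(1,2) n_pos x] B by (intro mult_left_mono) auto
    finally show ?thesis by (simp add: mult.commute)
  qed
  have "1 = Exp M (\<lambda>_. 1 :: real)" by simp
  also have "\<dots> \<le> Exp M (\<lambda>G. indicator {G. x \<in> openable V z G} G +
      (indicator {G. {x} \<subseteq> G} G + ?c G / real (z + 1)))"
  proof (rule expectation_mono[OF finite_M])
    fix G assume G: "G \<in> set_pmf M"
    have fG: "finite G" using M_pairs[OF G] finP finite_subset by blast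
    have c: "?c G = card {X\<in>?Q. X - {x} \<subseteq> G}"
      using fQ by (simp add: indicator_def sum.If_cases Int_def)
    show "1 \<le> indicator {G. x \<in> openable V z G} G + (indicator {G. {x} \<subseteq> G} G + ?c G / real (z + 1))"
    proof (cases "x \<in> G \<or> x \<in> openable V z G")
      case True
      then show ?thesis unfolding c by (auto simp: indicator_def)
    next
      case False
      then have "z + 1 \<le> card (closers G x)" using x by (auto simp: openable_def)
      also have "\<dots> \<le> card {X\<in>?Q. X - {x} \<subseteq> G}"
        using M_pairs[OF G] x
        by (intro card_mono finite_subset[OF _ fQ]) (auto simp: closers_def cps_def)
      finally have "real (z + 1) \<le> ?c G" unfolding c by (simp only: of_nat_le_iff)
      then have "1 \<le> ?c G / real (z + 1)" by simp
      then show ?thesis by (simp add: indicator_def)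
    qed
  qed
  also have "\<dots> = Pr M {G. x \<in> openable V z G} +
      (Pr M {G. {x} \<subseteq> G} + Exp M ?c / real (z + 1))"
    using finite_M by (simp add: Bochner_Integration.integral_add integrable_measure_pmf_finite)
  finally have "1 \<le> \<dots>" .
  moreover have "Pr M {G. {x} \<subseteq> G} \<le> B * p"
    using M_spread[of "{x}"] x s E2 by simp
  moreover have "Exp M ?c / real (z + 1) \<le> cst * B ^ (e - 1) / real (z + 1)"
    using ec by (intro divide_right_mono) auto
  ultimately show ?thesis by linarith
qed

text \<open>The three terms are the edges that survive deletion, the additions, and the additions
  discarded again. The middle one has no error term, because the rate gives each openable pair
  probability exactly \<open>q\<close>, whether or not transversals meet.\<close>

lemma M'_edges:
  "(1 - \<delta>) * Exp M (\<lambda>G. real (card G)) +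
   q * (\<Sum>x\<in>pairs V. Pr M {G. x \<in> openable V z G}) -
   real e * (\<Sum>(X, S)\<in>conflicts V. q ^ card S * (B * p) ^ card (X - S) * (1 + D))
   \<le> Exp M' (\<lambda>G. real (card G))"
proof -
  let ?i = "\<lambda>G X. hit G (fst X - snd X) (snd X)"
  have fA: "finite (conflicts V)" by (rule finite_conflicts[OF V(1)])
  have E1: "Exp M' (\<lambda>G. real (card G)) = Exp M
      (\<lambda>G. Exp (R G) (\<lambda>T. real (card (improved V z G T))))"
    unfolding M'_def using finite_M finite_R by (subst expectation_bind) auto
  have inner: "(1 - \<delta>) * real (card G) + q * (\<Sum>x\<in>pairs V. indicator {G. x \<in> openable V z G} G) -
      real e * (\<Sum>X\<in>conflicts V. ?i G X)
      \<le> Exp (R G) (\<lambda>T. real (card (improved V z G T)))" if G: "G \<in> set_pmf M" for G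
  proof -
    have GV: "G \<subseteq> pairs V" using M_pairs[OF G] .
    have fG: "finite G" using GV finP finite_subset by blast
    have GF: "G \<in> copy_free V" using G M_free by auto
    let ?g = "\<lambda>T. real (card G) - real (card (T \<inter> G)) + real (card (added V z G T \<inter> pairs V)) -
      real e * (\<Sum>X\<in>conflicts V. if fst X - snd X \<subseteq> G then indicator {T. snd X \<subseteq> added V z G T} T else (0 :: real))"
    have "Exp (R G) (\<lambda>T. real (card (T \<inter> G))) = (\<Sum>x\<in>G. \<delta>)"
    proof -
      have "Pr (R G) {T. x \<in> T} = \<delta>" if "x \<in> G" for x
        using prob_rsub[OF finP, of "{x}" "rate V z \<delta> q G"] rate_bounds[OF V(1) GV \<delta> q] GV that
        by (auto simp: rate_def)
      then show ?thesis using expectation_card[OF finite_R fG, of G "\<lambda>T. T"] by simp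
    qed
    then have e1: "Exp (R G) (\<lambda>T. real (card (T \<inter> G))) = \<delta> * card G" by simp
    have "Exp (R G) (\<lambda>T. real (card (added V z G T \<inter> pairs V))) =
        (\<Sum>x\<in>pairs V. Pr (R G) {T. x \<in> added V z G T})"
      by (rule expectation_card[OF finite_R finP])
    also have "\<dots> = (\<Sum>x\<in>pairs V. q * indicator {G. x \<in> openable V z G} G)"
    proof (rule sum.cong[OF refl])
      fix x assume "x \<in> pairs V"
      show "Pr (R G) {T. x \<in> added V z G T} = q * indicator {G. x \<in> openable V z G} G"
      proof (cases "x \<in> openable V z G")
        case True
        then show ?thesis using prob_added_single[OF V(1) GV \<delta> q True] by simp
      next
        case False
        then have "{T. x \<in> added V z G T} = {}" by (auto simp: added_def)
        then show ?thesis using False by simp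
      qed
    qed
    finally have e2: "Exp (R G) (\<lambda>T. real (card (added V z G T \<inter> pairs V))) =
        q * (\<Sum>x\<in>pairs V. indicator {G. x \<in> openable V z G} G)" by (simp add: sum_distrib_left)
    have e3: "Exp (R G) (\<lambda>T. \<Sum>X\<in>conflicts V.
        if fst X - snd X \<subseteq> G then indicator {T. snd X \<subseteq> added V z G T} T else (0 :: real)) = (\<Sum>X\<in>conflicts V. ?i G X)"
    proof -
      have "Exp (R G) (\<lambda>T. \<Sum>X\<in>conflicts V.
        if fst X - snd X \<subseteq> G then indicator {T. snd X \<subseteq> added V z G T} T else (0 :: real)) =
        (\<Sum>X\<in>conflicts V. Exp (R G) (\<lambda>T.
        if fst X - snd X \<subseteq> G then indicator {T. snd X \<subseteq> added V z G T} T else (0 :: real)))"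
        using finite_R by (intro Bochner_Integration.integral_sum integrable_measure_pmf_finite)
      also have "\<dots> = (\<Sum>X\<in>conflicts V. ?i G X)" by (intro sum.cong refl) simp
      finally show ?thesis .
    qed
    have "(1 - \<delta>) * real (card G) + q * (\<Sum>x\<in>pairs V. indicator {G. x \<in> openable V z G} G) -
      real e * (\<Sum>X\<in>conflicts V. ?i G X) = Exp (R G) ?g"
      using finite_R e1 e2 e3
      by (simp add: integrable_measure_pmf_finite algebra_simps)
    also have "\<dots> \<le> Exp (R G) (\<lambda>T. real (card (improved V z G T)))"
    proof (rule expectation_mono[OF finite_R])
      fix T
      have "added V z G T \<inter> pairs V = added V z G T" by (auto simp: added_def openable_def)
      moreover have "(\<Sum>X\<in>conflicts V. if fst X - snd X \<subseteq> G then indicator {T. snd X \<subseteq> added V z G T} T else (0 :: real)) =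
        (\<Sum>(X, S)\<in>conflicts V. if X - S \<subseteq> G \<and> S \<subseteq> added V z G T then 1 else (0::real))"
        by (intro sum.cong refl) (simp add: indicator_def split: prod.split)
      ultimately show "?g T \<le> real (card (improved V z G T))"
        using card_improved_ge[OF V(1) GF, of T z] by simp
    qed
    finally show ?thesis .
  qed
  have conf: "(\<Sum>X\<in>conflicts V. Exp M (\<lambda>G. ?i G X)) \<le>
      (\<Sum>(X, S)\<in>conflicts V. q ^ card S * (B * p) ^ card (X - S) * (1 + D))"
  proof (rule sum_mono, clarify)
    fix X S assume XS: "(X, S) \<in> conflicts V"
    then have X: "cp X" "X \<subseteq> pairs V" "S \<subseteq> X" "2 \<le> card S" by (auto simp: conflicts_def cps_def)
    have eq: "X - S \<union> S = X" using X by auto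
    \<comment> \<open>A copy inside \<open>X\<close> is \<open>X\<close> itself, having equally many
      edges, and so contains all of \<open>S\<close>; this is the condition of
      \<open>joint\<close>.\<close>
    have "card (Y \<inter> S) \<noteq> 1" if Y: "cp Y" "Y \<subseteq> X - S \<union> S" for Y
    proof -
      have "Y = X" using Y X finite_cp[OF X(1)] finite_cp[OF Y(1)] by (intro card_subset_eq) auto
      then show ?thesis using X by (simp add: Int_absorb1)
    qed
    then have "Exp M (\<lambda>G. ?i G (X, S)) \<le> q ^ card S * (B * p) ^ card (X - S) * (1 + D)"
      using X eq s finite_cp(3)[OF X(1)] unfolding fst_conv snd_conv by (intro joint) auto
    then show "Exp M (\<lambda>G. ?i G (X, S)) \<le> q ^ card S * (B * p) ^ card (X - S) * (1 + D)" .
  qed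
  have "(1 - \<delta>) * Exp M (\<lambda>G. real (card G)) +
      q * (\<Sum>x\<in>pairs V. Pr M {G. x \<in> openable V z G}) -
      real e * (\<Sum>X\<in>conflicts V. Exp M (\<lambda>G. ?i G X)) =
    Exp M (\<lambda>G. (1 - \<delta>) * real (card G) +
      q * (\<Sum>x\<in>pairs V. indicator {G. x \<in> openable V z G} G) - real e * (\<Sum>X\<in>conflicts V. ?i G X))"
    using finite_M
    by (simp add: integrable_measure_pmf_finite Bochner_Integration.integral_sum)
  also have "\<dots> \<le> Exp M' (\<lambda>G. real (card G))"
    unfolding E1 by (rule expectation_mono[OF finite_M]) (rule inner)
  finally show ?thesis using mult_left_mono[OF conf, of "real e"] by simp
qed

end

section \<open>Iterating the rounds\<close>

lemma eventually_powr_le: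
  assumes "a > 0" "c > 0"
  shows "\<forall>\<^sub>F n in sequentially. b * real n powr (- a) \<le> c"
proof -
  have "((\<lambda>n. real n powr (- a)) \<longlongrightarrow> 0) sequentially"
    using assms by (intro tendsto_neg_powr filterlim_real_sequentially) auto
  then have "((\<lambda>n. b * real n powr (- a)) \<longlongrightarrow> b * 0) sequentially"
    by (intro tendsto_mult tendsto_const)
  then have "\<forall>\<^sub>F n in sequentially. b * real n powr (- a) < c"
    using assms by (intro order_tendstoD(2)) auto
  then show ?thesis by eventually_elim simp
qed

context strictly_balanced
begin

abbreviation spread_random :: "nat \<Rightarrow> nat \<Rightarrow> real \<Rightarrow> real \<Rightarrow> nat set set pmf \<Rightarrow> bool" where
  "spread_random n s B K M \<equiv> set_pmf M \<subseteq> copy_free {1..n} \<and>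
     (\<forall>S\<subseteq>pairs {1..n}. card S \<le> s \<longrightarrow> Pr M {G. S \<subseteq> G} \<le> (B * real n powr (- \<theta>)) ^ card S) \<and>
     K * real n powr (2 - \<theta>) \<le> Exp M (\<lambda>G. real (card G))"

definition achievable :: "real \<Rightarrow> real \<Rightarrow> bool" where
  "achievable B K \<longleftrightarrow> (\<forall>s. \<forall>\<^sub>F n in sequentially. \<exists>M. spread_random n s B K M)"

lemma achievable_0: "achievable 1 0"
  unfolding achievable_def
proof (intro allI always_eventually)
  fix s n :: nat
  let ?M = "return_pmf {} :: nat set set pmf"
  have "\<not> cp {}" using finite_cp(3)[of "{}"] E2 by auto
  then have "set_pmf ?M \<subseteq> copy_free {1..n}" by (auto simp: copy_free_def)
  moreover have "Pr ?M {G. S \<subseteq> G} \<le> (1 * real n powr (- \<theta>)) ^ card S" for S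
    by (cases "S = {}") (auto simp: indicator_def)
  ultimately show "\<exists>M. spread_random n s 1 0 M"
    by (intro exI[of _ ?M]) auto
qed

text \<open>Additions gain an amount of order \<kappa> and conflicts cost order \<kappa>^2, so a
  small \<kappa> depending only on the cap \<open>Bm\<close> wins. Deletions cost order \<delta>,
  and \<delta> may be tiny without harming the gain: it only enters the condition q (1 / \<delta>)^z
  \<le> 1 and the error term, and both are settled by taking n large.\<close>

lemma achievable_step:
  assumes Bm: "1 \<le> Bm"
  shows "\<exists>\<kappa>>0. \<kappa> \<le> 1 \<and> (\<forall>B K. 1 \<le> B \<longrightarrow> B \<le> Bm \<longrightarrow> achievable B K \<longrightarrow>
    achievable (B + 2 * \<kappa>) (K + \<kappa> / 16))"
proof -
  have c0: "cst > 0" by simp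
  \<comment> \<open>Conflicts will cost at most L \<kappa>^2 n^(2 - \<theta>).\<close>
  define L where "L = real e * 2 ^ (e + 1) * Bm ^ e * cst"
  have L: "L > 0" using c0 Bm E2 by (auto simp: L_def)
  define \<kappa> where "\<kappa> = min 1 (1 / (64 * L))"
  have \<kappa>: "0 < \<kappa>" "\<kappa> \<le> 1" using L by (auto simp: \<kappa>_def)
  have "\<kappa> * L \<le> 1 / (64 * L) * L" using L by (intro mult_right_mono) (auto simp: \<kappa>_def)
  then have \<kappa>L: "\<kappa> * L \<le> 1 / 64" using L by simp
  \<comment> \<open>The expected edge number never exceeds Bm n^(2 - \<theta>), so deletions cost at
    most a share \<kappa> / 64 of n^(2 - \<theta>).\<close>
  define \<delta> where "\<delta> = \<kappa> / (64 * Bm)"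
  have \<delta>: "0 < \<delta>" "\<delta> \<le> 1" using \<kappa> Bm by (auto simp: \<delta>_def field_simps)
  \<comment> \<open>Together with B p \<le> 1 / 4 this makes every pair openable with probability at
    least 1 / 2.\<close>
  define z where "z = nat \<lceil>4 * cst * Bm ^ e\<rceil>"
  have z: "cst * B ^ (e - 1) / real (z + 1) \<le> 1 / 4" if B: "1 \<le> B" "B \<le> Bm" for B
  proof -
    have "B ^ (e - 1) \<le> Bm ^ (e - 1)" using B by (intro power_mono) auto
    also have "\<dots> \<le> Bm ^ e" using Bm by (intro power_increasing) auto
    finally have "4 * cst * B ^ (e - 1) \<le> 4 * cst * Bm ^ e" by (intro mult_left_mono) auto
    also have "\<dots> \<le> real (z + 1)" unfolding z_def by linarith
    finally show ?thesis by (simp add: field_simps)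
  qed
  have "achievable (B + 2 * \<kappa>) (K + \<kappa> / 16)"
    if B1: "1 \<le> B" "B \<le> Bm" and ach: "achievable B K" for B K
    unfolding achievable_def
  proof
    fix s0 :: nat
    define s where "s = max s0 e"
    define D0 where "D0 = (1 / \<delta>) ^ (z * s) * ((real s)\<^sup>2 * (B ^ (2 * e) * ocst s))"
    \<comment> \<open>Without errors \<open>B\<close> would become B + \<kappa>. The second \<kappa>
      absorbs the factor 1 + D, which is at most (B + 2 \<kappa>) / (B + \<kappa>).\<close>
    define \<xi> where "\<xi> = min 1 (\<kappa> / (B + \<kappa>))"
    have \<xi>: "\<xi> > 0" using \<kappa> B1 by (auto simp: \<xi>_def)
    have "\<forall>\<^sub>F n in sequentially. \<exists>M. spread_random n (s + 2 * e) B K M"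
      using ach unfolding achievable_def by blast
    moreover have "\<forall>\<^sub>F n in sequentially. (\<kappa> * (1 / \<delta>) ^ z) * real n powr (- \<theta>) \<le> 1"
      using \<theta> by (intro eventually_powr_le) auto
    moreover have "\<forall>\<^sub>F n in sequentially. B * real n powr (- \<theta>) \<le> 1 / 4"
      using \<theta> by (intro eventually_powr_le) auto
    moreover have "\<forall>\<^sub>F n in sequentially. D0 * real n powr (- \<epsilon>) \<le> \<xi>"
      using \<epsilon> \<xi> by (intro eventually_powr_le) auto
    moreover have "\<forall>\<^sub>F n in sequentially. 2 \<le> n" by (rule eventually_ge_at_top)
    ultimately show "\<forall>\<^sub>F n in sequentially. \<exists>M. spread_random n s0 (B + 2 * \<kappa>) (K + \<kappa> / 16) M"
    proof eventually_elim
      case (elim n)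
      then obtain M where M: "set_pmf M \<subseteq> copy_free {1..n}"
        "\<And>S. S\<subseteq>pairs {1..n} \<Longrightarrow> card S \<le> s + 2 * e \<Longrightarrow>
          Pr M {G. S \<subseteq> G} \<le> (B * real n powr (- \<theta>)) ^ card S"
        "K * real n powr (2 - \<theta>) \<le> Exp M (\<lambda>G. real (card G))" by blast
      let ?p = "real n powr (- \<theta>)" and ?V = "{1..n}" and ?N = "real n powr (2 - \<theta>)"
      interpret nibble E \<theta> \<epsilon> ?V n z s \<delta> "\<kappa> * ?p" B M
      proof unfold_locales
        show "\<kappa> * ?p * (1 / \<delta>) ^ z \<le> 1" using elim by (simp only: mult_ac)
        show "Pr M {G. S \<subseteq> G} \<le> (B * ?p) ^ card S"
          if "S \<subseteq> pairs {1..n}" "card S \<le> s + 2 * e" for S by (rule M(2)[OF that])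
        show "set_pmf M \<subseteq> copy_free {1..n}" by (fact M(1))
        show "2 \<le> n" by (fact elim)
        show "0 \<le> \<kappa> * ?p" using \<kappa> by simp
        show "finite {1..n}" by (rule finite_atLeastAtMost)
        show "card {1..n} = n" by simp
        show "1 \<le> B" by (rule B1(1))
        show "0 < \<delta>" "\<delta> \<le> 1" by (rule \<delta>)+
        show "e \<le> s" unfolding s_def by (rule max.cobounded2)
      qed
      have pn2: "?p * real n ^ 2 = ?N"
      proof -
        have "?N = real n powr (- \<theta> + 2)" by (rule arg_cong[where f = "\<lambda>y. real n powr y"]) simp
        also have "\<dots> = ?p * real n powr 2" by (rule powr_add)
        finally show ?thesis using n_pos by simp
      qed
      have "D = D0 * real n powr (- \<epsilon>)" by (simp add: D_def D0_def)
      then have D: "D \<le> \<xi>" using elim by simp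
      have D_nonneg: "0 \<le> D" using \<delta> B1 by (auto simp: D_def ocst_def)
      have N_pos: "0 < ?N" using n_pos by simp
      have spread: "Pr M' {G. S \<subseteq> G} \<le> ((B + 2 * \<kappa>) * ?p) ^ card S"
        if S: "S \<subseteq> pairs ?V" "card S \<le> s0" for S
      proof (cases "card S = 0")
        case False
        have "1 + D \<le> (B + 2 * \<kappa>) / (B + \<kappa>)"
          using D B1 \<kappa> by (simp add: \<xi>_def field_simps)
        moreover have "1 + D \<le> (1 + D) ^ card S"
          using D_nonneg False self_le_power[of "1 + D" "card S"] by simp
        ultimately have "1 + D \<le> ((B + 2 * \<kappa>) / (B + \<kappa>)) ^ card S"
          using D_nonneg power_mono[of "1 + D" "(B + 2 * \<kappa>) / (B + \<kappa>)" "card S"] by linarith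
        then have "(1 + D) * (\<kappa> * ?p + B * ?p) ^ card S \<le>
            ((B + 2 * \<kappa>) / (B + \<kappa>)) ^ card S * (\<kappa> * ?p + B * ?p) ^ card S"
          using B1 \<kappa> by (intro mult_right_mono) auto
        also have "\<dots> = ((B + 2 * \<kappa>) / (B + \<kappa>) * ((B + \<kappa>) * ?p)) ^ card S"
          by (simp add: power_mult_distrib[symmetric] algebra_simps)
        also have "(B + 2 * \<kappa>) / (B + \<kappa>) * ((B + \<kappa>) * ?p) = (B + 2 * \<kappa>) * ?p"
          using B1 \<kappa> by simp
        finally show ?thesis
          using M'_spread[OF S(1)] S(2) by (force simp: s_def)
      qed simp
      have cP: "real n ^ 2 / 4 \<le> card (pairs ?V)" "card (pairs ?V) \<le> real n ^ 2"
      proof -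
        have eq: "real (card (pairs ?V)) = real n * (real n - 1) / 2"
          using V by (simp add: card_pairs choose_two real_of_nat_div of_nat_diff)
        have "real n * 2 \<le> real n * real n" using V by (intro mult_left_mono) auto
        then show "real n ^ 2 / 4 \<le> card (pairs ?V)" "card (pairs ?V) \<le> real n ^ 2"
          unfolding eq by (auto simp: power2_eq_square algebra_simps)
      qed
      have loss: "\<delta> * Exp M (\<lambda>G. real (card G)) \<le> \<kappa> / 64 * ?N"
      proof -
        have "Exp M (\<lambda>G. real (card G)) \<le>
            Exp M (\<lambda>G. real (card (G \<inter> pairs ?V)))"
          using M_pairs by (intro expectation_mono[OF finite_M]) (simp add: Int_absorb2)
        also have "\<dots> = (\<Sum>x\<in>pairs ?V. Pr M {G. x \<in> G})"
          by (rule expectation_card[OF finite_M finP])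
        also have "\<dots> \<le> (\<Sum>x\<in>pairs ?V. B * ?p)"
        proof (rule sum_mono)
          fix x assume "x \<in> pairs ?V"
          then show "Pr M {G. x \<in> G} \<le> B * ?p"
            using M_spread[of "{x}"] s E2 by simp
        qed
        also have "\<dots> = card (pairs ?V) * (B * ?p)" by simp
        also have "\<dots> \<le> real n ^ 2 * (Bm * ?p)" using cP B1 by (intro mult_mono) auto
        also have "\<dots> = Bm * ?N" using pn2 by (simp add: mult_ac)
        finally have "\<delta> * Exp M (\<lambda>G. real (card G)) \<le> \<delta> * (Bm * ?N)"
          using \<delta> by (intro mult_left_mono) auto
        also have "\<dots> = \<kappa> / 64 * ?N" using Bm by (simp add: \<delta>_def)
        finally show ?thesis .
      qed
      have gain: "\<kappa> / 8 * ?N \<le> \<kappa> * ?p * (\<Sum>x\<in>pairs ?V. Pr M {G. x \<in> openable ?V z G})"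
      proof -
        have "real n ^ 2 / 8 \<le> (\<Sum>x\<in>pairs ?V. 1 / 2)" using cP by simp
        also have "\<dots> \<le> (\<Sum>x\<in>pairs ?V. Pr M {G. x \<in> openable ?V z G})"
        proof (rule sum_mono)
          fix x assume "x \<in> pairs ?V"
          from openable_prob[OF this] show "1 / 2 \<le> Pr M {G. x \<in> openable ?V z G}"
            using z[OF B1] elim by linarith
        qed
        finally have "\<kappa> * ?p * (real n ^ 2 / 8) \<le>
            \<kappa> * ?p * (\<Sum>x\<in>pairs ?V. Pr M {G. x \<in> openable ?V z G})"
          using \<kappa> by (intro mult_left_mono) auto
        then show ?thesis using pn2 by (simp add: mult_ac)
      qed
      have conf: "real e * (\<Sum>(X, S)\<in>conflicts ?V. (\<kappa> * ?p) ^ card S * (B * ?p) ^ card (X - S) * (1 + D)) \<le>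
          \<kappa> / 64 * ?N"
      proof -
        have "(\<Sum>(X, S)\<in>conflicts ?V. (\<kappa> * ?p) ^ card S * (B * ?p) ^ card (X - S) * (1 + D)) \<le>
            (\<Sum>(X, S)\<in>conflicts ?V. \<kappa>\<^sup>2 * Bm ^ e * ?p ^ e * 2)"
        proof (rule sum_mono, clarify)
          fix X S assume XS: "(X, S) \<in> conflicts ?V"
          then have X: "cp X" "S \<subseteq> X" "2 \<le> card S" by (auto simp: conflicts_def cps_def)
          have fX: "finite X" "card X = e" using finite_cp[OF X(1)] by auto
          then have ce: "card S + card (X - S) = e"
            using X card_mono[OF fX(1) X(2)] by (simp add: card_Diff_subset finite_subset)
          have "(\<kappa> * ?p) ^ card S * (B * ?p) ^ card (X - S) = \<kappa> ^ card S * B ^ card (X - S) * ?p ^ e"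
            unfolding ce[symmetric] by (simp add: power_mult_distrib power_add)
          also have "\<dots> \<le> \<kappa>\<^sup>2 * Bm ^ e * ?p ^ e"
          proof (intro mult_right_mono mult_mono)
            show "\<kappa> ^ card S \<le> \<kappa>\<^sup>2" using \<kappa> X by (intro power_decreasing) auto
            have "B ^ card (X - S) \<le> Bm ^ card (X - S)" using B1 by (intro power_mono) auto
            also have "\<dots> \<le> Bm ^ e" using Bm ce by (intro power_increasing) auto
            finally show "B ^ card (X - S) \<le> Bm ^ e" .
          qed (use B1 in auto)
          finally have "(\<kappa> * ?p) ^ card S * (B * ?p) ^ card (X - S) \<le> \<kappa>\<^sup>2 * Bm ^ e * ?p ^ e" .
          moreover have "1 + D \<le> 2" using D by (simp add: \<xi>_def)
          ultimately show "(\<kappa> * ?p) ^ card S * (B * ?p) ^ card (X - S) * (1 + D) \<le> \<kappa>\<^sup>2 * Bm ^ e * ?p ^ e * 2"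
            by (rule mult_mono) (use D_nonneg Bm in auto)
        qed
        also have "\<dots> = (\<Sum>X\<in>cps ?V. \<Sum>S\<in>{S. S \<subseteq> X \<and> 2 \<le> card S}. \<kappa>\<^sup>2 * Bm ^ e * ?p ^ e * 2)"
          unfolding conflicts_def using finite_cps[OF V(1)]
          by (subst sum.Sigma) (auto simp: cps_def dest: finite_cp(1))
        also have "\<dots> \<le> (\<Sum>X\<in>cps ?V. 2 ^ e * (\<kappa>\<^sup>2 * Bm ^ e * ?p ^ e * 2))"
        proof (rule sum_mono)
          fix X assume "X \<in> cps ?V"
          then have fX: "finite X" "card X = e" using finite_cp by (auto simp: cps_def)
          have "card {S. S \<subseteq> X \<and> 2 \<le> card S} \<le> card (Pow X)" using fX by (intro card_mono) auto
          then have "card {S. S \<subseteq> X \<and> 2 \<le> card S} \<le> 2 ^ e" using fX by (simp add: card_Pow)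
          then have "real (card {S. S \<subseteq> X \<and> 2 \<le> card S}) \<le> real (2 ^ e)" by (simp only: of_nat_le_iff)
          then have "real (card {S. S \<subseteq> X \<and> 2 \<le> card S}) * (\<kappa>\<^sup>2 * Bm ^ e * ?p ^ e * 2) \<le>
              2 ^ e * (\<kappa>\<^sup>2 * Bm ^ e * ?p ^ e * 2)"
            using Bm by (intro mult_right_mono) auto
          then show "(\<Sum>S\<in>{S. S \<subseteq> X \<and> 2 \<le> card S}. \<kappa>\<^sup>2 * Bm ^ e * ?p ^ e * 2) \<le>
              2 ^ e * (\<kappa>\<^sup>2 * Bm ^ e * ?p ^ e * 2)" by simp
        qed
        also have "\<dots> = 2 ^ (e + 1) * \<kappa>\<^sup>2 * Bm ^ e * (\<Sum>X\<in>cps ?V. ?p ^ e)"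
          by (simp add: sum_distrib_left mult_ac)
        also have "\<dots> \<le> 2 ^ (e + 1) * \<kappa>\<^sup>2 * Bm ^ e * (cst * ?N)"
          using sum_cps[OF V(1,2) n_pos] Bm by (intro mult_left_mono) auto
        finally have "real e * (\<Sum>(X, S)\<in>conflicts ?V. (\<kappa> * ?p) ^ card S * (B * ?p) ^ card (X - S) * (1 + D)) \<le>
            real e * (2 ^ (e + 1) * \<kappa>\<^sup>2 * Bm ^ e * (cst * ?N))"
          by (intro mult_left_mono) auto
        also have "\<dots> = \<kappa> * (\<kappa> * L) * ?N" by (simp add: L_def power2_eq_square mult_ac)
        also have "\<dots> \<le> \<kappa> * (1 / 64) * ?N"
          using \<kappa>L \<kappa> N_pos by (intro mult_right_mono mult_left_mono) auto
        finally show ?thesis by simp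
      qed
      \<comment> \<open>The balance of gain, deletions and conflicts is 1/8 - 1/64 - 1/64 \<ge>
        1/16.\<close>
      have "(K + \<kappa> / 16) * ?N \<le> Exp M' (\<lambda>G. real (card G))"
      proof -
        have "0 \<le> \<kappa> * ?N" using \<kappa> N_pos by simp
        moreover have "(1 - \<delta>) * Exp M (\<lambda>G. real (card G)) =
            Exp M (\<lambda>G. real (card G)) - \<delta> * Exp M (\<lambda>G. real (card G))"
          by (simp add: algebra_simps)
        moreover have "(K + \<kappa> / 16) * ?N = K * ?N + (\<kappa> * ?N) / 16" by (simp add: algebra_simps)
        moreover have "\<kappa> / 8 * ?N = (\<kappa> * ?N) / 8" "\<kappa> / 64 * ?N = (\<kappa> * ?N) / 64" by simp_all
        ultimately show ?thesis using M'_edges gain loss conf M(3) by linarith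
      qed
      then show ?case using M'_free spread by (intro exI[of _ M'] conjI) auto
    qed
  qed
  then show ?thesis using \<kappa> by blast
qed

lemma achievable_unbounded:
  assumes "K \<ge> 0"
  shows "\<exists>B K'. K \<le> K' \<and> achievable B K'"
proof -
  \<comment> \<open>Reaching \<open>K\<close> takes about 16 K / \<kappa> rounds, during which
    \<open>B\<close> grows by about 32 K whatever \<kappa> is; so the cap can be fixed before
    \<kappa>.\<close>
  define Bm where "Bm = 32 * K + 3"
  have "1 \<le> Bm" using assms by (simp add: Bm_def)
  then obtain \<kappa> where \<kappa>: "\<kappa> > 0" "\<kappa> \<le> 1" and
    step: "\<And>B K. 1 \<le> B \<Longrightarrow> B \<le> Bm \<Longrightarrow> achievable B K \<Longrightarrow> achievable (B + 2 * \<kappa>) (K + \<kappa> / 16)"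
    using achievable_step[of Bm] by blast
  have *: "real i \<le> 16 * K / \<kappa> + 1 \<Longrightarrow> achievable (1 + 2 * \<kappa> * real i) (\<kappa> * real i / 16)" for i :: nat
  proof (induction i)
    case (Suc i)
    then have "real i * \<kappa> \<le> (16 * K / \<kappa>) * \<kappa>" using \<kappa> by (intro mult_right_mono) auto
    then have "real i * \<kappa> \<le> 16 * K" using \<kappa> by simp
    then have "1 + 2 * \<kappa> * real i \<le> Bm" unfolding Bm_def by (simp add: mult_ac)
    then have "achievable (1 + 2 * \<kappa> * real i + 2 * \<kappa>) (\<kappa> * real i / 16 + \<kappa> / 16)"
      using Suc \<kappa> by (intro step) auto
    then show ?case by (simp add: algebra_simps add_divide_distrib)
  qed (simp add: achievable_0)
  define i where "i = nat \<lceil>16 * K / \<kappa>\<rceil>"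
  have "0 \<le> 16 * K / \<kappa>" using assms \<kappa> by simp
  then have i: "16 * K / \<kappa> \<le> real i" "real i \<le> 16 * K / \<kappa> + 1" unfolding i_def by linarith+
  have "K \<le> \<kappa> * real i / 16" using i(1) \<kappa> by (simp add: field_simps)
  then show ?thesis using *[OF i(2)] by blast
qed

lemma dense_copy_free:
  assumes "K \<ge> 0"
  shows "\<exists>n>0. \<exists>G\<in>copy_free {1..n}. K * real n powr (2 - \<theta>) \<le> real (card G)"
proof -
  obtain B K' where K': "K \<le> K'" "achievable B K'" using achievable_unbounded[OF assms] by blast
  then have "\<forall>\<^sub>F n in sequentially. \<exists>M. set_pmf M \<subseteq> copy_free {1..n} \<and>
     K' * real n powr (2 - \<theta>) \<le> Exp M (\<lambda>G. real (card G))"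
    unfolding achievable_def by (blast intro: eventually_mono)
  moreover have "\<forall>\<^sub>F n in sequentially. 1 \<le> (n :: nat)" by (rule eventually_ge_at_top)
  ultimately have "\<forall>\<^sub>F n in sequentially. 1 \<le> n \<and> (\<exists>M. set_pmf M \<subseteq> copy_free {1..n} \<and>
     K' * real n powr (2 - \<theta>) \<le> Exp M (\<lambda>G. real (card G)))"
    by eventually_elim simp
  then obtain n M where n: "1 \<le> n" and M: "set_pmf M \<subseteq> copy_free {1..n}"
    "K' * real n powr (2 - \<theta>) \<le> Exp M (\<lambda>G. real (card G))"
    by (auto dest!: eventually_happens)
  have fM: "finite (set_pmf M)" using M(1) finite_copy_free[of "{1..n}"] finite_subset by blast
  let ?m = "Max (card ` set_pmf M)"
  have "?m \<in> card ` set_pmf M" using fM set_pmf_not_empty by (intro Max_in) auto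
  then obtain G where G: "G \<in> set_pmf M" "card G = ?m" by force
  have "Exp M (\<lambda>G. real (card G)) \<le> Exp M (\<lambda>_. real ?m)"
    using fM by (intro expectation_mono) auto
  then have "K' * real n powr (2 - \<theta>) \<le> real (card G)" using M(2) G(2) by simp
  moreover have "K * real n powr (2 - \<theta>) \<le> K' * real n powr (2 - \<theta>)"
    using K' by (intro mult_right_mono) auto
  ultimately have "K * real n powr (2 - \<theta>) \<le> real (card G)" by (rule order_trans[rotated])
  moreover have "n > 0" "G \<in> copy_free {1..n}" using n M(1) G(1) by auto
  ultimately show ?thesis by blast
qed

end

section \<open>Passing to a strictly balanced subgraph\<close>

lemma copy_of_mono:
  assumes "copy_of E X" "F \<subseteq> E"
  shows "\<exists>Y\<subseteq>X. copy_of F Y"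
proof -
  obtain f where f: "inj_on f (\<Union>E)" "X = (`) f ` E" using assms by (auto simp: copy_of_def)
  have "inj_on f (\<Union>F)" using f(1) assms(2) by (meson Union_mono inj_on_subset)
  then show ?thesis using f(2) assms(2) by (intro exI[of _ "(`) f ` F"]) (auto simp: copy_of_def)
qed

lemma card_Union_two_edges:
  assumes "finite (\<Union>J)" "2 \<le> card J" "\<And>x. x \<in> J \<Longrightarrow> card x = 2"
  shows "3 \<le> card (\<Union>J)"
proof (rule ccontr)
  assume small: "\<not> ?thesis"
  have "x = \<Union>J" if x: "x \<in> J" for x
    using assms(1) assms(3)[OF x] x small by (intro card_seteq) auto
  then have "J \<subseteq> {\<Union>J}" by auto
  then have "card J \<le> 1" using card_mono[of "{\<Union>J}" J] by simp
  then show False using assms(2) by simp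
qed

text \<open>The deletion method only gives \<open>n powr (2 - \<beta>)\<close> edges up to a constant factor; the nibble
  yields every constant factor.\<close>

theorem superdeletion_bound:
  fixes E :: "'a set set" and \<beta> K :: real
  assumes E: "finite E" "\<And>x. x \<in> E \<Longrightarrow> card x = 2"
    and Z: "Z \<subseteq> E" "2 \<le> card Z" "real (card (\<Union>Z)) - 2 < real (card Z) - 1"
    and J0: "J0 \<subseteq> E" "2 \<le> card J0" "real (card (\<Union>J0)) - 2 \<le> \<beta> * (real (card J0) - 1)"
    and K: "K \<ge> 0"
  shows "\<exists>n>0. \<exists>G\<subseteq>pairs {1..n}. \<not> (\<exists>X\<subseteq>G. copy_of E X) \<and> K * real n powr (2 - \<beta>) \<le> real (card G)"
proof -
  define \<J> where "\<J> = {J. J \<subseteq> E \<and> 2 \<le> card J}"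
  define \<rho> where "\<rho> J = (real (card (\<Union>J)) - 2) / (real (card J) - 1)" for J :: "'a set set"
  have f\<J>: "finite \<J>" by (rule finite_subset[of _ "Pow E"]) (use E in \<open>auto simp: \<J>_def\<close>)
  have in\<J>: "Z \<in> \<J>" "J0 \<in> \<J>" using Z J0 by (auto simp: \<J>_def)
  \<comment> \<open>A subgraph \<open>F\<close> attaining the minimum gives the best exponent, since
    graphs without \<open>F\<close> have no copy of \<open>E\<close>. Choosing \<open>F\<close> with
    fewest edges makes it strictly balanced: its smaller parts have a strictly larger
    \<open>\<rho>\<close>.\<close>
  define \<theta> where "\<theta> = Min (\<rho> ` \<J>)"
  have \<theta>_le: "\<theta> \<le> \<rho> J" if "J \<in> \<J>" for J using that f\<J> by (auto simp: \<theta>_def)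
  have "\<theta> \<in> \<rho> ` \<J>" unfolding \<theta>_def using f\<J> in\<J> by (intro Min_in) auto
  then have "\<exists>F. F \<in> \<J> \<and> \<rho> F = \<theta>" by auto
  then obtain F where F: "F \<in> \<J>" "\<rho> F = \<theta>"
    and F_min: "\<And>J. J \<in> \<J> \<Longrightarrow> \<rho> J = \<theta> \<Longrightarrow> card F \<le> card J"
    using ex_has_least_nat[of "\<lambda>F. F \<in> \<J> \<and> \<rho> F = \<theta>" _ card] by blast
  have FE: "F \<subseteq> E" "2 \<le> card F" using F by (auto simp: \<J>_def)
  have finF: "finite F" using FE E finite_subset by blast
  have "finite x" if "x \<in> E" for x using E(2)[OF that] card_ge_0_finite by force
  then have fUE: "finite (\<Union>E)" using E(1) by auto
  have "3 \<le> card (\<Union>F)"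
  proof (rule card_Union_two_edges[OF _ FE(2)])
    show "finite (\<Union>F)" using FE fUE by (meson Union_mono finite_subset)
  qed (use FE E in auto)
  then have \<theta>0: "0 < \<theta>" unfolding F(2)[symmetric] \<rho>_def using FE by (intro divide_pos_pos) auto
  \<comment> \<open>A cycle supplies such a \<open>Z\<close>; in a forest every value of
    \<open>\<rho>\<close> is at least 1.\<close>
  have "\<rho> Z < 1" unfolding \<rho>_def using Z by (simp add: field_simps)
  then have \<theta>1: "\<theta> < 1" using \<theta>_le[OF in\<J>(1)] by simp
  have "\<rho> J0 \<le> \<beta>" unfolding \<rho>_def using J0 by (simp add: field_simps)
  then have \<theta>\<beta>: "\<theta> \<le> \<beta>" using \<theta>_le[OF in\<J>(2)] by simp
  define gap where "gap J = real (card (\<Union>J)) - 2 - \<theta> * (real (card J) - 1)" for J :: "'a set set"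
  define \<P> where "\<P> = {J. J \<subseteq> F \<and> 2 \<le> card J \<and> J \<noteq> F}"
  have f\<P>: "finite \<P>" by (rule finite_subset[of _ "Pow F"]) (use finF in \<open>auto simp: \<P>_def\<close>)
  have gap_pos: "0 < gap J" if J: "J \<in> \<P>" for J
  proof -
    have J\<J>: "J \<in> \<J>" using J FE by (auto simp: \<P>_def \<J>_def)
    have "card J < card F" using J finF by (intro psubset_card_mono) (auto simp: \<P>_def)
    then have "\<rho> J \<noteq> \<theta>" using F_min[OF J\<J>] by auto
    then have "\<theta> < \<rho> J" using \<theta>_le[OF J\<J>] by simp
    then show ?thesis using J by (simp add: gap_def \<rho>_def \<P>_def field_simps)
  qed
  \<comment> \<open>Finitely many parts leave a common margin. The cap 1 serves
    \<open>overlap\<close>, where one additional common vertex lowers the weight by 1.\<close>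
  define \<epsilon> where "\<epsilon> = Min (insert 1 (gap ` \<P>))"
  have \<epsilon>0: "0 < \<epsilon>" "\<epsilon> \<le> 1" using f\<P> gap_pos by (auto simp: \<epsilon>_def)
  have \<epsilon>gap: "\<epsilon> \<le> gap J" if "J \<in> \<P>" for J using that f\<P> by (auto simp: \<epsilon>_def)
  interpret strictly_balanced F \<theta> \<epsilon>
  proof
    show "real (card (\<Union>F)) - 2 = \<theta> * (real (card F) - 1)"
      using F(2) FE by (simp add: \<rho>_def field_simps)
    show "\<theta> * (real (card J) - 1) + \<epsilon> \<le> real (card (\<Union>J)) - 2"
      if "J \<subseteq> F" "2 \<le> card J" "J \<noteq> F" for J
      using \<epsilon>gap[of J] that by (simp add: gap_def \<P>_def)
  qed (use finF FE E \<theta>0 \<theta>1 \<epsilon>0 in auto)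
  obtain n G where n: "n > 0" and G: "G \<in> copy_free {1..n}" "K * real n powr (2 - \<theta>) \<le> real (card G)"
    using dense_copy_free[OF K] by blast
  have nocopy: "\<not> (\<exists>X\<subseteq>G. copy_of E X)"
  proof
    assume "\<exists>X\<subseteq>G. copy_of E X"
    then obtain X where X: "X \<subseteq> G" "copy_of E X" by blast
    from copy_of_mono[OF X(2) FE(1)] obtain Y where Y: "Y \<subseteq> X" "cp Y" by blast
    have "\<forall>X. cp X \<longrightarrow> \<not> X \<subseteq> G" using G(1) by (simp add: copy_free_def)
    then show False using X(1) Y by blast
  qed
  have "K * real n powr (2 - \<beta>) \<le> K * real n powr (2 - \<theta>)"
    using K n \<theta>\<beta> by (intro mult_left_mono powr_mono) auto
  then have "K * real n powr (2 - \<beta>) \<le> real (card G)" using G(2) by (rule order_trans)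
  moreover have "G \<subseteq> pairs {1..n}" using G(1) by (simp add: copy_free_def)
  ultimately show ?thesis using n nocopy by blast
qed

section \<open>Counting free graphs\<close>

definition free_sets :: "'a set set \<Rightarrow> nat set set \<Rightarrow> nat set set set" where
  "free_sets E G = {I. I \<subseteq> G \<and> \<not> (\<exists>X\<subseteq>I. copy_of E X)}"

lemma finite_free_sets: "finite G \<Longrightarrow> finite (free_sets E G)"
  by (rule finite_subset[of _ "Pow G"]) (auto simp: free_sets_def)

lemma card_free_sets_le:
  assumes "finite G"
  shows "real (card (free_sets E G)) \<le> 2 ^ card G"
proof -
  have "card (free_sets E G) \<le> card (Pow G)"
    using assms by (intro card_mono) (auto simp: free_sets_def)
  then have "card (free_sets E G) \<le> 2 ^ card G" using assms by (simp add: card_Pow)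
  then have "real (card (free_sets E G)) \<le> real (2 ^ card G)" by (simp only: of_nat_le_iff)
  then show ?thesis by simp
qed

lemma two_power_le_exp: "(2 :: real) ^ k \<le> exp (real k)"
proof -
  have "(2 :: real) \<le> exp 1" using exp_ge_add_one_self[of 1] by simp
  then have "(2 :: real) ^ k \<le> exp 1 ^ k" by (intro power_mono) auto
  then show ?thesis by (simp add: exp_of_nat_mult[symmetric])
qed

text \<open>\<open>density\<close> says that every subgraph stays strictly above the threshold for
  the exponent \<alpha>, with a common margin \<epsilon>. The cap (2 - \<alpha>) \<epsilon> \<le>
  \<alpha> keeps the size allowed for fingerprints at least 1, however dense the graph is.\<close>

locale supersaturated =
  fixes E :: "'a set set" and \<alpha> A \<epsilon> :: real
  assumes E: "finite E" "E \<noteq> {}" and edgeE: "\<And>x. x \<in> E \<Longrightarrow> card x = 2"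
    and \<alpha>: "0 < \<alpha>" "\<alpha> < 2" and A: "0 < A" and \<epsilon>: "0 < \<epsilon>" "(2 - \<alpha>) * \<epsilon> \<le> \<alpha>"
    and ex: "\<And>(R :: nat set) G'. finite R \<Longrightarrow> R \<noteq> {} \<Longrightarrow> G' \<subseteq> pairs R \<Longrightarrow>
      A * real (card R) powr \<alpha> < real (card G') \<Longrightarrow> \<exists>X\<subseteq>G'. copy_of E X"
    and density: "\<And>J. J \<subseteq> E \<Longrightarrow> 2 \<le> card J \<Longrightarrow>
      (1 + \<epsilon>) * (2 - \<alpha>) * (real (card J) - 1) \<le> real (card (\<Union>J)) - 2"
begin

abbreviation v where "v \<equiv> card (\<Union>E)"
abbreviation e where "e \<equiv> card E"
abbreviation \<beta> :: real where "\<beta> \<equiv> 2 - \<alpha>"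
abbreviation t0 :: real where "t0 \<equiv> 4 * A + 4"
abbreviation K0 :: real where "K0 \<equiv> 2 * 2 ^ (v + e + 3)"

lemma \<beta>_pos: "0 < \<beta>" using \<alpha> by simp

lemma finUE: "finite (\<Union>E)"
  using E(1) edgeE by (metis card.infinite finite_Union zero_neq_numeral)

lemma e_pos: "1 \<le> e" using E by (simp add: Suc_le_eq card_gt_0_iff)

lemma density':
  assumes "J \<subseteq> E" "J \<noteq> {}"
  shows "(1 + \<epsilon>) * \<beta> * (real (card J) - 1) \<le> real (card (\<Union>J)) - 2"
proof (cases "2 \<le> card J")
  case False
  moreover have "0 < card J" using assms E finite_subset by (auto simp: card_gt_0_iff)
  ultimately have "card J = 1" by simp
  then obtain x where "J = {x}" by (auto simp: card_1_singleton_iff)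
  then show ?thesis using assms edgeE[of x] by simp
qed (use density assms in blast)

text \<open>The average degree is at least of order Q^(v - 2), while j edges on k vertices lie in at
  most 2 Q^(v - k) copies of the family. As k - 2 \<ge> (1 + \<epsilon>) \<beta> (j - 1) and
  Q^\<beta> = u, each further edge costs a factor u^(-(1 + \<epsilon>)).\<close>

lemma copies_spread:
  fixes G :: "nat set set" and u :: real and n :: nat
  assumes n: "n > 0" and G: "G \<subseteq> pairs {1..n}" and u: "u \<ge> 1"
    and m: "real (card G) = u * t0 * n powr \<alpha>"
  shows "\<exists>w. spread_hypergraph e K0 G w (u powr (- (1 + \<epsilon>))) \<and>
    (\<forall>X. w X \<noteq> 0 \<longrightarrow> copy_of E X)"
proof -
  let ?Q = "u powr (1 / \<beta>)" and ?\<tau> = "u powr (- (1 + \<epsilon>))" and ?m = "real (card G)"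
  have finG: "finite G" using G finite_pairs[of "{1..n}"] finite_subset by blast
  have m0: "?m > 0" using m u A n by simp
  have "\<exists>\<H>. finite \<H> \<and> (\<forall>X\<in>\<H>. X \<subseteq> G \<and> copy_of E X) \<and>
    (\<forall>S. S \<noteq> {} \<longrightarrow> real (card {X\<in>\<H>. S \<subseteq> X}) \<le> 2 * ?Q ^ (v - card (\<Union>S))) \<and>
    1 / 2 ^ (v + e + 3) * ?m * ?Q powr (real v - 2) \<le> real (card \<H>)"
    by (rule supersaturation[OF E finUE \<alpha> A _ n G u m]) (rule ex)
  then obtain \<H> where \<H>: "finite \<H>" "\<forall>X\<in>\<H>. X \<subseteq> G \<and> copy_of E X"
    "\<forall>S. S \<noteq> {} \<longrightarrow> real (card {X\<in>\<H>. S \<subseteq> X}) \<le> 2 * ?Q ^ (v - card (\<Union>S))"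
    "1 / 2 ^ (v + e + 3) * ?m * ?Q powr (real v - 2) \<le> real (card \<H>)"
    by (elim exE conjE)
  define w :: "nat set set \<Rightarrow> real" where "w X = (if X \<in> \<H> then 1 else 0)" for X
  have wd: "wdeg G w T = real (card {X\<in>\<H>. T \<subseteq> X})" for T
  proof -
    have "{A. A \<subseteq> G \<and> T \<subseteq> A} \<inter> {A. A \<in> \<H>} = {X\<in>\<H>. T \<subseteq> X}" using \<H>(2) by auto
    then show ?thesis using finG by (simp add: wdeg_def w_def sum.If_cases finite_Pow_sub)
  qed
  have "wdeg G w {} = sum w (Pow G)" by (simp add: wdeg_def Pow_def)
  then have sw: "sum w (Pow G) = real (card \<H>)" using wd[of "{}"] by simp
  have "0 < 1 / 2 ^ (v + e + 3) * ?m * ?Q powr (real v - 2)" using m0 u by simp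
  then have H0: "0 < real (card \<H>)" using \<H>(4) by linarith
  have "wdeg G w T \<le> K0 * ?\<tau> ^ (card T - 1) * real (card \<H>) / ?m" if T: "T \<subseteq> G" "T \<noteq> {}" for T
  proof (cases "{X\<in>\<H>. T \<subseteq> X} = {}")
    case True
    have "0 \<le> K0 * ?\<tau> ^ (card T - 1) * real (card \<H>) / ?m" by simp
    then show ?thesis unfolding wd True by simp
  next
    case False
    then obtain X where X: "X \<in> \<H>" "T \<subseteq> X" by blast
    then have cX: "copy_of E X" using \<H>(2) by blast
    obtain J where J: "J \<subseteq> E" "copy_of J T" using copy_of_subset[OF cX X(2)] by blast
    have cT: "card T = card J" "card (\<Union>T) = card (\<Union>J)" using copy_of_card[OF J(2)] by auto
    have "J \<noteq> {}" using J(2) T(2) by (auto simp: copy_of_def)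
    from density'[OF J(1) this] have dens: "(1 + \<epsilon>) * \<beta> * (real (card T) - 1) \<le> real (card (\<Union>T)) - 2"
      using cT by simp
    have le: "card (\<Union>T) \<le> v" unfolding cT using finUE J(1) by (intro card_mono) auto
    have cT1: "card T \<ge> 1" using T finG by (simp add: Suc_le_eq card_gt_0_iff finite_subset)
    have "wdeg G w T \<le> 2 * ?Q ^ (v - card (\<Union>T))" unfolding wd using \<H>(3) T(2) by blast
    also have "?Q ^ (v - card (\<Union>T)) = u powr ((real v - real (card (\<Union>T))) / \<beta>)"
      using u le by (simp add: powr_realpow[symmetric] powr_powr of_nat_diff)
    also have "\<dots> \<le> u powr (- (1 + \<epsilon>) * (real (card T) - 1) + (real v - 2) / \<beta>)"
    proof (rule powr_mono)
      have "(1 + \<epsilon>) * (real (card T) - 1) \<le> (real (card (\<Union>T)) - 2) / \<beta>"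
        using dens \<beta>_pos by (simp add: pos_le_divide_eq mult_ac)
      moreover have "(real v - real (card (\<Union>T))) / \<beta> = (real v - 2) / \<beta> - (real (card (\<Union>T)) - 2) / \<beta>"
        by (simp add: diff_divide_distrib[symmetric])
      ultimately show "(real v - real (card (\<Union>T))) / \<beta> \<le> - (1 + \<epsilon>) * (real (card T) - 1) + (real v - 2) / \<beta>"
        by linarith
    qed (use u in simp)
    also have "\<dots> = ?\<tau> ^ (card T - 1) * ?Q powr (real v - 2)"
      using u cT1 by (simp add: powr_add powr_realpow[symmetric] powr_powr of_nat_diff)
    also have "2 * (?\<tau> ^ (card T - 1) * ?Q powr (real v - 2)) =
        K0 * ?\<tau> ^ (card T - 1) * (1 / 2 ^ (v + e + 3) * ?m * ?Q powr (real v - 2)) / ?m"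
      using m0 by simp
    also have "\<dots> \<le> K0 * ?\<tau> ^ (card T - 1) * real (card \<H>) / ?m"
      using \<H>(4) by (intro divide_right_mono mult_left_mono) auto
    finally show ?thesis by simp
  qed
  moreover have "A \<subseteq> G \<and> card A = e" if "w A \<noteq> 0" for A
    using that \<H>(2) copy_of_card(1)[of E A] by (auto simp: w_def split: if_splits)
  ultimately have "spread_hypergraph e K0 G w ?\<tau>"
    unfolding spread_hypergraph_def sw using finG m0 H0 u by (auto simp: w_def)
  moreover have "\<forall>X. w X \<noteq> 0 \<longrightarrow> copy_of E X" using \<H>(2) by (auto simp: w_def)
  ultimately show ?thesis by blast
qed

text \<open>Fingerprints have size of order u^(-\<epsilon>) n^\<alpha>, where the exponent -
  \<epsilon> is the margin in the density assumption. Counting them costs another factor ln u, which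
  half of this exponent absorbs.\<close>

lemma container_shrink:
  "\<exists>c C u0. 0 < c \<and> c < 1 \<and> 0 < C \<and> 1 \<le> u0 \<and> (\<forall>n G u. n > 0 \<longrightarrow> G \<subseteq> pairs {1..n} \<longrightarrow> u0 \<le> u \<longrightarrow>
     real (card G) = u * t0 * n powr \<alpha> \<longrightarrow>
     (\<exists>\<C>. finite \<C> \<and> real (card \<C>) \<le> exp (C * u powr (- (\<epsilon> / 2)) * n powr \<alpha>) \<and>
       (\<forall>X\<in>\<C>. X \<subseteq> G \<and> real (card X) \<le> (1 - c) * real (card G)) \<and>
       (\<forall>I\<in>free_sets E G. \<exists>X\<in>\<C>. I \<subseteq> X)))"
proof -
  have "0 < K0" by simp
  from hypergraph_containers[OF e_pos this] obtain c where c: "c > 0" and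
    cont: "\<forall>(V :: nat set set) w p b. spread_hypergraph e K0 V w p \<longrightarrow> p * real (card V) \<le> real b \<longrightarrow>
      real b \<le> c * real (card V) \<longrightarrow> has_containers e c V w b" by (elim exE conjE)
  define d where "d = min c (1 / 2)"
  define C where "C = real e * t0 * (4 * (1 + \<epsilon>) / \<epsilon> + 1)"
  \<comment> \<open>For u \<ge> 2 / c the fingerprint size, at most 2 / u times the number of edges,
    is within the range of the container theorem.\<close>
  define u0 where "u0 = max 1 (2 / c)"
  have C0: "C > 0" using e_pos A \<epsilon> by (auto simp: C_def intro!: mult_pos_pos add_pos_pos divide_pos_pos)
  have main: "\<exists>\<C>. finite \<C> \<and> real (card \<C>) \<le> exp (C * u powr (- (\<epsilon> / 2)) * n powr \<alpha>) \<and>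
       (\<forall>X\<in>\<C>. X \<subseteq> G \<and> real (card X) \<le> (1 - d) * real (card G)) \<and>
       (\<forall>I\<in>free_sets E G. \<exists>X\<in>\<C>. I \<subseteq> X)"
    if n: "n > 0" and G: "G \<subseteq> pairs {1..n}" and uu: "u0 \<le> u" and m: "real (card G) = u * t0 * n powr \<alpha>"
    for n :: nat and G u
  proof -
    let ?\<tau> = "u powr (- (1 + \<epsilon>))" and ?m = "real (card G)"
    have u: "u \<ge> 1" "2 / c \<le> u" using uu by (auto simp: u0_def)
    obtain w where w: "spread_hypergraph e K0 G w ?\<tau>" "\<forall>X. w X \<noteq> 0 \<longrightarrow> copy_of E X"
      using copies_spread[OF n G u(1) m] by blast
    have nr: "real n \<ge> 1" using n by simp
    have m0: "?m > 0" using m u A n by simp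
    have \<tau>m: "?\<tau> * ?m = u powr (- \<epsilon>) * t0 * n powr \<alpha>"
    proof -
      have "?\<tau> * u = u powr (- (1 + \<epsilon>) + 1)" using u unfolding powr_add by simp
      then show ?thesis using m by simp
    qed
    have "?m \<le> real (n * n)" using card_le_square[OF G] by (simp only: of_nat_le_iff)
    also have "real (n * n) = n powr \<beta> * n powr \<alpha>"
      using n by (simp add: powr_add[symmetric] power2_eq_square)
    finally have "u * t0 \<le> n powr \<beta>" using m n by simp
    moreover have "u * 1 \<le> u * t0" using u A by (intro mult_left_mono) auto
    ultimately have un: "u \<le> n powr \<beta>" by simp
    \<comment> \<open>The cap on \<epsilon> enters here, through u \<le> n^\<beta>. Rounding up to
      the natural number \<open>b\<close> then at most doubles the value.\<close>
    have \<tau>m1: "1 \<le> ?\<tau> * ?m"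
    proof -
      have "(n powr \<beta>) powr (- \<epsilon>) \<le> u powr (- \<epsilon>)" using un u \<epsilon> by (intro powr_mono2') auto
      moreover have "n powr (- \<alpha>) \<le> (n powr \<beta>) powr (- \<epsilon>)"
        unfolding powr_powr using nr \<epsilon>(2) by (intro powr_mono) auto
      ultimately have "n powr (- \<alpha>) * n powr \<alpha> \<le> u powr (- \<epsilon>) * n powr \<alpha>"
        by (intro mult_right_mono) auto
      then have "1 \<le> u powr (- \<epsilon>) * n powr \<alpha>" using n by (simp add: powr_add[symmetric])
      moreover have "1 * (u powr (- \<epsilon>) * n powr \<alpha>) \<le> t0 * (u powr (- \<epsilon>) * n powr \<alpha>)"
        using A by (intro mult_right_mono) auto
      ultimately show ?thesis unfolding \<tau>m by (simp add: mult_ac)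
    qed
    define b where "b = nat \<lceil>?\<tau> * ?m\<rceil>"
    have b: "?\<tau> * ?m \<le> real b" "real b \<le> 2 * (?\<tau> * ?m)" unfolding b_def using \<tau>m1 by linarith+
    have "?\<tau> \<le> u powr (- 1)" using u \<epsilon> by (intro powr_mono) auto
    also have "\<dots> = 1 / u" using u by (simp add: powr_minus_divide)
    also have "\<dots> \<le> c / 2" using u c by (simp add: field_simps)
    finally have "2 * (?\<tau> * ?m) \<le> c * ?m" using m0 by simp
    then have "has_containers e c G w b" using b by (intro cont[rule_format, OF w(1)]) auto
    then obtain \<C> where \<C>: "finite \<C>" "card \<C> \<le> binsum (card G) b ^ e"
      "\<forall>X\<in>\<C>. X \<subseteq> G \<and> real (card X) \<le> (1 - c) * ?m"
      "\<forall>I\<subseteq>G. indep w I \<longrightarrow> (\<exists>X\<in>\<C>. I \<subseteq> X)"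
      unfolding has_containers_def by (elim exE conjE)
    have \<tau>1: "0 < ?\<tau>" "?\<tau> \<le> 1" using u \<epsilon> powr_mono[of "- (1 + \<epsilon>)" 0 u] by auto
    have "real (card \<C>) \<le> real (binsum (card G) b) ^ e"
      using \<C>(2) by (metis of_nat_le_iff of_nat_power)
    also have "\<dots> \<le> ((1 / ?\<tau>) ^ b * exp (?\<tau> * ?m)) ^ e"
      by (intro power_mono binsum_le \<tau>1) auto
    also have "(1 / ?\<tau>) ^ b = exp (real b * ((1 + \<epsilon>) * ln u))"
    proof -
      have "1 / ?\<tau> = u powr (1 + \<epsilon>)" by (subst powr_minus_divide) simp
      also have "\<dots> = exp ((1 + \<epsilon>) * ln u)" using u by (simp add: powr_def)
      finally show ?thesis by (simp add: exp_of_nat_mult)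
    qed
    also have "(exp (real b * ((1 + \<epsilon>) * ln u)) * exp (?\<tau> * ?m)) ^ e =
        exp (real e * (real b * ((1 + \<epsilon>) * ln u) + ?\<tau> * ?m))"
      by (simp add: exp_add exp_of_nat_mult)
    also have "\<dots> \<le> exp (C * u powr (- (\<epsilon> / 2)) * n powr \<alpha>)"
    proof -
      have ln: "0 \<le> ln u" "ln u \<le> u powr (\<epsilon> / 2) / (\<epsilon> / 2)"
        using u \<epsilon> ln_powr_bound[of u "\<epsilon> / 2"] by auto
      have id: "x * t * N * (a * y) + x * t * N * y = t * (a + 1) * (x * y) * N" for x t N a y :: real
        by (simp add: algebra_simps)
      have one: "1 \<le> u powr (\<epsilon> / 2)" using u \<epsilon> by (simp add: ge_one_powr_ge_zero)
      have "real b * ((1 + \<epsilon>) * ln u) \<le> 2 * (?\<tau> * ?m) * ((1 + \<epsilon>) * (u powr (\<epsilon> / 2) / (\<epsilon> / 2)))"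
        using b ln \<epsilon> \<tau>m1 by (intro mult_mono mult_nonneg_nonneg) auto
      also have "\<dots> = ?\<tau> * ?m * (4 * (1 + \<epsilon>) / \<epsilon> * u powr (\<epsilon> / 2))" by simp
      finally have "real b * ((1 + \<epsilon>) * ln u) + ?\<tau> * ?m \<le>
          ?\<tau> * ?m * (4 * (1 + \<epsilon>) / \<epsilon> * u powr (\<epsilon> / 2)) + ?\<tau> * ?m * u powr (\<epsilon> / 2)"
        using mult_left_mono[OF one, of "?\<tau> * ?m"] \<tau>m1 by linarith
      also have "\<dots> = t0 * (4 * (1 + \<epsilon>) / \<epsilon> + 1) * (u powr (- \<epsilon>) * u powr (\<epsilon> / 2)) * n powr \<alpha>"
        unfolding \<tau>m by (rule id)
      also have "u powr (- \<epsilon>) * u powr (\<epsilon> / 2) = u powr (- (\<epsilon> / 2))"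
        by (simp add: powr_add[symmetric])
      finally have "real e * (real b * ((1 + \<epsilon>) * ln u) + ?\<tau> * ?m) \<le>
          real e * (t0 * (4 * (1 + \<epsilon>) / \<epsilon> + 1) * u powr (- (\<epsilon> / 2)) * n powr \<alpha>)"
        by (intro mult_left_mono) auto
      also have "\<dots> = C * u powr (- (\<epsilon> / 2)) * n powr \<alpha>" by (simp add: C_def mult_ac)
      finally show ?thesis by simp
    qed
    finally have cC: "real (card \<C>) \<le> exp (C * u powr (- (\<epsilon> / 2)) * n powr \<alpha>)" .
    have "X \<subseteq> G \<and> real (card X) \<le> (1 - d) * ?m" if "X \<in> \<C>" for X
    proof -
      have "(1 - c) * ?m \<le> (1 - d) * ?m" by (intro mult_right_mono) (auto simp: d_def)
      then show ?thesis using \<C>(3) that by force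
    qed
    moreover have "\<exists>X\<in>\<C>. I \<subseteq> X" if "I \<in> free_sets E G" for I
    proof -
      have "indep w I" using that w(2) by (auto simp: indep_def free_sets_def)
      then show ?thesis using \<C>(4) that by (auto simp: free_sets_def)
    qed
    ultimately show ?thesis using \<C>(1) cC by (intro exI[of _ \<C>] conjI ballI) auto
  qed
  have "0 < d" "d < 1" "1 \<le> u0" using c by (auto simp: d_def u0_def)
  then show ?thesis using C0 main by (intro exI[of _ d] exI[of _ C] exI[of _ u0] conjI allI impI)
qed

lemma free_sets_bound:
  "\<exists>M. \<forall>n G. n > 0 \<longrightarrow> G \<subseteq> pairs {1..n} \<longrightarrow> real (card (free_sets E G)) \<le> exp (M * n powr \<alpha>)"
proof -
  obtain c C u0 where c: "0 < c" "c < 1" and C: "0 < C" and u0: "1 \<le> u0" and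
    shrink: "\<forall>n G u. n > 0 \<longrightarrow> G \<subseteq> pairs {1..n} \<longrightarrow> u0 \<le> u \<longrightarrow>
     real (card G) = u * t0 * n powr \<alpha> \<longrightarrow>
     (\<exists>\<C>. finite \<C> \<and> real (card \<C>) \<le> exp (C * u powr (- (\<epsilon> / 2)) * n powr \<alpha>) \<and>
       (\<forall>X\<in>\<C>. X \<subseteq> G \<and> real (card X) \<le> (1 - c) * real (card G)) \<and>
       (\<forall>I\<in>free_sets E G. \<exists>X\<in>\<C>. I \<subseteq> X))"
    using container_shrink by (elim exE conjE)
  define g where "g = (1 - c) powr (- (\<epsilon> / 2))"
  have g1: "1 < g"
  proof -
    have "(1 - c) powr 0 < (1 - c) powr (- (\<epsilon> / 2))" using c \<epsilon> by (intro powr_less_mono') auto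
    then show ?thesis using c by (simp add: g_def)
  qed
  \<comment> \<open>Passing to a container multiplies u^(-\<epsilon> / 2) by at least
    \<open>g\<close>. With L (g - 1) = C the increase of L u^(-\<epsilon> / 2) pays for the number
    of containers, so the exponent M - L u^(-\<epsilon> / 2) telescopes.\<close>
  define L where "L = C / (g - 1)"
  have L: "0 < L" "L * g = L + C" using C g1 by (auto simp: L_def field_simps)
  \<comment> \<open>Since u^(-\<epsilon> / 2) \<le> 1, subtracting (L + C) u^(-\<epsilon> / 2) still
    leaves u0 t0, the trivial bound for graphs below the threshold \<open>u0\<close>.\<close>
  define M where "M = u0 * t0 + L + C"
  have small: "real (card (free_sets E G)) \<le> exp (u0 * t0 * n powr \<alpha>)"
    if "G \<subseteq> pairs {1..n}" "real (card G) \<le> u0 * t0 * n powr \<alpha>" for n :: nat and G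
  proof -
    have "finite G" using that finite_pairs[of "{1..n}"] finite_subset by blast
    then have "real (card (free_sets E G)) \<le> exp (real (card G))"
      using card_free_sets_le[of G E] two_power_le_exp[of "card G"] by linarith
    then show ?thesis using that(2) by (meson exp_le_cancel_iff order_trans)
  qed
  have large: "real (card (free_sets E G)) \<le> exp ((M - L * u powr (- (\<epsilon> / 2))) * n powr \<alpha>)"
    if "n > 0" "G \<subseteq> pairs {1..n}" "u0 \<le> u" "real (card G) = u * t0 * n powr \<alpha>" for n :: nat and G u
    using that
  proof (induction "card G" arbitrary: G u rule: less_induct)
    case less
    let ?x = "u powr (- (\<epsilon> / 2))" and ?N = "real n powr \<alpha>"
    have t0N: "0 < t0 * ?N" using A less.prems(1) by simp
    have u: "1 \<le> u" using less.prems u0 by simp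
    have x1: "0 < ?x" "?x \<le> 1" using u \<epsilon> powr_mono[of "- (\<epsilon> / 2)" 0 u] by auto
    have m0: "0 < real (card G)" unfolding less.prems(4) using t0N u by (simp add: mult.assoc)
    obtain \<C> where \<C>: "finite \<C>" "real (card \<C>) \<le> exp (C * ?x * ?N)"
      "\<forall>X\<in>\<C>. X \<subseteq> G \<and> real (card X) \<le> (1 - c) * real (card G)"
      "\<forall>I\<in>free_sets E G. \<exists>X\<in>\<C>. I \<subseteq> X"
      using shrink[rule_format, OF less.prems] by (elim exE conjE)
    have finG: "finite G" using less.prems finite_pairs[of "{1..n}"] finite_subset by blast
    have each: "real (card (free_sets E X)) \<le> exp ((M - (L + C) * ?x) * ?N)" if X: "X \<in> \<C>" for X
    proof -
      have XG: "X \<subseteq> G" "real (card X) \<le> (1 - c) * real (card G)" using \<C>(3) X by auto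
      have XV: "X \<subseteq> pairs {1..n}" using XG less.prems by auto
      define y where "y = real (card X) / (t0 * ?N)"
      have "y * (t0 * ?N) = real (card X)"
        using nonzero_eq_divide_eq[OF less_imp_neq[OF t0N, symmetric], THEN iffD1, OF y_def] .
      then have y: "real (card X) = y * t0 * ?N" by (simp only: mult.assoc)
      show ?thesis
      proof (cases "u0 \<le> y")
        case True
        have "(1 - c) * real (card G) < real (card G)" using c m0 by (simp add: algebra_simps)
        then have "card X < card G" using XG(2) by linarith
        from less.hyps[OF this less.prems(1) XV True y]
        have "real (card (free_sets E X)) \<le> exp ((M - L * y powr (- (\<epsilon> / 2))) * ?N)" .
        also have "\<dots> \<le> exp ((M - (L + C) * ?x) * ?N)"
        proof -
          have "y * (t0 * ?N) \<le> (1 - c) * u * (t0 * ?N)"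
            using XG(2) y less.prems(4) by (simp add: mult_ac)
          then have "y \<le> (1 - c) * u" using t0N by (simp only: mult_le_cancel_right_pos)
          then have "((1 - c) * u) powr (- (\<epsilon> / 2)) \<le> y powr (- (\<epsilon> / 2))"
            using True u0 \<epsilon> by (intro powr_mono2') auto
          then have "g * ?x \<le> y powr (- (\<epsilon> / 2))" using c u by (simp add: powr_mult g_def)
          then have "L * (g * ?x) \<le> L * y powr (- (\<epsilon> / 2))" using L by (intro mult_left_mono) auto
          then have "(L + C) * ?x \<le> L * y powr (- (\<epsilon> / 2))" using L(2) by (metis mult.assoc)
          then have "(M - L * y powr (- (\<epsilon> / 2))) * ?N \<le> (M - (L + C) * ?x) * ?N"
            by (intro mult_right_mono) auto
          then show ?thesis by simp
        qed
        finally show ?thesis .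
      next
        case False
        then have "y * (t0 * ?N) \<le> u0 * (t0 * ?N)" using t0N by (intro mult_right_mono) auto
        then have "real (card X) \<le> u0 * t0 * ?N" using y by (simp add: mult_ac)
        from small[OF XV this] have "real (card (free_sets E X)) \<le> exp (u0 * t0 * ?N)" .
        also have "\<dots> \<le> exp ((M - (L + C) * ?x) * ?N)"
        proof -
          have "(L + C) * ?x \<le> (L + C) * 1" using L C x1 by (intro mult_left_mono) auto
          then have "u0 * t0 * ?N \<le> (M - (L + C) * ?x) * ?N"
            by (intro mult_right_mono) (auto simp: M_def)
          then show ?thesis by simp
        qed
        finally show ?thesis .
      qed
    qed
    have "free_sets E G \<subseteq> (\<Union>X\<in>\<C>. free_sets E X)"
      using \<C>(4) unfolding free_sets_def by blast
    moreover have "finite (\<Union>X\<in>\<C>. free_sets E X)"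
      using \<C>(1,3) finG by (intro finite_UN_I finite_free_sets) (auto dest: finite_subset)
    ultimately have "card (free_sets E G) \<le> card (\<Union>X\<in>\<C>. free_sets E X)" by (intro card_mono)
    also have "\<dots> \<le> (\<Sum>X\<in>\<C>. card (free_sets E X))" by (rule card_UN_le[OF \<C>(1)])
    finally have "real (card (free_sets E G)) \<le> (\<Sum>X\<in>\<C>. real (card (free_sets E X)))"
      by (metis of_nat_le_iff of_nat_sum)
    also have "\<dots> \<le> (\<Sum>X\<in>\<C>. exp ((M - (L + C) * ?x) * ?N))" by (intro sum_mono each)
    also have "\<dots> = real (card \<C>) * exp ((M - (L + C) * ?x) * ?N)" by simp
    also have "\<dots> \<le> exp (C * ?x * ?N) * exp ((M - (L + C) * ?x) * ?N)"
      using \<C>(2) by (intro mult_right_mono) auto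
    also have "\<dots> = exp ((M - L * ?x) * ?N)"
      by (simp add: exp_add[symmetric] algebra_simps)
    finally show ?case .
  qed
  have "real (card (free_sets E G)) \<le> exp (M * n powr \<alpha>)" if G: "n > 0" "G \<subseteq> pairs {1..n}" for n :: nat and G
  proof -
    have t0N: "0 < t0 * real n powr \<alpha>" using A G by simp
    define y where "y = real (card G) / (t0 * real n powr \<alpha>)"
    have "y * (t0 * real n powr \<alpha>) = real (card G)"
      using nonzero_eq_divide_eq[OF less_imp_neq[OF t0N, symmetric], THEN iffD1, OF y_def] .
    then have y: "real (card G) = y * t0 * real n powr \<alpha>" by (simp only: mult.assoc)
    show ?thesis
    proof (cases "u0 \<le> y")
      case True
      have "(M - L * y powr (- (\<epsilon> / 2))) * n powr \<alpha> \<le> M * n powr \<alpha>"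
        using L by (intro mult_right_mono) auto
      then show ?thesis using large[OF G True y] by (meson exp_le_cancel_iff order_trans)
    next
      case False
      then have "y * (t0 * real n powr \<alpha>) \<le> u0 * (t0 * real n powr \<alpha>)"
        using t0N by (intro mult_right_mono) auto
      then have "real (card G) \<le> u0 * t0 * real n powr \<alpha>" using y by (simp add: mult_ac)
      moreover have "u0 * t0 * n powr \<alpha> \<le> M * n powr \<alpha>"
        using L C by (intro mult_right_mono) (auto simp: M_def)
      ultimately show ?thesis using small[OF G(2)] by (meson exp_le_cancel_iff order_trans)
    qed
  qed
  then show ?thesis by blast
qed

end

section \<open>From edge sets back to graphs\<close>

lemma copy_of_imp_contains_copy:
  assumes H: "finite_simple_graph H" and G: "finite (verts G)" "edges G \<subseteq> pairs (verts G)"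
    and n: "card (verts H) \<le> card (verts G)" and X: "X \<subseteq> edges G" "copy_of (edges H) X"
  shows "contains_copy G H"
proof -
  let ?U = "\<Union>(edges H)"
  have UH: "?U \<subseteq> verts H" and fH: "finite (verts H)" using H by (auto simp: finite_simple_graph_def)
  obtain f where f: "inj_on f ?U" "X = (`) f ` edges H" using X(2) by (auto simp: copy_of_def)
  have fU: "f ` ?U \<subseteq> verts G" 
  proof -
    have "f ` ?U = \<Union>X" using f(2) by auto
    then show ?thesis using Union_pairs_subset[OF subset_trans[OF X(1) G(2)]] by simp
  qed
  \<comment> \<open>The isolated vertices of \<open>H\<close> go injectively to vertices outside the
    copy; there is room because \<open>G\<close> has at least as many vertices as
    \<open>H\<close>.\<close>
  have "card (verts H - ?U) = card (verts H) - card ?U"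
    using UH fH by (intro card_Diff_subset finite_subset[OF UH]) auto
  also have "\<dots> \<le> card (verts G) - card (f ` ?U)" using n card_image[OF f(1)] by simp
  also have "\<dots> = card (verts G - f ` ?U)"
    using fU G(1) by (intro card_Diff_subset[symmetric] finite_subset[OF fU]) auto
  finally obtain g where g: "inj_on g (verts H - ?U)" "g ` (verts H - ?U) \<subseteq> verts G - f ` ?U"
    using card_le_inj[of "verts H - ?U" "verts G - f ` ?U"] fH G(1) by auto
  define h where "h x = (if x \<in> ?U then f x else g x)" for x
  have "inj_on h (verts H)"
  proof (rule inj_onI)
    fix x y assume "x \<in> verts H" "y \<in> verts H" "h x = h y"
    moreover have "f a \<noteq> g b" if "a \<in> ?U" "b \<in> verts H - ?U" for a b
      using g(2) that by (metis DiffD2 image_eqI image_subset_iff)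
    ultimately show "x = y"
      using inj_onD[OF f(1), of x y] inj_onD[OF g(1), of x y]
      by (metis DiffI h_def)
  qed
  moreover have "h ` verts H \<subseteq> verts G"
  proof (rule image_subsetI)
    fix x assume "x \<in> verts H"
    show "h x \<in> verts G"
    proof (cases "x \<in> ?U")
      case True
      then have "f x \<in> f ` ?U" by (rule imageI)
      then show ?thesis using True fU by (simp add: h_def subset_iff)
    next
      case False
      then have "g x \<in> g ` (verts H - ?U)" using \<open>x \<in> verts H\<close> by (intro imageI) simp
      then have "g x \<in> verts G" using g(2) by blast
      then show ?thesis unfolding h_def if_not_P[OF False] .
    qed
  qed
  moreover have "h ` x \<in> edges G" if "x \<in> edges H" for x
  proof -
    have "h ` x = f ` x" using that by (auto simp: h_def)
    then show ?thesis using that f(2) X(1) by auto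
  qed
  ultimately show ?thesis unfolding contains_copy_def by blast
qed

lemma card_le_ex_number:
  fixes G :: "nat set set"
  assumes "finite V" "G \<subseteq> pairs V" "\<not> (\<exists>X\<subseteq>G. copy_of (edges H) X)" "finite_simple_graph H"
  shows "card G \<le> ex_number (card V) H"
  unfolding ex_number_def
proof (rule Max_ge)
  have "\<not> contains_copy (V, G) H"
  proof
    assume "contains_copy (V, G) H"
    from contains_copy_imp_copy_of[OF this subset_refl] show False
      using assms(3,4) by (auto simp: finite_simple_graph_def)
  qed
  moreover have "finite_simple_graph (V, G)" using assms by (auto simp: finite_simple_graph_def pairs_def)
  ultimately show "card G \<in> {card (edges G) |G :: nat graph.
     finite_simple_graph G \<and> card (verts G) = card V \<and> \<not> contains_copy G H}"
    by (intro CollectI exI[of _ "(V, G)"]) auto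
qed (rule finite_edge_numbers)

text \<open>For k = 2 both edges would coincide; from k = 3 on, two positions cannot each be the
  cyclic successor of the other.\<close>

lemma card_cycle_edges:
  assumes "3 \<le> k"
  shows "card (edges (cycle_graph k)) = k"
proof -
  have "inj_on (\<lambda>i. {i, (i + 1) mod k}) {..<k}"
  proof (rule inj_onI)
    fix i j assume ij: "i \<in> {..<k}" "j \<in> {..<k}" "{i, (i + 1) mod k} = {j, (j + 1) mod k}"
    have md: "(x + 1) mod k = (if x + 1 = k then 0 else x + 1)" if "x < k" for x
      using that by auto
    show "i = j"
    proof (rule ccontr)
      assume "i \<noteq> j"
      then have eq: "i = (j + 1) mod k" "j = (i + 1) mod k" using ij(3) by (metis doubleton_eq_iff)+
      have lt: "i < k" "j < k" using ij(1,2) by auto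
      have "j + 1 = k \<and> i = 0 \<or> i = j + 1" using trans[OF eq(1) md[OF lt(2)]] by metis
      moreover have "i + 1 = k \<and> j = 0 \<or> j = i + 1" using trans[OF eq(2) md[OF lt(1)]] by metis
      ultimately show False using assms by (elim disjE conjE) linarith+
    qed
  qed
  moreover have "edges (cycle_graph k) = (\<lambda>i. {i, (i + 1) mod k}) ` {..<k}"
  proof -
    have "{F i |i. i < k} = F ` {..<k}" for F :: "nat \<Rightarrow> nat set" by auto
    then show ?thesis unfolding cycle_graph_def snd_conv .
  qed
  ultimately show ?thesis by (simp add: card_image)
qed

lemma cycle_subgraph:
  assumes H: "finite_simple_graph H" and "contains_cycle H"
  shows "\<exists>Z\<subseteq>edges H. 2 \<le> card Z \<and> real (card (\<Union>Z)) - 2 < real (card Z) - 1"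
proof -
  obtain k f where k: "3 \<le> k" and f: "inj_on f {..<k}" "\<forall>x\<in>edges (cycle_graph k). f ` x \<in> edges H"
    using assms(2) by (auto simp: contains_cycle_def contains_copy_def cycle_graph_def)
  let ?Z = "(`) f ` edges (cycle_graph k)"
  have U: "\<Union>(edges (cycle_graph k)) \<subseteq> {..<k}" using k by (auto simp: cycle_graph_def)
  then have "inj_on ((`) f) (edges (cycle_graph k))"
    using f(1) inj_on_subset by (intro inj_on_image) blast
  then have cZ: "card ?Z = k" using card_cycle_edges[OF k] by (simp add: card_image)
  have "\<Union>?Z \<subseteq> f ` {..<k}" using U by auto
  then have "card (\<Union>?Z) \<le> card (f ` {..<k})" by (intro card_mono) auto
  also have "\<dots> \<le> k" using card_image_le[of "{..<k}" f] by simp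
  finally have "real (card (\<Union>?Z)) - 2 < real (card ?Z) - 1" using cZ by simp
  moreover have "?Z \<subseteq> edges H" using f(2) by (intro image_subsetI) blast
  moreover have "2 \<le> card ?Z" using cZ k by simp
  ultimately show ?thesis by blast
qed

lemma labeled_free_graphs_pairs:
  assumes "G \<in> labeled_free_graphs n H"
  shows "verts G = {1..n}" "edges G \<subseteq> pairs {1..n}" "\<not> contains_copy G H"
proof -
  have G: "finite_simple_graph G" "verts G = {1..n}" "\<not> contains_copy G H"
    using assms by (simp_all add: labeled_free_graphs_def)
  then show "verts G = {1..n}" "\<not> contains_copy G H" by simp_all
  show "edges G \<subseteq> pairs {1..n}"
  proof
    fix x assume "x \<in> edges G"
    then show "x \<in> pairs {1..n}" using G(1,2) by (simp add: finite_simple_graph_def pairs_def)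
  qed
qed

lemma card_labeled_le:
  "real (card (labeled_free_graphs n H)) \<le> 2 powr (real n ^ 2)"
proof -
  have "labeled_free_graphs n H \<subseteq> {{1..n}} \<times> Pow (pairs {1..n})"
  proof
    fix G assume "G \<in> labeled_free_graphs n H"
    from labeled_free_graphs_pairs[OF this] show "G \<in> {{1..n}} \<times> Pow (pairs {1..n})"
      by (simp add: mem_Times_iff)
  qed
  then have "card (labeled_free_graphs n H) \<le> card ({{1..n}} \<times> Pow (pairs {1..n}))"
    using finite_pairs[of "{1..n}"] by (intro card_mono) simp_all
  also have "\<dots> = 2 ^ (n choose 2)"
    using finite_pairs[of "{1..n}"] by (simp add: card_cartesian_product card_Pow card_pairs)
  also have "\<dots> \<le> 2 ^ (n * n)"
    by (intro power_increasing choose_two_le) simp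
  finally have "real (card (labeled_free_graphs n H)) \<le> real (2 ^ (n * n))" by (simp only: of_nat_le_iff)
  also have "\<dots> = 2 powr (real n ^ 2)" by (simp add: powr_realpow[symmetric] power2_eq_square)
  finally show ?thesis .
qed

lemma card_labeled_le_free_sets:
  assumes "finite_simple_graph H" "card (verts H) \<le> n"
  shows "card (labeled_free_graphs n H) \<le> card (free_sets (edges H) (pairs {1..n}))"
proof (rule card_inj_on_le[where f = edges])
  show "inj_on edges (labeled_free_graphs n H)"
    by (intro inj_onI prod_eqI) (simp_all add: labeled_free_graphs_pairs(1))
  show "finite (free_sets (edges H) (pairs {1..n}))"
    by (intro finite_free_sets finite_pairs) simp
  show "edges ` labeled_free_graphs n H \<subseteq> free_sets (edges H) (pairs {1..n})"
  proof (rule image_subsetI)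
    fix G assume "G \<in> labeled_free_graphs n H"
    note G = labeled_free_graphs_pairs[OF this]
    have "\<not> (\<exists>X\<subseteq>edges G. copy_of (edges H) X)"
    proof
      assume "\<exists>X\<subseteq>edges G. copy_of (edges H) X"
      then obtain X where X: "X \<subseteq> edges G" "copy_of (edges H) X" by blast
      have "contains_copy G H"
        by (rule copy_of_imp_contains_copy[OF assms(1) _ _ _ X]) (use G assms(2) in simp_all)
      then show False using G(3) by simp
    qed
    then show "edges G \<in> free_sets (edges H) (pairs {1..n})" using G(2) by (simp add: free_sets_def)
  qed
qed

theorem theorem1p2:
  fixes H :: "'a graph" and \<alpha> A :: real
  assumes "finite_simple_graph H" and "contains_cycle H"
    and "\<alpha> > 0" and "A > 0"
    and "\<And>n :: nat. n > 0 \<Longrightarrow> real (ex_number n H) \<le> A * real n powr \<alpha>"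
  shows "\<exists>C :: real. \<forall>n :: nat.
           real (card (labeled_free_graphs n H)) \<le> 2 powr (C * real n powr \<alpha>)"
proof (cases "\<alpha> < 2")
  case False
  \<comment> \<open>For \<alpha> \<ge> 2 the number of all graphs on n vertices is already small
    enough.\<close>
  have "real (card (labeled_free_graphs n H)) \<le> 2 powr (1 * real n powr \<alpha>)" for n
  proof -
    have "real n ^ 2 \<le> real n powr \<alpha>"
    proof (cases "n = 0")
      case False
      then have "real n powr 2 \<le> real n powr \<alpha>" using \<open>\<not> \<alpha> < 2\<close> by (intro powr_mono) auto
      then show ?thesis using False by simp
    qed simp
    then have "2 powr (real n ^ 2) \<le> 2 powr (1 * real n powr \<alpha>)" by (intro powr_mono) auto
    then show ?thesis using card_labeled_le[of n H] by (rule order_trans[rotated])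
  qed
  then show ?thesis by blast
next
  case True
  let ?E = "edges H"
  define \<beta> where "\<beta> = 2 - \<alpha>"
  have \<beta>: "\<beta> > 0" using True by (simp add: \<beta>_def)
  have finV: "finite (verts H)" and edge: "\<And>x. x \<in> ?E \<Longrightarrow> x \<subseteq> verts H \<and> card x = 2"
    using assms(1) by (auto simp: finite_simple_graph_def)
  have "?E \<subseteq> Pow (verts H)" using edge by auto
  then have finE: "finite ?E" using finV finite_subset by auto
  obtain Z where Z: "Z \<subseteq> ?E" "2 \<le> card Z" "real (card (\<Union>Z)) - 2 < real (card Z) - 1"
    using cycle_subgraph[OF assms(1,2)] by blast
  have bound: "real (card G) \<le> A * real (card R) powr \<alpha>"
    if "finite R" "R \<noteq> {}" "G \<subseteq> pairs R" "\<not> (\<exists>X\<subseteq>G. copy_of ?E X)" for R :: "nat set" and G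
  proof -
    have "real (card G) \<le> real (ex_number (card R) H)"
      using card_le_ex_number[OF that(1,3,4) assms(1)] by simp
    also have "\<dots> \<le> A * real (card R) powr \<alpha>"
      using that by (intro assms(5)) (simp add: card_gt_0_iff)
    finally show ?thesis .
  qed
  \<comment> \<open>Otherwise \<open>superdeletion_bound\<close> with constant A + 1 would give an
    H-free graph with more edges than the assumed bound permits. Equality is excluded too, and this
    strictness is the source of \<epsilon>.\<close>
  have dens: "\<beta> * (real (card J) - 1) < real (card (\<Union>J)) - 2" if J: "J \<subseteq> ?E" "2 \<le> card J" for J
  proof (rule ccontr)
    assume "\<not> ?thesis"
    then have "real (card (\<Union>J)) - 2 \<le> \<beta> * (real (card J) - 1)" by simp
    from superdeletion_bound[OF finE _ Z J this, of "A + 1"] edge \<open>A > 0\<close>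
    obtain n G where n: "n > 0" and G: "G \<subseteq> pairs {1..n}" "\<not> (\<exists>X\<subseteq>G. copy_of ?E X)"
      "(A + 1) * real n powr (2 - \<beta>) \<le> real (card G)" by auto
    have "{1..n} \<noteq> {}" using n by simp
    from bound[OF _ this G(1,2)] have "real (card G) \<le> A * real n powr \<alpha>" by simp
    then have "(A + 1) * real n powr \<alpha> \<le> A * real n powr \<alpha>" using G(3) by (simp add: \<beta>_def)
    moreover have "0 < real n powr \<alpha>" using n by simp
    ultimately show False by (simp add: algebra_simps)
  qed
  define r where "r J = (real (card (\<Union>J)) - 2) / (\<beta> * (real (card J) - 1)) - 1" for J :: "'a set set"
  define \<J> where "\<J> = {J. J \<subseteq> ?E \<and> 2 \<le> card J}"
  have f\<J>: "finite \<J>" by (rule finite_subset[of _ "Pow ?E"]) (use finE in \<open>auto simp: \<J>_def\<close>)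
  \<comment> \<open>\<open>r J\<close> is the relative margin of \<open>J\<close>;
    \<open>\<alpha> / \<beta>\<close> is the cap demanded by \<open>supersaturated\<close>.\<close>
  define \<epsilon> where "\<epsilon> = Min (insert (\<alpha> / \<beta>) (r ` \<J>))"
  have r_pos: "0 < r J" if "J \<in> \<J>" for J
    using dens[of J] that \<beta> by (simp add: r_def \<J>_def field_simps)
  have \<epsilon>0: "0 < \<epsilon>" using f\<J> r_pos \<beta> assms(3) by (auto simp: \<epsilon>_def)
  have "\<epsilon> \<le> \<alpha> / \<beta>" using f\<J> by (simp add: \<epsilon>_def)
  then have \<epsilon>1: "\<beta> * \<epsilon> \<le> \<alpha>" using \<beta> by (simp add: field_simps)
  have \<epsilon>2: "(1 + \<epsilon>) * \<beta> * (real (card J) - 1) \<le> real (card (\<Union>J)) - 2" if J: "J \<subseteq> ?E" "2 \<le> card J" for J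
  proof -
    have "\<epsilon> \<le> r J" using f\<J> J by (auto simp: \<epsilon>_def \<J>_def)
    then have "1 + \<epsilon> \<le> (real (card (\<Union>J)) - 2) / (\<beta> * (real (card J) - 1))" by (simp add: r_def)
    moreover have "0 < \<beta> * (real (card J) - 1)" using \<beta> J by simp
    ultimately show ?thesis by (simp add: pos_le_divide_eq mult.assoc)
  qed
  interpret supersaturated ?E \<alpha> A \<epsilon>
  proof
    show "\<exists>X\<subseteq>G'. copy_of ?E X" if "finite R" "R \<noteq> {}" "G' \<subseteq> pairs R"
      "A * real (card R) powr \<alpha> < real (card G')" for R :: "nat set" and G'
      using bound[OF that(1-3)] that(4) by (meson not_less)
    show "?E \<noteq> {}" using Z by auto
    show "finite ?E" by (fact finE)
    show "card x = 2" if "x \<in> ?E" for x using edge[OF that] by simp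
    show "(2 - \<alpha>) * \<epsilon> \<le> \<alpha>" using \<epsilon>1 by (simp add: \<beta>_def)
    show "(1 + \<epsilon>) * (2 - \<alpha>) * (real (card J) - 1) \<le> real (card (\<Union>J)) - 2"
      if "J \<subseteq> ?E" "2 \<le> card J" for J using \<epsilon>2[OF that] by (simp add: \<beta>_def)
  qed (fact assms(3) True assms(4) \<epsilon>0)+
  obtain M where M: "\<forall>n G. n > 0 \<longrightarrow> G \<subseteq> pairs {1..n} \<longrightarrow>
      real (card (free_sets ?E G)) \<le> exp (M * real n powr \<alpha>)"
    using free_sets_bound by (elim exE)
  define h where "h = real (card (verts H))"
  \<comment> \<open>\<open>M / ln 2\<close> changes the base from e to 2; \<open>h ^ 2\<close>
    covers n below the number of vertices of \<open>H\<close>, where every graph is H-free.\<close>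
  define C where "C = max (M / ln 2) (h ^ 2)"
  have "real (card (labeled_free_graphs n H)) \<le> 2 powr (C * real n powr \<alpha>)" for n
  proof (cases "n = 0 \<or> n < card (verts H)")
    case True
    have "real n ^ 2 \<le> C * real n powr \<alpha>"
    \<comment> \<open>For n = 0 both sides are 0, since \<open>0 powr \<alpha> = 0\<close>.\<close>
    proof (cases "n = 0")
      case False
      then have "real n ^ 2 \<le> h ^ 2" using True unfolding h_def by (intro power_mono) auto
      also have "\<dots> \<le> C * 1" by (simp add: C_def)
      also have "\<dots> \<le> C * real n powr \<alpha>"
      proof (rule mult_left_mono)
        show "1 \<le> real n powr \<alpha>" using False assms(3) by (intro ge_one_powr_ge_zero) auto
        have "0 \<le> h ^ 2" by simp
        then show "0 \<le> C" unfolding C_def by linarith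
      qed
      finally show ?thesis .
    qed simp
    then have "2 powr (real n ^ 2) \<le> 2 powr (C * real n powr \<alpha>)" by (intro powr_mono) auto
    then show ?thesis using card_labeled_le[of n H] by (rule order_trans[rotated])
  next
    case False
    then have "real (card (labeled_free_graphs n H)) \<le> real (card (free_sets ?E (pairs {1..n})))"
      using card_labeled_le_free_sets[OF assms(1), of n] by simp
    also have "\<dots> \<le> exp (M * real n powr \<alpha>)" using M False by auto
    also have "\<dots> = 2 powr (M / ln 2 * real n powr \<alpha>)" by (simp add: powr_def)
    also have "\<dots> \<le> 2 powr (C * real n powr \<alpha>)"
      by (intro powr_mono mult_right_mono) (auto simp: C_def)
    finally show ?thesis .
  qed
  then show ?thesis by blast
qed

end
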